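(* Let $\mathbf Y=\mathbf H(\mathcal Z,\mathbf Y)$ be a well-founded system with solution $\mathbf S$ satisfying $\mathbf S(\mathbf 0)=\mathbf H^m(\mathbf 0,\mathbf 0)$. Let $(\mathbf Y^{[n]})_{n\ge0}$ be defined by $\mathbf Y^{[0]}=\mathbf S(\mathbf 0)$ and $\mathbf Y^{[n+1]}=\big(\mathbf N_{\mathbf H}(\mathcal Z,\mathbf Y^{[n]})\big)_{\le 2^{n+1}-1}$, where $$\mathbf N_{\mathbf H}(\mathcal Z,\mathbf Y)=\mathbf Y+\Big(\sum_{k\ge0}\Big(\frac{\partial\mathbf H}{\partial\mathbf Y}(\mathcal Z,\mathbf Y)\Big)^k\Big)\cdot\big(\mathbf H(\mathcal Z,\mathbf Y)-\mathbf Y\big).$$ Then for all $n\ge0$, $\mathbf Y^{[n]}$ has contact of order $2^n-1$ with $\mathbf S$.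
   Context: Species (multisort) are functorial assignments of finite sets of structures to tuples of finite sets, up to isomorphism, with standard sum, product, composition and partial derivatives; the Jacobian matrix has entries $\partial\mathcal H_i/\partial\mathcal Y_j$, powers computed with species sums and products, $0$-th power the identity matrix. $\mathcal F_{\le p}$ is the restriction of $\mathcal F$ to structures of size $\le p$; $\mathbf S(\mathbf 0)$ the subspecies of size-$0$ structures. Contact of order $p$ means $\mathcal F_{\le p}\cong\mathcal G_{\le p}$. For $\mathcal F\subset\mathcal G$, $\mathcal G-\mathcal F$ is the species with $\mathcal G=\mathcal F+(\mathcal G-\mathcal F)$. Composition with species having structures on the empty set is defined for species polynomial in the corresponding sorts (finitely many structures of each total size in the other sorts), via isomorphism classes. The system is \emph{well founded} if the iteration $\mathbf Z^{[0]}=\mathbf 0$, $\mathbf Z^{[n+1]}=\mathbf H(\mathcal Z,\mathbf Z^{[n]})$ is well defined (for each $i$, $\mathbf H$ polynomial in $\mathcal Y_i$ or $\mathcal Z^{[n]}_i(0)=0$ for all $n$), converges (eventual contact of every order), and the limit has no coordinate equal to the empty species. $\mathbf H^m(\mathbf 0,\mathbf 0)$ is the $m$-th iterate of $\mathbf Y\mapsto\mathbf H(\mathbf 0,\mathbf Y)$ from $\mathbf 0$. *)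

theory Defs
  imports "HOL-Library.Countable_Set" "HOL-Library.Disjoint_Sets"
begin

section \<open>Multisort species\<close>

text \<open>
  A multisort species with sorts \<open>'s\<close> is a functor from tuples of finite sets and tuples of
  bijections to finite sets. Label sets range over the finite subsets of \<^typ>\<open>nat\<close>, a category
  equivalent to that of all finite sets. Every species on it is isomorphic to one whose
  structures are natural numbers, since each set of structures is finite; this is the type
  \<open>'s species\<close>.
\<close>

record ('s, 'a) prespecies =
  str :: "('s \<Rightarrow> nat set) \<Rightarrow> 'a set"
  trn :: "('s \<Rightarrow> nat set) \<Rightarrow> ('s \<Rightarrow> nat \<Rightarrow> nat) \<Rightarrow> 'a \<Rightarrow> 'a"

type_synonym 's species = "('s, nat) prespecies"

definition fin_tuple :: "('s \<Rightarrow> nat set) \<Rightarrow> bool" where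
  "fin_tuple U \<longleftrightarrow> (\<forall>s. finite (U s))"

definition bij_tuple :: "('s \<Rightarrow> nat \<Rightarrow> nat) \<Rightarrow> ('s \<Rightarrow> nat set) \<Rightarrow> ('s \<Rightarrow> nat set) \<Rightarrow> bool" where
  "bij_tuple \<sigma> U V \<longleftrightarrow> (\<forall>s. bij_betw (\<sigma> s) (U s) (V s))"

definition image_tuple :: "('s \<Rightarrow> nat \<Rightarrow> nat) \<Rightarrow> ('s \<Rightarrow> nat set) \<Rightarrow> 's \<Rightarrow> nat set" where
  "image_tuple \<sigma> U = (\<lambda>s. \<sigma> s ` U s)"

definition size_tuple :: "('s::finite \<Rightarrow> nat set) \<Rightarrow> nat" where
  "size_tuple U = (\<Sum>s\<in>UNIV. card (U s))"

text \<open>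
  \<open>trn F U \<sigma>\<close> is the transport of structures along \<open>\<sigma>\<close>, of which only the restriction to \<open>U\<close>
  matters.
\<close>

definition is_species :: "('s, 'a) prespecies \<Rightarrow> bool" where
  "is_species F \<longleftrightarrow>
     (\<forall>U. fin_tuple U \<longrightarrow> finite (str F U)) \<and>
     (\<forall>U V \<sigma>. fin_tuple U \<longrightarrow> bij_tuple \<sigma> U V \<longrightarrow>
        (\<forall>x\<in>str F U. trn F U \<sigma> x \<in> str F V)) \<and>
     (\<forall>U V \<sigma> \<tau>. fin_tuple U \<longrightarrow> bij_tuple \<sigma> U V \<longrightarrow> (\<forall>s. \<forall>u\<in>U s. \<sigma> s u = \<tau> s u) \<longrightarrow>
        (\<forall>x\<in>str F U. trn F U \<sigma> x = trn F U \<tau> x)) \<and>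
     (\<forall>U. fin_tuple U \<longrightarrow> (\<forall>x\<in>str F U. trn F U (\<lambda>s u. u) x = x)) \<and>
     (\<forall>U V W \<sigma> \<tau>. fin_tuple U \<longrightarrow> bij_tuple \<sigma> U V \<longrightarrow> bij_tuple \<tau> V W \<longrightarrow>
        (\<forall>x\<in>str F U. trn F V \<tau> (trn F U \<sigma> x) = trn F U (\<lambda>s. \<tau> s \<circ> \<sigma> s) x))"

definition iso :: "('s, 'a) prespecies \<Rightarrow> ('s, 'b) prespecies \<Rightarrow> bool" (infix \<open>\<cong>\<close> 50) where
  "F \<cong> G \<longleftrightarrow> (\<exists>\<phi>.
     (\<forall>U. fin_tuple U \<longrightarrow> bij_betw (\<phi> U) (str F U) (str G U)) \<and>
     (\<forall>U V \<sigma>. fin_tuple U \<longrightarrow> bij_tuple \<sigma> U V \<longrightarrow>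
        (\<forall>x\<in>str F U. \<phi> V (trn F U \<sigma> x) = trn G U \<sigma> (\<phi> U x))))"

text \<open>
  Replaces a species by an isomorphic one whose structures are natural numbers, so that the
  operations below stay within the type \<open>'s species\<close> and can be iterated.
\<close>

definition encode :: "('s, 'a) prespecies \<Rightarrow> 's species" where
  "encode F = \<lparr>
     str = (\<lambda>U. to_nat_on (str F U) ` str F U),
     trn = (\<lambda>U \<sigma> x. to_nat_on (str F (image_tuple \<sigma> U)) (trn F U \<sigma> (from_nat_into (str F U) x)))
   \<rparr>"


section \<open>Operations\<close>

definition szero :: "'s species" where
  "szero = \<lparr> str = (\<lambda>U. {}), trn = (\<lambda>U \<sigma> x. x) \<rparr>"

definition sone :: "'s species" where
  "sone = \<lparr> str = (\<lambda>U. if U = (\<lambda>s. {}) then {0} else {}), trn = (\<lambda>U \<sigma> x. x) \<rparr>"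

definition singleton :: "'s \<Rightarrow> 's species" where
  "singleton s = \<lparr>
     str = (\<lambda>U. if \<exists>u. U = (\<lambda>t. if t = s then {u} else {}) then {0} else {}),
     trn = (\<lambda>U \<sigma> x. x) \<rparr>"

definition splus :: "'s species \<Rightarrow> 's species \<Rightarrow> 's species" where
  "splus F G = encode \<lparr>
     str = (\<lambda>U. str F U <+> str G U),
     trn = (\<lambda>U \<sigma>. map_sum (trn F U \<sigma>) (trn G U \<sigma>)) \<rparr>"

definition ssum :: "'i set \<Rightarrow> ('i \<Rightarrow> 's species) \<Rightarrow> 's species" where
  "ssum I F = encode \<lparr>
     str = (\<lambda>U. SIGMA i:I. str (F i) U),
     trn = (\<lambda>U \<sigma> (i, x). (i, trn (F i) U \<sigma> x)) \<rparr>"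

text \<open>
  In a product structure \<open>(A, x, y)\<close>, the labels \<open>A\<close> carry \<open>x\<close> and the remaining ones carry \<open>y\<close>.
\<close>

definition stimes :: "'s species \<Rightarrow> 's species \<Rightarrow> 's species" where
  "stimes F G = encode \<lparr>
     str = (\<lambda>U. {(A, x, y). (\<forall>s. A s \<subseteq> U s) \<and> x \<in> str F A \<and> y \<in> str G (\<lambda>s. U s - A s)}),
     trn = (\<lambda>U \<sigma> (A, x, y).
       (image_tuple \<sigma> A, trn F A \<sigma> x, trn G (\<lambda>s. U s - A s) \<sigma> y)) \<rparr>"

text \<open>
  An \<open>F(G)\<close>-assembly \<open>(A, B, f, g)\<close> on \<open>U\<close> consists of an \<open>F\<close>-structure \<open>f\<close> on a tuple \<open>A\<close> of
  finite sets of points together with, for each point \<open>a\<close> of sort \<open>t\<close>, a \<open>G t\<close>-structure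
  \<open>g t a\<close> on \<open>B t a\<close>, where the (possibly empty) blocks \<open>B t a\<close> are disjoint with union \<open>U\<close>.
  The values of \<open>B\<close> and \<open>g\<close> outside \<open>A\<close> are fixed by convention.

  The structures of \<open>F(G)\<close> are the assemblies up to renaming of the points. If no \<open>G t\<close> has a
  structure on the empty set, the points can be identified with their blocks and this is the
  usual partitional composition; otherwise it is the composition by isomorphism classes, which
  gives finite sets of structures if \<open>F\<close> is polynomial in the sorts concerned.
\<close>

type_synonym ('t, 's) assembly =
  "('t \<Rightarrow> nat set) \<times> ('t \<Rightarrow> nat \<Rightarrow> 's \<Rightarrow> nat set) \<times> nat \<times> ('t \<Rightarrow> nat \<Rightarrow> nat)"

definition assemblies ::
  "'t species \<Rightarrow> ('t \<Rightarrow> 's species) \<Rightarrow> ('s \<Rightarrow> nat set) \<Rightarrow> ('t, 's) assembly set" where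
  "assemblies F G U = {(A, B, f, g).
     fin_tuple A \<and> f \<in> str F A \<and>
     (\<forall>t. \<forall>a\<in>A t. g t a \<in> str (G t) (B t a)) \<and>
     (\<forall>t a. a \<notin> A t \<longrightarrow> B t a = (\<lambda>s. {}) \<and> g t a = 0) \<and>
     (\<forall>s. disjoint_family_on (\<lambda>(t, a). B t a s) (Sigma UNIV A) \<and>
          (\<Union>(t, a)\<in>Sigma UNIV A. B t a s) = U s)}"

definition assembly_rel ::
  "'t species \<Rightarrow> ('t \<Rightarrow> 's species) \<Rightarrow> ('s \<Rightarrow> nat set) \<Rightarrow>
     (('t, 's) assembly \<times> ('t, 's) assembly) set" where
  "assembly_rel F G U = {((A, B, f, g), (A', B', f', g')).
     (A, B, f, g) \<in> assemblies F G U \<and> (A', B', f', g') \<in> assemblies F G U \<and>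
     (\<exists>\<rho>. bij_tuple \<rho> A A' \<and> trn F A \<rho> f = f' \<and>
          (\<forall>t. \<forall>a\<in>A t. B' t (\<rho> t a) = B t a \<and> g' t (\<rho> t a) = g t a))}"

definition relabel ::
  "('t \<Rightarrow> 's species) \<Rightarrow> ('s \<Rightarrow> nat \<Rightarrow> nat) \<Rightarrow> ('t, 's) assembly \<Rightarrow> ('t, 's) assembly" where
  "relabel G \<sigma> = (\<lambda>(A, B, f, g).
     (A, \<lambda>t a. image_tuple \<sigma> (B t a), f,
      \<lambda>t a. if a \<in> A t then trn (G t) (B t a) \<sigma> (g t a) else 0))"

definition scomp :: "'t species \<Rightarrow> ('t \<Rightarrow> 's species) \<Rightarrow> 's species" where
  "scomp F G = encode \<lparr>
     str = (\<lambda>U. assemblies F G U // assembly_rel F G U),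
     trn = (\<lambda>U \<sigma> c. relabel G \<sigma> ` c) \<rparr>"

text \<open>
  The extra label of sort \<open>s\<close> in a structure of the derivative is \<open>0\<close>, the labels in \<open>U s\<close> being
  shifted by one to make room for it.
\<close>

definition spderiv :: "'s \<Rightarrow> 's species \<Rightarrow> 's species" where
  "spderiv s F = \<lparr>
     str = (\<lambda>U. str F (U(s := insert 0 (Suc ` U s)))),
     trn = (\<lambda>U \<sigma>. trn F (U(s := insert 0 (Suc ` U s)))
                       (\<sigma>(s := case_nat 0 (\<lambda>u. Suc (\<sigma> s u))))) \<rparr>"

definition srestr :: "nat \<Rightarrow> 's::finite species \<Rightarrow> 's species" where
  "srestr p F = F\<lparr> str := \<lambda>U. if size_tuple U \<le> p then str F U else {} \<rparr>"

abbreviation at_zero :: "'s::finite species \<Rightarrow> 's species" where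
  "at_zero F \<equiv> srestr 0 F"

definition contact :: "nat \<Rightarrow> 's::finite species \<Rightarrow> 's species \<Rightarrow> bool" where
  "contact p F G \<longleftrightarrow> srestr p F \<cong> srestr p G"

text \<open>
  Defined only if \<open>F\<close> is isomorphic to a subspecies of \<open>G\<close>; the result is then unique up to
  isomorphism.
\<close>

definition sminus :: "'s species \<Rightarrow> 's species \<Rightarrow> 's species" where
  "sminus G F = (SOME D. is_species D \<and> G \<cong> splus F D)"


section \<open>Matrices of species\<close>

definition mat_one :: "'n \<Rightarrow> 'n \<Rightarrow> 's species" where
  "mat_one i j = (if i = j then sone else szero)"

definition mat_mult ::
  "('n \<Rightarrow> 'n::finite \<Rightarrow> 's species) \<Rightarrow> ('n \<Rightarrow> 'n \<Rightarrow> 's species) \<Rightarrow> 'n \<Rightarrow> 'n \<Rightarrow> 's species" where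
  "mat_mult M N i j = ssum UNIV (\<lambda>k. stimes (M i k) (N k j))"

definition mat_vec ::
  "('n \<Rightarrow> 'n::finite \<Rightarrow> 's species) \<Rightarrow> ('n \<Rightarrow> 's species) \<Rightarrow> 'n \<Rightarrow> 's species" where
  "mat_vec M v i = ssum UNIV (\<lambda>k. stimes (M i k) (v k))"

primrec mat_pow :: "('n \<Rightarrow> 'n::finite \<Rightarrow> 's species) \<Rightarrow> nat \<Rightarrow> 'n \<Rightarrow> 'n \<Rightarrow> 's species" where
  "mat_pow M 0 = mat_one"
| "mat_pow M (Suc k) = mat_mult M (mat_pow M k)"

definition mat_geom :: "('n \<Rightarrow> 'n::finite \<Rightarrow> 's species) \<Rightarrow> 'n \<Rightarrow> 'n \<Rightarrow> 's species" where
  "mat_geom M i j = ssum (UNIV :: nat set) (\<lambda>k. mat_pow M k i j)"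


section \<open>Systems \<open>Y = H(Z, Y)\<close>\<close>

text \<open>
  A system is a family \<open>H\<close> of species whose sorts are those of \<open>Z\<close> (\<open>Inl\<close>) and of \<open>Y\<close> (\<open>Inr\<close>).
\<close>

definition subst_ZY :: "('z + 'n) species \<Rightarrow> ('n \<Rightarrow> 'z species) \<Rightarrow> 'z species" where
  "subst_ZY F Y = scomp F (case_sum singleton Y)"

definition subst_0Y :: "('z + 'n) species \<Rightarrow> ('n \<Rightarrow> 'z species) \<Rightarrow> 'z species" where
  "subst_0Y F Y = scomp F (case_sum (\<lambda>_. szero) Y)"

primrec iter_Z :: "('n \<Rightarrow> ('z + 'n) species) \<Rightarrow> nat \<Rightarrow> 'n \<Rightarrow> 'z species" where
  "iter_Z H 0 = (\<lambda>i. szero)"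
| "iter_Z H (Suc n) = (\<lambda>i. subst_ZY (H i) (iter_Z H n))"

primrec iter_0 :: "('n \<Rightarrow> ('z + 'n) species) \<Rightarrow> nat \<Rightarrow> 'n \<Rightarrow> 'z species" where
  "iter_0 H 0 = (\<lambda>i. szero)"
| "iter_0 H (Suc n) = (\<lambda>i. subst_0Y (H i) (iter_0 H n))"

text \<open>
  Finitely many structures, counted on the standard label sets \<open>{..<n s}\<close> (which represent all
  isomorphism classes), of each total size in the sorts other than \<open>t\<close>.
\<close>

definition polynomial_in :: "'s::finite \<Rightarrow> 's species \<Rightarrow> bool" where
  "polynomial_in t F \<longleftrightarrow>
     (\<forall>q. finite {(n, x). (\<Sum>s\<in>UNIV - {t}. n s) = q \<and> x \<in> str F (\<lambda>s. {..<n s})})"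

text \<open>
  The condition on each sort separately does not ensure that the iterates have finite sets of
  structures (with \<open>H\<^sub>1 = \<Sum>k. Y\<^sub>1\<^sup>k Y\<^sub>2\<^sup>k\<close> and \<open>H\<^sub>2 = 1\<close>, the second iterate has infinitely many
  structures on the empty set), hence the requirement that they be species.
\<close>

definition iter_well_defined :: "('n::finite \<Rightarrow> ('z::finite + 'n) species) \<Rightarrow> bool" where
  "iter_well_defined H \<longleftrightarrow>
     (\<forall>j. (\<forall>i. polynomial_in (Inr j) (H i)) \<or> (\<forall>n. at_zero (iter_Z H n j) \<cong> (szero :: 'z species))) \<and>
     (\<forall>n i. is_species (iter_Z H n i))"

definition converges_to :: "(nat \<Rightarrow> 'n \<Rightarrow> 'z::finite species) \<Rightarrow> ('n \<Rightarrow> 'z species) \<Rightarrow> bool" where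
  "converges_to X L \<longleftrightarrow> (\<forall>p. \<exists>N. \<forall>n\<ge>N. \<forall>i. contact p (X n i) (L i))"

definition well_founded :: "('n::finite \<Rightarrow> ('z::finite + 'n) species) \<Rightarrow> bool" where
  "well_founded H \<longleftrightarrow> iter_well_defined H \<and>
     (\<exists>L. (\<forall>i. is_species (L i)) \<and> converges_to (iter_Z H) L \<and>
          (\<forall>i. \<not> L i \<cong> (szero :: 'z species)))"

definition jacobian ::
  "('n \<Rightarrow> ('z + 'n) species) \<Rightarrow> ('n \<Rightarrow> 'z species) \<Rightarrow> 'n \<Rightarrow> 'n \<Rightarrow> 'z species" where
  "jacobian H Y i j = subst_ZY (spderiv (Inr j) (H i)) Y"

definition newton ::
  "('n::finite \<Rightarrow> ('z + 'n) species) \<Rightarrow> ('n \<Rightarrow> 'z species) \<Rightarrow> 'n \<Rightarrow> 'z species" where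
  "newton H Y i = splus (Y i)
     (mat_vec (mat_geom (jacobian H Y)) (\<lambda>j. sminus (subst_ZY (H j) Y) (Y j)) i)"

primrec newton_iter ::
  "('n::finite \<Rightarrow> ('z::finite + 'n) species) \<Rightarrow> ('n \<Rightarrow> 'z species) \<Rightarrow> nat \<Rightarrow> 'n \<Rightarrow> 'z species" where
  "newton_iter H Y0 0 = Y0"
| "newton_iter H Y0 (Suc n) = (\<lambda>i. srestr (2 ^ (n + 1) - 1) (newton H (newton_iter H Y0 n) i))"

end

theory Submission
  imports Defs
begin

text \<open>
  By induction, the iterate \<open>Y\<close> of index \<open>n\<close> is the truncation of \<open>S\<close> at size \<open>p = 2\<^sup>n - 1\<close>. Let \<open>E\<close> be
  the part of \<open>S\<close> of size greater than \<open>p\<close>. An \<open>H(Z, S)\<close>-assembly with at most \<open>2p + 1\<close> labels has at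
  most one block carrying an \<open>E\<close>-structure, hence \<open>H(Z, S) = H(Z, Y) + J \<cdot> E\<close> up to size \<open>2p + 1\<close>, with
  \<open>J\<close> the Jacobian matrix at \<open>Y\<close>. Cancelling \<open>Y\<close>, which only involves sizes at most \<open>p\<close>, from
  \<open>S = H(Z, S)\<close> gives \<open>E = D + J \<cdot> E\<close> with \<open>D = H(Z, Y) - Y\<close>, an equation also satisfied by the Newton
  correction \<open>(\<Sum>k. J\<^sup>k) \<cdot> D\<close>. Its solution is unique because the matrix of structures of size \<open>0\<close> of
  \<open>J\<close> is nilpotent: around a cycle of such structures, counting shows that no structure of \<open>S\<close> can be
  the first one to appear in the iteration of \<open>Y \<mapsto> H(Z, Y)\<close>.
\<close>

section \<open>Tuples of label sets\<close>

text \<open>The bound 2p + 1 is the largest size at which two blocks of size at least p + 1 cannot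
  coexist, and 2(2^n - 1) + 1 = 2^(n+1) - 1 makes the order of contact double. Three obstacles shape
  the argument. The Taylor expansion holds only up to a size, and the infinite sum of matrix powers
  is not known beforehand to have finite sets of structures; hence the steps are natural bijections
  in prescribed sizes between countable families, and finiteness of the Newton iterate comes out of
  its comparison with \<open>S\<close>. An isomorphism between A + B and A + C need not restrict to
  one between B and C. Cancellation is therefore done by separating sizes: \<open>Y\<close> lives in
  sizes at most p and the difference \<open>D\<close>, by counting, in sizes above p. Finally,
  \<open>S\<close> is given as a fixed point and is not identified with the limit of the iteration.
  The two are compared through supports alone: a label set carrying a structure of an iterate also
  carries one of \<open>S\<close>.\<close>

lemma size_tuple_bij: "bij_tuple \<sigma> U V \<Longrightarrow> size_tuple V = size_tuple U"
  unfolding bij_tuple_def size_tuple_def by (metis bij_betw_same_card)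

lemma fin_tuple_bij: "fin_tuple U \<Longrightarrow> bij_tuple \<sigma> U V \<Longrightarrow> fin_tuple V"
  unfolding bij_tuple_def fin_tuple_def by (metis bij_betw_finite)

lemma fin_tuple_subset: "fin_tuple U \<Longrightarrow> (\<And>s. A s \<subseteq> U s) \<Longrightarrow> fin_tuple A"
  unfolding fin_tuple_def by (metis finite_subset)

lemma fin_tuple_diff: "fin_tuple U \<Longrightarrow> fin_tuple (\<lambda>s. U s - A s)"
  unfolding fin_tuple_def by auto

lemma image_tuple_bij: "bij_tuple \<sigma> U V \<Longrightarrow> image_tuple \<sigma> U = V"
  unfolding bij_tuple_def image_tuple_def by (auto simp: bij_betw_def)

lemma bij_tuple_subset:
  "bij_tuple \<sigma> U V \<Longrightarrow> (\<And>s. A s \<subseteq> U s) \<Longrightarrow> bij_tuple \<sigma> A (image_tuple \<sigma> A)"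
  unfolding bij_tuple_def image_tuple_def by (meson bij_betw_subset)

lemma image_tuple_diff:
  assumes "bij_tuple \<sigma> U V" "\<And>s. A s \<subseteq> C s" "\<And>s. C s \<subseteq> U s"
  shows "image_tuple \<sigma> (\<lambda>s. C s - A s) = (\<lambda>s. image_tuple \<sigma> C s - image_tuple \<sigma> A s)"
proof
  fix s
  have "inj_on (\<sigma> s) (U s)" using assms(1) by (auto simp: bij_tuple_def bij_betw_def)
  then show "image_tuple \<sigma> (\<lambda>s. C s - A s) s = image_tuple \<sigma> C s - image_tuple \<sigma> A s"
    unfolding image_tuple_def using assms(2,3)
    by (intro inj_on_image_set_diff[of "\<sigma> s" "U s"]) (auto dest: subsetD)
qed

lemma bij_tuple_diff:
  assumes "bij_tuple \<sigma> U V" "\<And>s. A s \<subseteq> U s"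
  shows "bij_tuple \<sigma> (\<lambda>s. U s - A s) (\<lambda>s. V s - image_tuple \<sigma> A s)"
proof -
  have "bij_tuple \<sigma> (\<lambda>s. U s - A s) (image_tuple \<sigma> (\<lambda>s. U s - A s))"
    by (rule bij_tuple_subset[OF assms(1)]) auto
  then show ?thesis
    using image_tuple_diff[OF assms(1) assms(2)] image_tuple_bij[OF assms(1)] by simp
qed

lemma image_tuple_subset: "bij_tuple \<sigma> U V \<Longrightarrow> A s \<subseteq> U s \<Longrightarrow> image_tuple \<sigma> A s \<subseteq> V s"
  unfolding bij_tuple_def image_tuple_def bij_betw_def by blast

lemma bij_tuple_inverse:
  assumes "bij_tuple \<sigma> U V"
  obtains \<tau> where "bij_tuple \<tau> V U" "\<And>s u. u \<in> U s \<Longrightarrow> \<tau> s (\<sigma> s u) = u"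
    "\<And>s v. v \<in> V s \<Longrightarrow> \<sigma> s (\<tau> s v) = v"
proof
  show "bij_tuple (\<lambda>s. inv_into (U s) (\<sigma> s)) V U"
    using assms by (auto simp: bij_tuple_def intro: bij_betw_inv_into)
  show "inv_into (U s) (\<sigma> s) (\<sigma> s u) = u" if "u \<in> U s" for s u
    using assms that by (auto simp: bij_tuple_def bij_betw_def)
  show "\<sigma> s (inv_into (U s) (\<sigma> s) v) = v" if "v \<in> V s" for s v
    using assms that by (auto simp: bij_tuple_def bij_betw_def f_inv_into_f)
qed

lemma size_tuple_mono: "fin_tuple U \<Longrightarrow> (\<And>s. A s \<subseteq> U s) \<Longrightarrow> size_tuple A \<le> size_tuple U"
  unfolding size_tuple_def fin_tuple_def by (intro sum_mono card_mono) auto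

lemma size_tuple_diff:
  assumes "fin_tuple U" "\<And>s. A s \<subseteq> U s"
  shows "size_tuple (\<lambda>s. U s - A s) + size_tuple A = size_tuple U"
proof -
  have "card (U s - A s) + card (A s) = card (U s)" for s
    using assms by (metis card_Diff_subset card_mono diff_add fin_tuple_def finite_subset)
  then show ?thesis unfolding size_tuple_def by (simp add: sum.distrib[symmetric])
qed

lemma size_tuple_eq_0: "fin_tuple U \<Longrightarrow> size_tuple U = 0 \<Longrightarrow> U = (\<lambda>s. {})"
  unfolding size_tuple_def fin_tuple_def by auto

lemma finite_subtuples:
  fixes U :: "'s::finite \<Rightarrow> nat set"
  assumes "fin_tuple U"
  shows "finite {A. \<forall>s. A s \<subseteq> U s}"
proof -
  have "{A. \<forall>s. A s \<subseteq> U s} = Pi\<^sub>E UNIV (\<lambda>s. Pow (U s))" by (auto simp: PiE_def Pi_def)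
  moreover have "finite (Pi\<^sub>E (UNIV::'s set) (\<lambda>s. Pow (U s)))"
    using assms by (intro finite_PiE) (auto simp: fin_tuple_def)
  ultimately show ?thesis by simp
qed


section \<open>Natural isomorphisms in prescribed sizes\<close>

text \<open>
  The functor laws are not required. Countability is what makes \<open>encode\<close> an isomorphism; infinite
  sets of structures are allowed because of the infinite sum in \<open>mat_geom\<close>.
\<close>

definition admissible :: "('s, 'a) prespecies \<Rightarrow> bool" where
  "admissible F \<longleftrightarrow>
     (\<forall>U. fin_tuple U \<longrightarrow> countable (str F U)) \<and>
     (\<forall>U V \<sigma>. fin_tuple U \<longrightarrow> bij_tuple \<sigma> U V \<longrightarrow> (\<forall>x\<in>str F U. trn F U \<sigma> x \<in> str F V))"

lemma admissibleI:
  assumes "\<And>U. fin_tuple U \<Longrightarrow> countable (str F U)"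
    and "\<And>U V \<sigma> x. fin_tuple U \<Longrightarrow> bij_tuple \<sigma> U V \<Longrightarrow> x \<in> str F U \<Longrightarrow> trn F U \<sigma> x \<in> str F V"
  shows "admissible F"
  using assms unfolding admissible_def by blast

lemma admissible_countable: "admissible F \<Longrightarrow> fin_tuple U \<Longrightarrow> countable (str F U)"
  unfolding admissible_def by blast

lemma admissible_trn:
  "admissible F \<Longrightarrow> fin_tuple U \<Longrightarrow> bij_tuple \<sigma> U V \<Longrightarrow> x \<in> str F U \<Longrightarrow> trn F U \<sigma> x \<in> str F V"
  unfolding admissible_def by blast

section \<open>Functor laws of species as separate rules\<close>

lemma
  assumes "is_species F" "fin_tuple U"
  shows species_finite: "finite (str F U)"
    and species_id: "x \<in> str F U \<Longrightarrow> trn F U (\<lambda>s u. u) x = x"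
  using assms unfolding is_species_def by auto

lemma
  assumes "is_species F" "fin_tuple U" "bij_tuple \<sigma> U V" "x \<in> str F U"
  shows species_trn: "trn F U \<sigma> x \<in> str F V"
    and species_cong: "(\<And>s u. u \<in> U s \<Longrightarrow> \<sigma> s u = \<tau> s u) \<Longrightarrow> trn F U \<sigma> x = trn F U \<tau> x"
    and species_comp: "bij_tuple \<tau>' V W \<Longrightarrow> trn F V \<tau>' (trn F U \<sigma> x) = trn F U (\<lambda>s. \<tau>' s \<circ> \<sigma> s) x"
proof -
  note F = assms(1)[unfolded is_species_def]
  show "trn F U \<sigma> x \<in> str F V"
    using conjunct1[OF conjunct2[OF F]] assms(2-4) by blast
  show "trn F U \<sigma> x = trn F U \<tau> x" if "\<And>s u. u \<in> U s \<Longrightarrow> \<sigma> s u = \<tau> s u"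
    using conjunct1[OF conjunct2[OF conjunct2[OF F]]] assms(2-4) that by blast
  show "trn F V \<tau>' (trn F U \<sigma> x) = trn F U (\<lambda>s. \<tau>' s \<circ> \<sigma> s) x" if "bij_tuple \<tau>' V W"
    using conjunct2[OF conjunct2[OF conjunct2[OF conjunct2[OF F]]]] assms(2-4) that by blast
qed

lemma is_speciesI:
  assumes "\<And>U. fin_tuple U \<Longrightarrow> finite (str F U)"
    and "\<And>U V \<sigma> x. fin_tuple U \<Longrightarrow> bij_tuple \<sigma> U V \<Longrightarrow> x \<in> str F U \<Longrightarrow> trn F U \<sigma> x \<in> str F V"
    and "\<And>U V \<sigma> \<tau> x. fin_tuple U \<Longrightarrow> bij_tuple \<sigma> U V \<Longrightarrow> (\<And>s u. u \<in> U s \<Longrightarrow> \<sigma> s u = \<tau> s u) \<Longrightarrow>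
      x \<in> str F U \<Longrightarrow> trn F U \<sigma> x = trn F U \<tau> x"
    and "\<And>U x. fin_tuple U \<Longrightarrow> x \<in> str F U \<Longrightarrow> trn F U (\<lambda>s u. u) x = x"
    and "\<And>U V W \<sigma> \<tau> x. fin_tuple U \<Longrightarrow> bij_tuple \<sigma> U V \<Longrightarrow> bij_tuple \<tau> V W \<Longrightarrow> x \<in> str F U \<Longrightarrow>
      trn F V \<tau> (trn F U \<sigma> x) = trn F U (\<lambda>s. \<tau> s \<circ> \<sigma> s) x"
  shows "is_species F"
  unfolding is_species_def
  apply (intro conjI allI impI ballI)
      apply (erule assms(1))
     apply (erule (2) assms(2))
    apply (erule (1) assms(3); blast)
   apply (erule (1) assms(4))
  apply (erule (3) assms(5))
  done

lemma is_species_admissible: "is_species F \<Longrightarrow> admissible F"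
  by (rule admissibleI) (auto intro: countable_finite species_finite species_trn)

text \<open>Selecting label sets by total size is harmless for naturality, since transport preserves
  the size. Admissibility of both sides is built in so that chains of isomorphisms carry it
  along.\<close>

definition iso_on ::
  "(nat \<Rightarrow> bool) \<Rightarrow> ('s::finite, 'a) prespecies \<Rightarrow> ('s, 'b) prespecies \<Rightarrow> bool" where
  "iso_on P F G \<longleftrightarrow> admissible F \<and> admissible G \<and> (\<exists>\<phi>.
     (\<forall>U. fin_tuple U \<longrightarrow> P (size_tuple U) \<longrightarrow> bij_betw (\<phi> U) (str F U) (str G U)) \<and>
     (\<forall>U V \<sigma>. fin_tuple U \<longrightarrow> P (size_tuple U) \<longrightarrow> bij_tuple \<sigma> U V \<longrightarrow>
        (\<forall>x\<in>str F U. \<phi> V (trn F U \<sigma> x) = trn G U \<sigma> (\<phi> U x))))"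

abbreviation iso_all :: "('s::finite, 'a) prespecies \<Rightarrow> ('s, 'b) prespecies \<Rightarrow> bool" where
  "iso_all \<equiv> iso_on (\<lambda>_. True)"

lemma iso_onI:
  assumes "admissible F" "admissible G"
    and "\<And>U. fin_tuple U \<Longrightarrow> P (size_tuple U) \<Longrightarrow> bij_betw (\<phi> U) (str F U) (str G U)"
    and "\<And>U V \<sigma> x. fin_tuple U \<Longrightarrow> P (size_tuple U) \<Longrightarrow> bij_tuple \<sigma> U V \<Longrightarrow> x \<in> str F U \<Longrightarrow>
      \<phi> V (trn F U \<sigma> x) = trn G U \<sigma> (\<phi> U x)"
  shows "iso_on P F G"
  unfolding iso_on_def using assms by blast

lemma iso_onE:
  assumes "iso_on P F G"
  obtains \<phi> where "admissible F" "admissible G"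
    and "\<And>U. fin_tuple U \<Longrightarrow> P (size_tuple U) \<Longrightarrow> bij_betw (\<phi> U) (str F U) (str G U)"
    and "\<And>U V \<sigma> x. fin_tuple U \<Longrightarrow> P (size_tuple U) \<Longrightarrow> bij_tuple \<sigma> U V \<Longrightarrow> x \<in> str F U \<Longrightarrow>
      \<phi> V (trn F U \<sigma> x) = trn G U \<sigma> (\<phi> U x)"
proof -
  obtain \<phi> where "admissible F" "admissible G"
    "\<forall>U. fin_tuple U \<longrightarrow> P (size_tuple U) \<longrightarrow> bij_betw (\<phi> U) (str F U) (str G U)"
    "\<forall>U V \<sigma>. fin_tuple U \<longrightarrow> P (size_tuple U) \<longrightarrow> bij_tuple \<sigma> U V \<longrightarrow>
        (\<forall>x\<in>str F U. \<phi> V (trn F U \<sigma> x) = trn G U \<sigma> (\<phi> U x))"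
    using assms unfolding iso_on_def by blast
  then show thesis by (intro that[of \<phi>]) blast+
qed

text \<open>Structures of a composition are equivalence classes, on which maps are awkward to
  define. A natural relation, total and unique on both sides, gives the isomorphism with no
  compatible choice of representatives.\<close>

lemma iso_on_relI:
  assumes F: "admissible F" and G: "admissible G"
    and left_total: "\<And>U x. fin_tuple U \<Longrightarrow> P (size_tuple U) \<Longrightarrow> x \<in> str F U \<Longrightarrow>
      \<exists>y\<in>str G U. R U x y"
    and right_total: "\<And>U y. fin_tuple U \<Longrightarrow> P (size_tuple U) \<Longrightarrow> y \<in> str G U \<Longrightarrow>
      \<exists>x\<in>str F U. R U x y"
    and right_unique: "\<And>U x y y'. fin_tuple U \<Longrightarrow> P (size_tuple U) \<Longrightarrow> x \<in> str F U \<Longrightarrow>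
      y \<in> str G U \<Longrightarrow> y' \<in> str G U \<Longrightarrow> R U x y \<Longrightarrow> R U x y' \<Longrightarrow> y = y'"
    and left_unique: "\<And>U x x' y. fin_tuple U \<Longrightarrow> P (size_tuple U) \<Longrightarrow> x \<in> str F U \<Longrightarrow>
      x' \<in> str F U \<Longrightarrow> y \<in> str G U \<Longrightarrow> R U x y \<Longrightarrow> R U x' y \<Longrightarrow> x = x'"
    and natural: "\<And>U V \<sigma> x y. fin_tuple U \<Longrightarrow> P (size_tuple U) \<Longrightarrow> bij_tuple \<sigma> U V \<Longrightarrow>
      x \<in> str F U \<Longrightarrow> y \<in> str G U \<Longrightarrow> R U x y \<Longrightarrow> R V (trn F U \<sigma> x) (trn G U \<sigma> y)"
  shows "iso_on P F G"
proof -
  define \<phi> where "\<phi> U x = (SOME y. y \<in> str G U \<and> R U x y)" for U x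
  have \<phi>: "\<phi> U x \<in> str G U \<and> R U x (\<phi> U x)"
    if "fin_tuple U" "P (size_tuple U)" "x \<in> str F U" for U x
    using left_total[OF that] unfolding \<phi>_def by (metis (mono_tags, lifting) someI_ex)
  show ?thesis
  proof (rule iso_onI[OF F G, where \<phi> = \<phi>])
    fix U :: "'a \<Rightarrow> nat set" assume U: "fin_tuple U" "P (size_tuple U)"
    show "bij_betw (\<phi> U) (str F U) (str G U)"
      unfolding bij_betw_def
    proof
      show "inj_on (\<phi> U) (str F U)"
        using \<phi>[OF U] left_unique[OF U] by (metis inj_onI)
      show "\<phi> U ` str F U = str G U"
      proof
        show "\<phi> U ` str F U \<subseteq> str G U" using \<phi>[OF U] by blast
        show "str G U \<subseteq> \<phi> U ` str F U"
        proof
          fix y assume y: "y \<in> str G U"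
          then obtain x where x: "x \<in> str F U" "R U x y" using right_total[OF U] by blast
          then have "y = \<phi> U x" using right_unique[OF U x(1) y] \<phi>[OF U x(1)] by blast
          then show "y \<in> \<phi> U ` str F U" using x by blast
        qed
      qed
    qed
  next
    fix U V \<sigma> x assume *: "fin_tuple U" "P (size_tuple U)" "bij_tuple \<sigma> U V" "x \<in> str F U"
    have V: "fin_tuple V" "P (size_tuple V)"
      using * fin_tuple_bij size_tuple_bij by metis+
    \<comment> \<open>Both sides are related to \<open>trn F U \<sigma> x\<close>, so right
      uniqueness identifies them, whatever choice was made in \<open>\<phi>\<close>.\<close>
    show "\<phi> V (trn F U \<sigma> x) = trn G U \<sigma> (\<phi> U x)"
      using right_unique[OF V] \<phi>[OF V] \<phi>[OF *(1,2,4)] natural[OF *]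
        admissible_trn[OF F *(1,3,4)] admissible_trn[OF G *(1,3)] by metis
  qed
qed

lemma iso_on_admissible1: "iso_on P F G \<Longrightarrow> admissible F"
  and iso_on_admissible2: "iso_on P F G \<Longrightarrow> admissible G"
  unfolding iso_on_def by blast+

lemma iso_on_refl: "admissible F \<Longrightarrow> iso_on P F F"
  by (rule iso_onI[where \<phi> = "\<lambda>U x. x"]) (auto simp: bij_betw_def)

lemma iso_on_sym:
  assumes "iso_on P F G"
  shows "iso_on P G F"
proof -
  obtain \<phi> where F: "admissible F" and G: "admissible G"
    and bij: "\<And>U. fin_tuple U \<Longrightarrow> P (size_tuple U) \<Longrightarrow> bij_betw (\<phi> U) (str F U) (str G U)"
    and nat: "\<And>U V \<sigma> x. fin_tuple U \<Longrightarrow> P (size_tuple U) \<Longrightarrow> bij_tuple \<sigma> U V \<Longrightarrow>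
      x \<in> str F U \<Longrightarrow> \<phi> V (trn F U \<sigma> x) = trn G U \<sigma> (\<phi> U x)"
    using iso_onE[OF assms] by metis
  show ?thesis
  proof (rule iso_on_relI[OF G F, where R = "\<lambda>U y x. \<phi> U x = y"])
    fix U :: "'a \<Rightarrow> nat set" assume U: "fin_tuple U" "P (size_tuple U)"
    note b = bij[OF U]
    show "\<exists>x\<in>str F U. \<phi> U x = y" if "y \<in> str G U" for y
      using bij_betw_imp_surj_on[OF b] that by (metis imageE)
    show "\<exists>y\<in>str G U. \<phi> U x = y" if "x \<in> str F U" for x
      using b that by (auto simp: bij_betw_def)
    show "x = x'" if "\<phi> U x = y" "\<phi> U x' = y" "x \<in> str F U" "x' \<in> str F U" for x x' y
      using b that by (metis bij_betw_def inj_onD)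
  qed (auto simp: nat)
qed

lemma iso_on_trans [trans]:
  assumes "iso_on P F G" "iso_on P G K"
  shows "iso_on P F K"
proof -
  obtain \<phi> where F: "admissible F" and G: "admissible G"
    and bij: "\<And>U. fin_tuple U \<Longrightarrow> P (size_tuple U) \<Longrightarrow> bij_betw (\<phi> U) (str F U) (str G U)"
    and nat: "\<And>U V \<sigma> x. fin_tuple U \<Longrightarrow> P (size_tuple U) \<Longrightarrow> bij_tuple \<sigma> U V \<Longrightarrow>
      x \<in> str F U \<Longrightarrow> \<phi> V (trn F U \<sigma> x) = trn G U \<sigma> (\<phi> U x)"
    using iso_onE[OF assms(1)] by metis
  obtain \<psi> where "admissible G" and K: "admissible K"
    and bij': "\<And>U. fin_tuple U \<Longrightarrow> P (size_tuple U) \<Longrightarrow> bij_betw (\<psi> U) (str G U) (str K U)"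
    and nat': "\<And>U V \<sigma> x. fin_tuple U \<Longrightarrow> P (size_tuple U) \<Longrightarrow> bij_tuple \<sigma> U V \<Longrightarrow>
      x \<in> str G U \<Longrightarrow> \<psi> V (trn G U \<sigma> x) = trn K U \<sigma> (\<psi> U x)"
    using iso_onE[OF assms(2)] by metis
  show ?thesis
  proof (rule iso_onI[OF F K, where \<phi> = "\<lambda>U. \<psi> U \<circ> \<phi> U"])
    fix U V \<sigma> x assume "fin_tuple U" "P (size_tuple U)" "bij_tuple \<sigma> U V" "x \<in> str F U"
    then show "(\<psi> V \<circ> \<phi> V) (trn F U \<sigma> x) = trn K U \<sigma> ((\<psi> U \<circ> \<phi> U) x)"
      using nat nat' bij bij_betwE by fastforce
  qed (blast intro: bij_betw_trans bij bij')
qed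

lemma iso_on_mono: "iso_on P F G \<Longrightarrow> (\<And>k. Q k \<Longrightarrow> P k) \<Longrightarrow> iso_on Q F G"
  unfolding iso_on_def by blast

lemma iso_on_all: "iso_all F G \<Longrightarrow> iso_on P F G"
  by (erule iso_on_mono) simp

text \<open>Transport never changes the total size, so isomorphisms chosen independently for each
  size, without any compatibility between them, glue to a natural one.\<close>

lemma iso_on_sizes:
  assumes F: "admissible F" and G: "admissible G"
    and "\<And>k. P k \<Longrightarrow> iso_on (\<lambda>l. l = k) F G"
  shows "iso_on P F G"
proof -
  have "\<exists>\<phi>. (\<forall>U. fin_tuple U \<longrightarrow> size_tuple U = k \<longrightarrow> bij_betw (\<phi> U) (str F U) (str G U)) \<and>
     (\<forall>U V \<sigma>. fin_tuple U \<longrightarrow> size_tuple U = k \<longrightarrow> bij_tuple \<sigma> U V \<longrightarrow>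
        (\<forall>x\<in>str F U. \<phi> V (trn F U \<sigma> x) = trn G U \<sigma> (\<phi> U x)))" if "P k" for k
    using assms(3)[OF that] unfolding iso_on_def by blast
  then obtain \<phi> where \<phi>: "P k \<Longrightarrow>
     (\<forall>U. fin_tuple U \<longrightarrow> size_tuple U = k \<longrightarrow> bij_betw (\<phi> k U) (str F U) (str G U)) \<and>
     (\<forall>U V \<sigma>. fin_tuple U \<longrightarrow> size_tuple U = k \<longrightarrow> bij_tuple \<sigma> U V \<longrightarrow>
        (\<forall>x\<in>str F U. \<phi> k V (trn F U \<sigma> x) = trn G U \<sigma> (\<phi> k U x)))" for k
    by metis
  show ?thesis
  proof (rule iso_onI[OF F G, where \<phi> = "\<lambda>U. \<phi> (size_tuple U) U"])
    fix U V \<sigma> x assume *: "fin_tuple U" "P (size_tuple U)" "bij_tuple \<sigma> U V" "x \<in> str F U"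
    show "\<phi> (size_tuple V) V (trn F U \<sigma> x) = trn G U \<sigma> (\<phi> (size_tuple U) U x)"
      unfolding size_tuple_bij[OF *(3)] using \<phi>[OF *(2)] * by blast
  qed (use \<phi> in blast)
qed

lemma
  assumes "iso_on P F G" "fin_tuple U" "P (size_tuple U)"
  shows iso_on_nonempty: "str F U = {} \<longleftrightarrow> str G U = {}"
    and iso_on_card: "card (str F U) = card (str G U)"
    and iso_on_finite: "finite (str F U) \<longleftrightarrow> finite (str G U)"
proof -
  obtain h where "bij_betw h (str F U) (str G U)"
    using iso_onE[OF assms(1)] assms(2,3) by metis
  then show "str F U = {} \<longleftrightarrow> str G U = {}" "card (str F U) = card (str G U)"
    "finite (str F U) \<longleftrightarrow> finite (str G U)"
    by (auto simp: bij_betw_same_card bij_betw_finite dest: bij_betw_imp_surj_on)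
qed

lemma iso_on_empty:
  assumes "admissible F" "admissible G"
    and "\<And>U. fin_tuple U \<Longrightarrow> P (size_tuple U) \<Longrightarrow> str F U = {}"
    and "\<And>U. fin_tuple U \<Longrightarrow> P (size_tuple U) \<Longrightarrow> str G U = {}"
  shows "iso_on P F G"
  by (rule iso_onI[OF assms(1,2), where \<phi> = "\<lambda>U x. undefined"])
    (auto simp: assms(3,4) bij_betw_def)

lemma iso_all_iff_iso: "iso_all F G \<longleftrightarrow> admissible F \<and> admissible G \<and> F \<cong> G"
  unfolding iso_on_def iso_def by blast

text \<open>The relation \<cong> by itself does not say that transport in \<open>G\<close> lands in
  the right set; naturality forces it once this is known for \<open>F\<close>.\<close>

lemma iso_imp_admissible:
  assumes "F \<cong> G" "admissible F"
  shows "admissible G"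
proof -
  obtain \<phi> where bij: "\<And>U. fin_tuple U \<Longrightarrow> bij_betw (\<phi> U) (str F U) (str G U)"
    and nat: "\<And>U V \<sigma> x. fin_tuple U \<Longrightarrow> bij_tuple \<sigma> U V \<Longrightarrow> x \<in> str F U \<Longrightarrow>
      \<phi> V (trn F U \<sigma> x) = trn G U \<sigma> (\<phi> U x)"
    using assms(1) unfolding iso_def by blast
  show ?thesis
  proof (rule admissibleI)
    fix U :: "'a \<Rightarrow> nat set" assume "fin_tuple U"
    then show "countable (str G U)"
      using bij admissible_countable[OF assms(2)] by (metis bij_betw_def countable_image)
  next
    fix U V \<sigma> y assume *: "fin_tuple U" "bij_tuple \<sigma> U V" "y \<in> str G U"
    obtain x where x: "x \<in> str F U" "y = \<phi> U x" using bij[OF *(1)] *(3) by (auto simp: bij_betw_def)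
    have "\<phi> V (trn F U \<sigma> x) \<in> str G V"
      using bij[OF fin_tuple_bij[OF *(1,2)]] admissible_trn[OF assms(2) *(1,2) x(1)]
      by (auto simp: bij_betw_def)
    then show "trn G U \<sigma> y \<in> str G V" using nat[OF *(1,2) x(1)] x(2) by simp
  qed
qed

lemma iso_imp_iso_all: "F \<cong> G \<Longrightarrow> admissible F \<Longrightarrow> iso_all F G"
  using iso_all_iff_iso iso_imp_admissible by blast

text \<open>Injectivity transports the functor laws back along a natural embedding.\<close>

lemma is_species_embedding:
  assumes F: "admissible F" and G: "is_species G"
    and inj: "\<And>U. fin_tuple U \<Longrightarrow> inj_on (\<phi> U) (str F U)"
    and into: "\<And>U x. fin_tuple U \<Longrightarrow> x \<in> str F U \<Longrightarrow> \<phi> U x \<in> str G U"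
    and nat: "\<And>U V \<sigma> x. fin_tuple U \<Longrightarrow> bij_tuple \<sigma> U V \<Longrightarrow> x \<in> str F U \<Longrightarrow>
      \<phi> V (trn F U \<sigma> x) = trn G U \<sigma> (\<phi> U x)"
  shows "is_species F"
proof -
  have eq: "x = y" if "fin_tuple U" "x \<in> str F U" "y \<in> str F U" "\<phi> U x = \<phi> U y" for U x y
    using inj that by (meson inj_onD)
  have fin: "finite (str F U)" if "fin_tuple U" for U
    by (rule inj_on_finite[OF inj[OF that] _ species_finite[OF G that]]) (use into[OF that] in blast)
  have mem: "trn F U \<sigma> x \<in> str F V" if "fin_tuple U" "bij_tuple \<sigma> U V" "x \<in> str F U" for U V \<sigma> x
    using F that by (rule admissible_trn)
  have cong: "trn F U \<sigma> x = trn F U \<tau> x"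
    if *: "fin_tuple U" "bij_tuple \<sigma> U V" "\<And>s u. u \<in> U s \<Longrightarrow> \<sigma> s u = \<tau> s u" "x \<in> str F U" for U V \<sigma> \<tau> x
  proof -
    have \<tau>: "bij_tuple \<tau> U V"
      using *(2,3) unfolding bij_tuple_def by (metis bij_betw_cong)
    have "trn G U \<sigma> (\<phi> U x) = trn G U \<tau> (\<phi> U x)"
      using species_cong[OF G *(1,2) into[OF *(1,4)]] *(3) by blast
    then show ?thesis
      using eq[OF fin_tuple_bij[OF *(1,2)] mem[OF *(1,2,4)] mem[OF *(1) \<tau> *(4)]]
        nat[OF *(1,2,4)] nat[OF *(1) \<tau> *(4)] by simp
  qed
  have id: "trn F U (\<lambda>s u. u) x = x" if *: "fin_tuple U" "x \<in> str F U" for U x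
  proof -
    have id: "bij_tuple (\<lambda>s u. u) U U" by (simp add: bij_tuple_def bij_betw_def)
    have "trn G U (\<lambda>s u. u) (\<phi> U x) = \<phi> U x"
      using species_id[OF G *(1) into[OF *]] .
    then show ?thesis using eq[OF *(1) mem[OF *(1) id *(2)] *(2)] nat[OF *(1) id *(2)] by simp
  qed
  have comp: "trn F V \<tau> (trn F U \<sigma> x) = trn F U (\<lambda>s. \<tau> s \<circ> \<sigma> s) x"
    if *: "fin_tuple U" "bij_tuple \<sigma> U V" "bij_tuple \<tau> V W" "x \<in> str F U" for U V W \<sigma> \<tau> x
  proof -
    have V: "fin_tuple V" using * fin_tuple_bij by blast
    have W: "fin_tuple W" using * V fin_tuple_bij by blast
    have c: "bij_tuple (\<lambda>s. \<tau> s \<circ> \<sigma> s) U W"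
      using *(2,3) unfolding bij_tuple_def by (meson bij_betw_trans)
    have "trn G V \<tau> (trn G U \<sigma> (\<phi> U x)) = trn G U (\<lambda>s. \<tau> s \<circ> \<sigma> s) (\<phi> U x)"
      using species_comp[OF G *(1,2) into[OF *(1,4)] *(3)] .
    then show ?thesis
      using eq[OF W mem[OF V *(3) mem[OF *(1,2,4)]] mem[OF *(1) c *(4)]]
        nat[OF V *(3) mem[OF *(1,2,4)]] nat[OF *(1,2,4)] nat[OF *(1) c *(4)] by simp
  qed
  show ?thesis
    by (rule is_speciesI) (fact fin, fact mem, fact cong, fact id, fact comp)
qed

text \<open>This is how an iterate, produced by an operator containing an infinite sum, is seen to
  be a species: it is isomorphic to a truncation of \<open>S\<close>.\<close>

lemma iso_all_is_species:
  assumes "iso_all F G" "is_species G"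
  shows "is_species F"
proof -
  obtain \<phi> where F: "admissible F"
    and bij: "\<And>U. fin_tuple U \<Longrightarrow> bij_betw (\<phi> U) (str F U) (str G U)"
    and nat: "\<And>U V \<sigma> x. fin_tuple U \<Longrightarrow> bij_tuple \<sigma> U V \<Longrightarrow>
      x \<in> str F U \<Longrightarrow> \<phi> V (trn F U \<sigma> x) = trn G U \<sigma> (\<phi> U x)"
    using iso_onE[OF assms(1)] by metis
  show ?thesis
    by (rule is_species_embedding[OF F assms(2), where \<phi> = \<phi>])
      (use bij nat in \<open>auto simp: bij_betw_def\<close>)
qed


section \<open>Encoding and restriction\<close>

lemma admissible_encode:
  assumes "admissible F"
  shows "admissible (encode F)"
proof (rule admissibleI)
  fix U V \<sigma> x assume *: "fin_tuple U" "bij_tuple \<sigma> U V" "x \<in> str (encode F) U"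
  then obtain y where y: "y \<in> str F U" "x = to_nat_on (str F U) y" by (auto simp: encode_def)
  then have "from_nat_into (str F U) x = y"
    using admissible_countable[OF assms *(1)] by simp
  then show "trn (encode F) U \<sigma> x \<in> str (encode F) V"
    using admissible_trn[OF assms *(1,2) y(1)] image_tuple_bij[OF *(2)] by (simp add: encode_def)
qed (use assms in \<open>auto simp: encode_def\<close>)

lemma iso_encode:
  assumes "admissible F"
  shows "iso_on P F (encode F)"
proof (rule iso_onI[OF assms admissible_encode[OF assms], where \<phi> = "\<lambda>U. to_nat_on (str F U)"])
  fix U :: "'a \<Rightarrow> nat set" assume "fin_tuple U"
  then show "bij_betw (to_nat_on (str F U)) (str F U) (str (encode F) U)"
    using admissible_countable[OF assms] by (simp add: encode_def bij_betw_def inj_on_to_nat_on)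
next
  fix U V \<sigma> x assume *: "fin_tuple U" "bij_tuple \<sigma> U V" "x \<in> str F U"
  then show "to_nat_on (str F V) (trn F U \<sigma> x) = trn (encode F) U \<sigma> (to_nat_on (str F U) x)"
    using admissible_countable[OF assms *(1)] image_tuple_bij[OF *(2)] by (simp add: encode_def)
qed

text \<open>A predicate instead of a bound, because the part of size greater than p is needed as
  well as the truncation.\<close>

definition prestr :: "(nat \<Rightarrow> bool) \<Rightarrow> ('s::finite, 'a) prespecies \<Rightarrow> ('s, 'a) prespecies" where
  "prestr P F = \<lparr> str = \<lambda>U. if P (size_tuple U) then str F U else {}, trn = trn F \<rparr>"

lemma srestr_eq_prestr: "srestr p F = prestr (\<lambda>k. k \<le> p) F"
  by (simp add: srestr_def prestr_def)

lemma str_prestr: "str (prestr P F) U = (if P (size_tuple U) then str F U else {})"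
  and trn_prestr [simp]: "trn (prestr P F) = trn F"
  by (simp_all add: prestr_def)

lemma admissible_prestr: "admissible F \<Longrightarrow> admissible (prestr P F)"
  by (rule admissibleI)
    (auto simp: str_prestr size_tuple_bij intro: admissible_countable admissible_trn split: if_splits)

lemma iso_on_prestr:
  assumes "admissible F" "\<And>k. Q k \<Longrightarrow> P k"
  shows "iso_on Q (prestr P F) F"
  by (rule iso_onI[where \<phi> = "\<lambda>U x. x"])
    (auto simp: assms admissible_prestr str_prestr bij_betw_def)

lemma is_species_prestr:
  assumes "is_species F"
  shows "is_species (prestr P F)"
  by (rule is_species_embedding[where \<phi> = "\<lambda>U x. x", OF _ assms])
    (auto simp: admissible_prestr is_species_admissible assms str_prestr split: if_splits)

text \<open>Outside \<open>P\<close> both restrictions are empty, so an isomorphism known only in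
  the sizes of \<open>P\<close> becomes one in all sizes. This absorbs the truncation in the
  definition of the Newton iterates.\<close>

lemma iso_on_imp_prestr:
  assumes "iso_on P F G"
  shows "iso_all (prestr P F) (prestr P G)"
proof (rule iso_on_sizes)
  show "admissible (prestr P F)" "admissible (prestr P G)"
    using assms by (auto intro: admissible_prestr iso_on_admissible1 iso_on_admissible2)
  fix k
  show "iso_on (\<lambda>l. l = k) (prestr P F) (prestr P G)"
  proof (cases "P k")
    case True
    have "iso_on (\<lambda>l. l = k) (prestr P F) F"
      using True by (intro iso_on_prestr iso_on_admissible1[OF assms]) auto
    also have "iso_on (\<lambda>l. l = k) F G"
      using assms True by (auto intro: iso_on_mono)
    also have "iso_on (\<lambda>l. l = k) G (prestr P G)"
      using True by (intro iso_on_sym[OF iso_on_prestr] iso_on_admissible2[OF assms]) auto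
    finally show ?thesis .
  next
    case False
    then show ?thesis
      using assms by (intro iso_on_empty)
        (auto intro: admissible_prestr iso_on_admissible1 iso_on_admissible2 simp: str_prestr)
  qed
qed

lemma contact_iff_iso_on:
  assumes "admissible F" "admissible G"
  shows "contact p F G \<longleftrightarrow> iso_on (\<lambda>k. k \<le> p) F G"
proof
  assume "contact p F G"
  then have "iso_all (prestr (\<lambda>k. k \<le> p) F) (prestr (\<lambda>k. k \<le> p) G)"
    using assms by (simp add: contact_def srestr_eq_prestr iso_all_iff_iso admissible_prestr)
  then have "iso_on (\<lambda>k. k \<le> p) (prestr (\<lambda>k. k \<le> p) F) (prestr (\<lambda>k. k \<le> p) G)"
    by (rule iso_on_all)
  then show "iso_on (\<lambda>k. k \<le> p) F G"
    using iso_on_prestr[OF assms(1)] iso_on_prestr[OF assms(2)] iso_on_trans iso_on_sym by metis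
next
  assume "iso_on (\<lambda>k. k \<le> p) F G"
  then show "contact p F G"
    using iso_on_imp_prestr[of "\<lambda>k. k \<le> p" F G] by (simp add: contact_def srestr_eq_prestr iso_all_iff_iso)
qed


section \<open>Sums and products\<close>

text \<open>The operations before encoding, for structures of any type.\<close>

definition pplus :: "('s, 'a) prespecies \<Rightarrow> ('s, 'b) prespecies \<Rightarrow> ('s, 'a + 'b) prespecies" where
  "pplus F G = \<lparr>
     str = (\<lambda>U. str F U <+> str G U),
     trn = (\<lambda>U \<sigma>. map_sum (trn F U \<sigma>) (trn G U \<sigma>)) \<rparr>"

definition psum :: "'i set \<Rightarrow> ('i \<Rightarrow> ('s, 'a) prespecies) \<Rightarrow> ('s, 'i \<times> 'a) prespecies" where
  "psum I F = \<lparr>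
     str = (\<lambda>U. SIGMA i:I. str (F i) U),
     trn = (\<lambda>U \<sigma> (i, x). (i, trn (F i) U \<sigma> x)) \<rparr>"

definition pprod ::
  "('s, 'a) prespecies \<Rightarrow> ('s, 'b) prespecies \<Rightarrow> ('s, ('s \<Rightarrow> nat set) \<times> 'a \<times> 'b) prespecies" where
  "pprod F G = \<lparr>
     str = (\<lambda>U. {(A, x, y). (\<forall>s. A s \<subseteq> U s) \<and> x \<in> str F A \<and> y \<in> str G (\<lambda>s. U s - A s)}),
     trn = (\<lambda>U \<sigma> (A, x, y).
       (image_tuple \<sigma> A, trn F A \<sigma> x, trn G (\<lambda>s. U s - A s) \<sigma> y)) \<rparr>"

lemma splus_eq_encode: "splus F G = encode (pplus F G)"
  and ssum_eq_encode: "ssum I F' = encode (psum I F')"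
  and stimes_eq_encode: "stimes F G = encode (pprod F G)"
  by (simp_all add: splus_def pplus_def ssum_def psum_def stimes_def pprod_def)

lemma str_pplus: "str (pplus F G) U = str F U <+> str G U"
  and trn_pplus: "trn (pplus F G) U \<sigma> = map_sum (trn F U \<sigma>) (trn G U \<sigma>)"
  and str_psum: "str (psum I F') U = (SIGMA i:I. str (F' i) U)"
  and trn_psum: "trn (psum I F') U \<sigma> = (\<lambda>(i, x). (i, trn (F' i) U \<sigma> x))"
  and str_pprod: "str (pprod F G) U =
    {(A, x, y). (\<forall>s. A s \<subseteq> U s) \<and> x \<in> str F A \<and> y \<in> str G (\<lambda>s. U s - A s)}"
  and trn_pprod: "trn (pprod F G) U \<sigma> =
    (\<lambda>(A, x, y). (image_tuple \<sigma> A, trn F A \<sigma> x, trn G (\<lambda>s. U s - A s) \<sigma> y))"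
  by (simp_all add: pplus_def psum_def pprod_def)

lemmas prespecies_op_simps = str_pplus trn_pplus str_psum trn_psum str_pprod trn_pprod

lemma admissible_pplus:
  assumes "admissible F" "admissible G"
  shows "admissible (pplus F G)"
  by (rule admissibleI)
    (auto simp: prespecies_op_simps countable_Plus admissible_countable[OF assms(1)] admissible_countable[OF assms(2)]
      admissible_trn[OF assms(1)] admissible_trn[OF assms(2)])

lemma admissible_psum:
  fixes I :: "'i::countable set"
  assumes "\<And>i. i \<in> I \<Longrightarrow> admissible (F i)"
  shows "admissible (psum I F)"
  by (rule admissibleI)
    (auto simp: prespecies_op_simps admissible_countable[OF assms] intro: admissible_trn[OF assms])

lemma admissible_pprod:
  fixes F :: "('s::finite, 'a) prespecies"
  assumes F: "admissible F" and G: "admissible G"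
  shows "admissible (pprod F G)"
proof (rule admissibleI)
  fix U :: "'s \<Rightarrow> nat set" assume U: "fin_tuple U"
  have "str (pprod F G) U = (SIGMA A:{A. \<forall>s. A s \<subseteq> U s}. str F A \<times> str G (\<lambda>s. U s - A s))"
    by (auto simp: prespecies_op_simps)
  moreover have "countable (SIGMA A:{A. \<forall>s. A s \<subseteq> U s}. str F A \<times> str G (\<lambda>s. U s - A s))"
    using finite_subtuples[OF U] fin_tuple_subset[OF U] fin_tuple_diff[OF U]
    by (intro countable_SIGMA countable_finite[OF finite_subtuples[OF U]])
      (auto intro!: admissible_countable[OF F] admissible_countable[OF G])
  ultimately show "countable (str (pprod F G) U)" by simp
next
  fix U V \<sigma> z assume *: "fin_tuple U" "bij_tuple \<sigma> U V" "z \<in> str (pprod F G) U"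
  then obtain A x y where z: "z = (A, x, y)" "\<And>s. A s \<subseteq> U s" "x \<in> str F A" "y \<in> str G (\<lambda>s. U s - A s)"
    by (auto simp: prespecies_op_simps)
  show "trn (pprod F G) U \<sigma> z \<in> str (pprod F G) V"
    using z(1) image_tuple_subset[OF *(2)] z(2)
      admissible_trn[OF F fin_tuple_subset[OF *(1) z(2)] bij_tuple_subset[OF *(2) z(2)] z(3)]
      admissible_trn[OF G fin_tuple_diff[OF *(1)] bij_tuple_diff[OF *(2) z(2)] z(4)]
    by (auto simp: prespecies_op_simps)
qed

section \<open>Compatibility of sums and products with isomorphisms\<close>

lemma pplus_cong:
  assumes "iso_on P F F'" "iso_on P G G'"
  shows "iso_on P (pplus F G) (pplus F' G')"
proof -
  obtain \<phi> where F: "admissible F" "admissible F'"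
    and \<phi>: "\<And>U. fin_tuple U \<Longrightarrow> P (size_tuple U) \<Longrightarrow> bij_betw (\<phi> U) (str F U) (str F' U)"
    and \<phi>_nat: "\<And>U V \<sigma> x. fin_tuple U \<Longrightarrow> P (size_tuple U) \<Longrightarrow> bij_tuple \<sigma> U V \<Longrightarrow>
      x \<in> str F U \<Longrightarrow> \<phi> V (trn F U \<sigma> x) = trn F' U \<sigma> (\<phi> U x)"
    using iso_onE[OF assms(1)] by metis
  obtain \<psi> where G: "admissible G" "admissible G'"
    and \<psi>: "\<And>U. fin_tuple U \<Longrightarrow> P (size_tuple U) \<Longrightarrow> bij_betw (\<psi> U) (str G U) (str G' U)"
    and \<psi>_nat: "\<And>U V \<sigma> x. fin_tuple U \<Longrightarrow> P (size_tuple U) \<Longrightarrow> bij_tuple \<sigma> U V \<Longrightarrow>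
      x \<in> str G U \<Longrightarrow> \<psi> V (trn G U \<sigma> x) = trn G' U \<sigma> (\<psi> U x)"
    using iso_onE[OF assms(2)] by metis
  show ?thesis
  proof (rule iso_onI[where \<phi> = "\<lambda>U. map_sum (\<phi> U) (\<psi> U)"])
    fix U :: "'a \<Rightarrow> nat set" assume U: "fin_tuple U" "P (size_tuple U)"
    have "inj_on (map_sum (\<phi> U) (\<psi> U)) (str F U <+> str G U)"
      using bij_betw_imp_inj_on[OF \<phi>[OF U]] bij_betw_imp_inj_on[OF \<psi>[OF U]]
      by (intro inj_onI) (auto dest: inj_onD)
    moreover have "map_sum (\<phi> U) (\<psi> U) ` (str F U <+> str G U) = \<phi> U ` str F U <+> \<psi> U ` str G U"
      by (simp add: Plus_def image_Un image_image)
    then have "map_sum (\<phi> U) (\<psi> U) ` (str F U <+> str G U) = str F' U <+> str G' U"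
      by (simp only: bij_betw_imp_surj_on[OF \<phi>[OF U]] bij_betw_imp_surj_on[OF \<psi>[OF U]])
    ultimately show "bij_betw (map_sum (\<phi> U) (\<psi> U)) (str (pplus F G) U) (str (pplus F' G') U)"
      by (simp add: prespecies_op_simps bij_betw_def)
  qed (auto simp: F G admissible_pplus prespecies_op_simps \<phi>_nat \<psi>_nat)
qed

lemma psum_cong:
  fixes I :: "'i::countable set" and F :: "'i \<Rightarrow> ('s::finite, 'a) prespecies"
  assumes "\<And>i. i \<in> I \<Longrightarrow> iso_on P (F i) (F' i)"
  shows "iso_on P (psum I F) (psum I F')"
proof -
  have "\<exists>\<phi>. (\<forall>U. fin_tuple U \<longrightarrow> P (size_tuple U) \<longrightarrow> bij_betw (\<phi> U) (str (F i) U) (str (F' i) U)) \<and>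
     (\<forall>U V \<sigma>. fin_tuple U \<longrightarrow> P (size_tuple U) \<longrightarrow> bij_tuple \<sigma> U V \<longrightarrow>
        (\<forall>x\<in>str (F i) U. \<phi> V (trn (F i) U \<sigma> x) = trn (F' i) U \<sigma> (\<phi> U x)))" if "i \<in> I" for i
    using assms[OF that] unfolding iso_on_def by blast
  then obtain \<phi> where \<phi>: "\<And>i. i \<in> I \<Longrightarrow>
     (\<forall>U. fin_tuple U \<longrightarrow> P (size_tuple U) \<longrightarrow> bij_betw (\<phi> i U) (str (F i) U) (str (F' i) U)) \<and>
     (\<forall>U V \<sigma>. fin_tuple U \<longrightarrow> P (size_tuple U) \<longrightarrow> bij_tuple \<sigma> U V \<longrightarrow>
        (\<forall>x\<in>str (F i) U. \<phi> i V (trn (F i) U \<sigma> x) = trn (F' i) U \<sigma> (\<phi> i U x)))"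
    by metis
  show ?thesis
  proof (rule iso_onI[where \<phi> = "\<lambda>U (i, x). (i, \<phi> i U x)"])
    fix U :: "'s \<Rightarrow> nat set" assume U: "fin_tuple U" "P (size_tuple U)"
    have b: "bij_betw (\<phi> i U) (str (F i) U) (str (F' i) U)" if "i \<in> I" for i
      using \<phi>[OF that] U by blast
    show "bij_betw (\<lambda>(i, x). (i, \<phi> i U x)) (str (psum I F) U) (str (psum I F') U)"
      unfolding bij_betw_def
    proof
      show "inj_on (\<lambda>(i, x). (i, \<phi> i U x)) (str (psum I F) U)"
        using b by (auto simp: prespecies_op_simps inj_on_def bij_betw_def)
      show "(\<lambda>(i, x). (i, \<phi> i U x)) ` str (psum I F) U = str (psum I F') U"
      proof (intro subset_antisym subsetI)
        fix z assume "z \<in> (\<lambda>(i, x). (i, \<phi> i U x)) ` str (psum I F) U"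
        then show "z \<in> str (psum I F') U"
          using bij_betwE[OF b] by (auto simp: prespecies_op_simps)
      next
        fix z assume "z \<in> str (psum I F') U"
        then obtain i y where z: "z = (i, y)" "i \<in> I" "y \<in> str (F' i) U"
          by (auto simp: prespecies_op_simps)
        then obtain x where "x \<in> str (F i) U" "y = \<phi> i U x"
          using bij_betw_imp_surj_on[OF b[OF z(2)]] by (metis imageE)
        then show "z \<in> (\<lambda>(i, x). (i, \<phi> i U x)) ` str (psum I F) U"
          using z by (auto simp: prespecies_op_simps intro!: image_eqI[where x = "(i, x)"])
      qed
    qed
  next
    show "admissible (psum I F)" "admissible (psum I F')"
      using assms by (blast intro: admissible_psum dest: iso_on_admissible1 iso_on_admissible2)+
  qed (use \<phi> in \<open>auto simp: prespecies_op_simps\<close>)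
qed

lemma pprod_cong_left:
  assumes "iso_all F F'" and G: "admissible G"
  shows "iso_on P (pprod F G) (pprod F' G)"
proof -
  obtain \<phi> where F: "admissible F" "admissible F'"
    and \<phi>: "\<And>U. fin_tuple U \<Longrightarrow> bij_betw (\<phi> U) (str F U) (str F' U)"
    and \<phi>_nat: "\<And>U V \<sigma> x. fin_tuple U \<Longrightarrow> bij_tuple \<sigma> U V \<Longrightarrow>
      x \<in> str F U \<Longrightarrow> \<phi> V (trn F U \<sigma> x) = trn F' U \<sigma> (\<phi> U x)"
    using iso_onE[OF assms(1)] by metis
  show ?thesis
  proof (rule iso_onI[where \<phi> = "\<lambda>U (A, x, y). (A, \<phi> A x, y)"])
    fix U :: "'a \<Rightarrow> nat set" assume U: "fin_tuple U"
    have b: "bij_betw (\<phi> A) (str F A) (str F' A)" if "\<forall>s. A s \<subseteq> U s" for A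
      using \<phi> fin_tuple_subset[OF U] that by blast
    show "bij_betw (\<lambda>(A, x, y). (A, \<phi> A x, y)) (str (pprod F G) U) (str (pprod F' G) U)"
      unfolding bij_betw_def
    proof
      show "inj_on (\<lambda>(A, x, y). (A, \<phi> A x, y)) (str (pprod F G) U)"
        using b by (auto simp: prespecies_op_simps inj_on_def bij_betw_def)
      show "(\<lambda>(A, x, y). (A, \<phi> A x, y)) ` str (pprod F G) U = str (pprod F' G) U"
      proof (intro subset_antisym subsetI)
        fix z assume "z \<in> (\<lambda>(A, x, y). (A, \<phi> A x, y)) ` str (pprod F G) U"
        then show "z \<in> str (pprod F' G) U"
          using bij_betwE[OF b] by (auto simp: prespecies_op_simps)
      next
        fix z assume "z \<in> str (pprod F' G) U"
        then obtain A x' y where z: "z = (A, x', y)" "\<forall>s. A s \<subseteq> U s" "x' \<in> str F' A"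
          "y \<in> str G (\<lambda>s. U s - A s)"
          by (auto simp: prespecies_op_simps)
        then obtain x where "x \<in> str F A" "x' = \<phi> A x"
          using bij_betw_imp_surj_on[OF b[OF z(2)]] by (metis imageE)
        then show "z \<in> (\<lambda>(A, x, y). (A, \<phi> A x, y)) ` str (pprod F G) U"
          using z by (auto simp: prespecies_op_simps intro!: image_eqI[where x = "(A, x, y)"])
      qed
    qed
  next
    fix U V \<sigma> z assume *: "fin_tuple U" "bij_tuple \<sigma> U V" "z \<in> str (pprod F G) U"
    then obtain A x y where z: "z = (A, x, y)" "\<And>s. A s \<subseteq> U s" "x \<in> str F A"
      by (auto simp: prespecies_op_simps)
    show "(\<lambda>(A, x, y). (A, \<phi> A x, y)) (trn (pprod F G) U \<sigma> z) =
        trn (pprod F' G) U \<sigma> ((\<lambda>(A, x, y). (A, \<phi> A x, y)) z)"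
      using z(1) \<phi>_nat[OF fin_tuple_subset[OF *(1) z(2)] bij_tuple_subset[OF *(2) z(2)] z(3)]
      by (simp add: prespecies_op_simps)
  qed (auto simp: F G admissible_pprod)
qed

text \<open>The right factor is only evaluated on complements of label sets carrying an
  \<open>F\<close>-structure. The hypothesis \<open>sizes\<close> records which sizes this produces,
  and it is what allows a linear system to be solved by recursion on the size.\<close>

lemma pprod_cong_right:
  assumes F: "admissible F" and "iso_on Q G G'"
    and sizes: "\<And>U A. fin_tuple U \<Longrightarrow> P (size_tuple U) \<Longrightarrow> (\<And>s. A s \<subseteq> U s) \<Longrightarrow> str F A \<noteq> {} \<Longrightarrow>
      Q (size_tuple (\<lambda>s. U s - A s))"
  shows "iso_on P (pprod F G) (pprod F G')"
proof -
  obtain \<phi> where G: "admissible G" "admissible G'"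
    and \<phi>: "\<And>U. fin_tuple U \<Longrightarrow> Q (size_tuple U) \<Longrightarrow> bij_betw (\<phi> U) (str G U) (str G' U)"
    and \<phi>_nat: "\<And>U V \<sigma> x. fin_tuple U \<Longrightarrow> Q (size_tuple U) \<Longrightarrow> bij_tuple \<sigma> U V \<Longrightarrow>
      x \<in> str G U \<Longrightarrow> \<phi> V (trn G U \<sigma> x) = trn G' U \<sigma> (\<phi> U x)"
    using iso_onE[OF assms(2)] by metis
  show ?thesis
  proof (rule iso_onI[where \<phi> = "\<lambda>U (A, x, y). (A, x, \<phi> (\<lambda>s. U s - A s) y)"])
    fix U :: "'a \<Rightarrow> nat set" assume U: "fin_tuple U" "P (size_tuple U)"
    have b: "bij_betw (\<phi> (\<lambda>s. U s - A s)) (str G (\<lambda>s. U s - A s)) (str G' (\<lambda>s. U s - A s))"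
      if "\<forall>s. A s \<subseteq> U s" "x \<in> str F A" for A x
      using \<phi>[OF fin_tuple_diff[OF U(1)]] sizes[OF U] that by blast
    show "bij_betw (\<lambda>(A, x, y). (A, x, \<phi> (\<lambda>s. U s - A s) y)) (str (pprod F G) U) (str (pprod F G') U)"
      unfolding bij_betw_def
    proof
      show "inj_on (\<lambda>(A, x, y). (A, x, \<phi> (\<lambda>s. U s - A s) y)) (str (pprod F G) U)"
        using b by (auto simp: prespecies_op_simps inj_on_def bij_betw_def)
      show "(\<lambda>(A, x, y). (A, x, \<phi> (\<lambda>s. U s - A s) y)) ` str (pprod F G) U = str (pprod F G') U"
      proof (intro subset_antisym subsetI)
        fix z assume "z \<in> (\<lambda>(A, x, y). (A, x, \<phi> (\<lambda>s. U s - A s) y)) ` str (pprod F G) U"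
        then show "z \<in> str (pprod F G') U"
          using bij_betwE[OF b] by (auto simp: prespecies_op_simps)
      next
        fix z assume "z \<in> str (pprod F G') U"
        then obtain A x y' where z: "z = (A, x, y')" "\<forall>s. A s \<subseteq> U s" "x \<in> str F A"
          "y' \<in> str G' (\<lambda>s. U s - A s)"
          by (auto simp: prespecies_op_simps)
        then have "y' \<in> \<phi> (\<lambda>s. U s - A s) ` str G (\<lambda>s. U s - A s)"
          by (simp only: bij_betw_imp_surj_on[OF b[OF z(2,3)]])
        then obtain y where "y \<in> str G (\<lambda>s. U s - A s)" "y' = \<phi> (\<lambda>s. U s - A s) y"
          by blast
        then show "z \<in> (\<lambda>(A, x, y). (A, x, \<phi> (\<lambda>s. U s - A s) y)) ` str (pprod F G) U"
          using z by (auto simp: prespecies_op_simps intro!: image_eqI[where x = "(A, x, y)"])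
      qed
    qed
  next
    fix U V \<sigma> z assume *: "fin_tuple U" "P (size_tuple U)" "bij_tuple \<sigma> U V" "z \<in> str (pprod F G) U"
    then obtain A x y where z: "z = (A, x, y)" "\<And>s. A s \<subseteq> U s" "x \<in> str F A"
      "y \<in> str G (\<lambda>s. U s - A s)"
      by (auto simp: prespecies_op_simps)
    show "(\<lambda>(A, x, y). (A, x, \<phi> (\<lambda>s. V s - A s) y)) (trn (pprod F G) U \<sigma> z) =
        trn (pprod F G') U \<sigma> ((\<lambda>(A, x, y). (A, x, \<phi> (\<lambda>s. U s - A s) y)) z)"
      using z(1) z(3) \<phi>_nat[OF fin_tuple_diff[OF *(1)] _ bij_tuple_diff[OF *(3) z(2)] z(4)]
        sizes[OF *(1,2) z(2)]
      by (auto simp: prespecies_op_simps)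
  qed (auto simp: F G admissible_pprod)
qed

section \<open>Distributivity, exchange of sums, associativity and unit\<close>

lemma pprod_psum_left:
  fixes I :: "'i::countable set" and F :: "'i \<Rightarrow> ('s::finite, 'a) prespecies"
  assumes "\<And>i. i \<in> I \<Longrightarrow> admissible (F i)" "admissible G"
  shows "iso_on P (pprod (psum I F) G) (psum I (\<lambda>i. pprod (F i) G))"
  by (rule iso_onI[where \<phi> = "\<lambda>U (A, (i, x), y). (i, (A, x, y))"])
    (auto simp: assms admissible_pprod admissible_psum prespecies_op_simps bij_betw_def inj_on_def image_iff)

lemma pprod_psum_right:
  fixes I :: "'i::countable set" and G :: "'i \<Rightarrow> ('s::finite, 'a) prespecies"
  assumes "admissible F" "\<And>i. i \<in> I \<Longrightarrow> admissible (G i)"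
  shows "iso_on P (pprod F (psum I G)) (psum I (\<lambda>i. pprod F (G i)))"
  by (rule iso_onI[where \<phi> = "\<lambda>U (A, x, (i, y)). (i, (A, x, y))"])
    (auto simp: assms admissible_pprod admissible_psum prespecies_op_simps bij_betw_def inj_on_def image_iff)

lemma psum_swap:
  fixes I :: "'i::countable set" and J :: "'j::countable set" and F :: "'i \<Rightarrow> 'j \<Rightarrow> ('s::finite, 'a) prespecies"
  assumes "\<And>i j. i \<in> I \<Longrightarrow> j \<in> J \<Longrightarrow> admissible (F i j)"
  shows "iso_on P (psum I (\<lambda>i. psum J (F i))) (psum J (\<lambda>j. psum I (\<lambda>i. F i j)))"
  by (rule iso_onI[where \<phi> = "\<lambda>U (i, (j, x)). (j, (i, x))"])
    (auto simp: assms admissible_psum prespecies_op_simps bij_betw_def inj_on_def image_iff)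

lemma psum_nat_unfold:
  fixes F :: "nat \<Rightarrow> ('s::finite, 'a) prespecies"
  assumes "\<And>i. admissible (F i)"
  shows "iso_on P (psum UNIV F) (pplus (F 0) (psum UNIV (\<lambda>k. F (Suc k))))"
proof (rule iso_onI[where \<phi> = "\<lambda>U (i, x). case i of 0 \<Rightarrow> Inl x | Suc k \<Rightarrow> Inr (k, x)"])
  fix U :: "'s \<Rightarrow> nat set"
  show "bij_betw (\<lambda>(i, x). case i of 0 \<Rightarrow> Inl x | Suc k \<Rightarrow> Inr (k, x)) (str (psum UNIV F) U)
      (str (pplus (F 0) (psum UNIV (\<lambda>k. F (Suc k)))) U)"
    unfolding bij_betw_def
  proof
    show "inj_on (\<lambda>(i, x). case i of 0 \<Rightarrow> Inl x | Suc k \<Rightarrow> Inr (k, x)) (str (psum UNIV F) U)"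
      by (auto simp: inj_on_def split: nat.splits)
    show "(\<lambda>(i, x). case i of 0 \<Rightarrow> Inl x | Suc k \<Rightarrow> Inr (k, x)) ` str (psum UNIV F) U =
        str (pplus (F 0) (psum UNIV (\<lambda>k. F (Suc k)))) U"
      by (force simp: prespecies_op_simps image_iff split: nat.splits)
  qed
qed (auto simp: assms admissible_psum admissible_pplus prespecies_op_simps split: nat.splits)

text \<open>Both sides cut the labels into three parts. On the left the first part \<open>B\<close>
  lies inside the union \<open>A\<close> of the first two; on the right the second part is named
  directly, as the difference of \<open>A\<close> and \<open>B\<close>.\<close>

lemma pprod_assoc:
  fixes F :: "('s::finite, 'a) prespecies"
  assumes "admissible F" "admissible G" "admissible K"
  shows "iso_on P (pprod (pprod F G) K) (pprod F (pprod G K))"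
proof (rule iso_onI[where \<phi> = "\<lambda>U (A, (B, x, y), z). (B, x, (\<lambda>s. A s - B s, y, z))"])
  fix U :: "'s \<Rightarrow> nat set"
  show "bij_betw (\<lambda>(A, (B, x, y), z). (B, x, (\<lambda>s. A s - B s, y, z)))
      (str (pprod (pprod F G) K) U) (str (pprod F (pprod G K)) U)"
  proof (rule bij_betw_byWitness[where f' = "\<lambda>(B, x, (C, y, z)). (\<lambda>s. B s \<union> C s, (B, x, y), z)"])
    have 1: "(\<lambda>s. B s \<union> A s) = A" if "\<forall>s. B s \<subseteq> A s" for A B :: "'s \<Rightarrow> nat set"
      using that by blast
    have 2: "(\<lambda>s. U s - B s - (A s - B s)) = (\<lambda>s. U s - A s)" if "\<forall>s. B s \<subseteq> A s"
      for A B :: "'s \<Rightarrow> nat set"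
      using that by blast
    have 3: "(\<lambda>s. B s \<union> C s - B s) = C" if "\<forall>s. C s \<subseteq> U s - B s" for C B :: "'s \<Rightarrow> nat set"
      using that by blast
    have 4: "(\<lambda>s. U s - (B s \<union> C s)) = (\<lambda>s. U s - B s - C s)" for C B :: "'s \<Rightarrow> nat set"
      by blast
    show "\<forall>a\<in>str (pprod (pprod F G) K) U. (\<lambda>(B, x, (C, y, z)). (\<lambda>s. B s \<union> C s, (B, x, y), z))
        ((\<lambda>(A, (B, x, y), z). (B, x, (\<lambda>s. A s - B s, y, z))) a) = a"
      by (auto simp: prespecies_op_simps 1)
    show "\<forall>a\<in>str (pprod F (pprod G K)) U. (\<lambda>(A, (B, x, y), z). (B, x, (\<lambda>s. A s - B s, y, z)))
        ((\<lambda>(B, x, (C, y, z)). (\<lambda>s. B s \<union> C s, (B, x, y), z)) a) = a"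
      by (auto simp: prespecies_op_simps 3)
    show "(\<lambda>(A, (B, x, y), z). (B, x, (\<lambda>s. A s - B s, y, z))) ` str (pprod (pprod F G) K) U
        \<subseteq> str (pprod F (pprod G K)) U"
      by (auto simp: prespecies_op_simps 2; blast)
    show "(\<lambda>(B, x, (C, y, z)). (\<lambda>s. B s \<union> C s, (B, x, y), z)) ` str (pprod F (pprod G K)) U
        \<subseteq> str (pprod (pprod F G) K) U"
      by (auto simp: prespecies_op_simps 3 4; blast)
  qed
next
  fix U V \<sigma> w assume *: "fin_tuple U" "bij_tuple \<sigma> U V" "w \<in> str (pprod (pprod F G) K) U"
  then obtain A B x y z where w: "w = (A, (B, x, y), z)" "\<forall>s. A s \<subseteq> U s" "\<forall>s. B s \<subseteq> A s"
    by (auto simp: prespecies_op_simps)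
  have "(\<lambda>s. U s - B s - (A s - B s)) = (\<lambda>s. U s - A s)"
    using w(3) by blast
  moreover have "image_tuple \<sigma> (\<lambda>s. A s - B s) = (\<lambda>s. image_tuple \<sigma> A s - image_tuple \<sigma> B s)"
    using w(2,3) by (intro image_tuple_diff[OF *(2)]) auto
  ultimately show "(\<lambda>(A, (B, x, y), z). (B, x, (\<lambda>s. A s - B s, y, z))) (trn (pprod (pprod F G) K) U \<sigma> w) =
       trn (pprod F (pprod G K)) U \<sigma> ((\<lambda>(A, (B, x, y), z). (B, x, (\<lambda>s. A s - B s, y, z))) w)"
    by (simp add: w(1) prespecies_op_simps)
qed (auto simp: assms admissible_pprod)

lemma admissible_szero: "admissible szero"
  by (rule admissibleI) (auto simp: szero_def)

lemma bij_tuple_empty_iff: "bij_tuple \<sigma> U V \<Longrightarrow> U = (\<lambda>s. {}) \<longleftrightarrow> V = (\<lambda>s. {})"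
  unfolding bij_tuple_def bij_betw_def fun_eq_iff by (metis image_is_empty)

lemma admissible_sone: "admissible sone"
  by (rule admissibleI) (auto simp: sone_def bij_tuple_empty_iff split: if_splits)

lemma admissible_mat_one: "admissible (mat_one i j)"
  by (simp add: mat_one_def admissible_sone admissible_szero)

text \<open>Only the summand of index \<open>i\<close> is nonempty, and there \<open>sone\<close>
  forces its share of the labels to be empty, so that \<open>D i\<close> receives all of
  them.\<close>

lemma psum_mat_one:
  fixes D :: "'n::finite \<Rightarrow> 's::finite species"
  assumes "\<And>j. admissible (D j)"
  shows "iso_on P (psum UNIV (\<lambda>j. pprod (mat_one i j) (D j))) (D i)"
proof (rule iso_onI[where \<phi> = "\<lambda>U (j, (A, x, y)). y"])
  fix U :: "'s \<Rightarrow> nat set"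
  show "bij_betw (\<lambda>(j, (A, x, y)). y) (str (psum UNIV (\<lambda>j. pprod (mat_one i j) (D j))) U) (str (D i) U)"
    by (rule bij_betw_byWitness[where f' = "\<lambda>y. (i, (\<lambda>s. {}, 0, y))"])
      (auto simp: prespecies_op_simps mat_one_def sone_def szero_def split: if_splits)
next
  show "admissible (psum UNIV (\<lambda>j. pprod (mat_one i j) (D j)))"
    by (intro admissible_psum admissible_pprod admissible_mat_one assms)
qed (auto simp: assms prespecies_op_simps mat_one_def sone_def szero_def split: if_splits)

section \<open>From the encoded operations to the unencoded ones\<close>

lemma splus_iso:
  "admissible F \<Longrightarrow> admissible G \<Longrightarrow> iso_on P (splus F G) (pplus F G)"
  unfolding splus_eq_encode by (intro iso_on_sym[OF iso_encode] admissible_pplus)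

lemma ssum_iso:
  fixes I :: "'i::countable set" and F :: "'i \<Rightarrow> 's::finite species"
  shows "(\<And>i. i \<in> I \<Longrightarrow> admissible (F i)) \<Longrightarrow> iso_on P (ssum I F) (psum I F)"
  unfolding ssum_eq_encode by (intro iso_on_sym[OF iso_encode] admissible_psum)

lemma stimes_iso:
  "admissible F \<Longrightarrow> admissible G \<Longrightarrow> iso_on P (stimes F G) (pprod F G)"
  unfolding stimes_eq_encode by (intro iso_on_sym[OF iso_encode] admissible_pprod)

lemma admissible_ssum:
  "(\<And>i::'i::countable. i \<in> I \<Longrightarrow> admissible (F i)) \<Longrightarrow> admissible (ssum I F)"
  unfolding ssum_eq_encode by (intro admissible_encode admissible_psum)

lemma admissible_stimes:
  fixes F :: "'s::finite species"
  shows "admissible F \<Longrightarrow> admissible G \<Longrightarrow> admissible (stimes F G)"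
  unfolding stimes_eq_encode by (intro admissible_encode admissible_pprod)


section \<open>Composition\<close>

definition pcomp :: "'t species \<Rightarrow> ('t \<Rightarrow> 's species) \<Rightarrow> ('s, ('t, 's) assembly set) prespecies" where
  "pcomp F G = \<lparr>
     str = (\<lambda>U. assemblies F G U // assembly_rel F G U),
     trn = (\<lambda>U \<sigma> c. relabel G \<sigma> ` c) \<rparr>"

lemma scomp_eq_encode: "scomp F G = encode (pcomp F G)"
  by (simp add: scomp_def pcomp_def)

lemma str_pcomp: "str (pcomp F G) U = assemblies F G U // assembly_rel F G U"
  and trn_pcomp: "trn (pcomp F G) U \<sigma> c = relabel G \<sigma> ` c"
  by (simp_all add: pcomp_def)

lemma assemblies_iff:
  "(A, B, f, g) \<in> assemblies F G U \<longleftrightarrow>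
     fin_tuple A \<and> f \<in> str F A \<and>
     (\<forall>t. \<forall>a\<in>A t. g t a \<in> str (G t) (B t a)) \<and>
     (\<forall>t a. a \<notin> A t \<longrightarrow> B t a = (\<lambda>s. {}) \<and> g t a = 0) \<and>
     (\<forall>s t a t' a'. a \<in> A t \<longrightarrow> a' \<in> A t' \<longrightarrow> (t, a) \<noteq> (t', a') \<longrightarrow> B t a s \<inter> B t' a' s = {}) \<and>
     (\<forall>s u. u \<in> U s \<longleftrightarrow> (\<exists>t a. a \<in> A t \<and> u \<in> B t a s))"
proof -
  have 1: "disjoint_family_on (\<lambda>(t, a). B t a s) (Sigma UNIV A) \<longleftrightarrow>
      (\<forall>t a t' a'. a \<in> A t \<longrightarrow> a' \<in> A t' \<longrightarrow> (t, a) \<noteq> (t', a') \<longrightarrow> B t a s \<inter> B t' a' s = {})" for s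
    unfolding disjoint_family_on_def by fastforce
  have 2: "(\<Union>(t, a)\<in>Sigma UNIV A. B t a s) = U s \<longleftrightarrow> (\<forall>u. u \<in> U s \<longleftrightarrow> (\<exists>t a. a \<in> A t \<and> u \<in> B t a s))" for s
    by (simp add: set_eq_iff Bex_def eq_commute)
  show ?thesis unfolding assemblies_def using 1 2 by (simp add: all_conj_distrib)
qed

lemma
  assumes "(A, B, f, g) \<in> assemblies F G U"
  shows assembly_fin: "fin_tuple A"
    and assembly_outer: "f \<in> str F A"
    and assembly_inner: "a \<in> A t \<Longrightarrow> g t a \<in> str (G t) (B t a)"
    and assembly_outside: "a \<notin> A t \<Longrightarrow> B t a = (\<lambda>s. {})" "a \<notin> A t \<Longrightarrow> g t a = 0"
    and assembly_disjoint: "a \<in> A t \<Longrightarrow> a' \<in> A t' \<Longrightarrow> (t, a) \<noteq> (t', a') \<Longrightarrow> B t a s \<inter> B t' a' s = {}"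
    and assembly_Union: "u \<in> U s \<longleftrightarrow> (\<exists>t a. a \<in> A t \<and> u \<in> B t a s)"
  using assms by (simp_all add: assemblies_iff)

lemma assembly_block_subset:
  assumes "(A, B, f, g) \<in> assemblies F G U"
  shows "B t a s \<subseteq> U s"
proof
  fix u assume u: "u \<in> B t a s"
  then have "a \<in> A t" using assembly_outside(1)[OF assms] by (metis empty_iff)
  with u show "u \<in> U s" using assembly_Union[OF assms] by metis
qed

lemma assembly_relI:
  assumes "(A, B, f, g) \<in> assemblies F G U" "(A', B', f', g') \<in> assemblies F G U"
    "bij_tuple \<rho> A A'" "trn F A \<rho> f = f'"
    "\<And>t a. a \<in> A t \<Longrightarrow> B' t (\<rho> t a) = B t a" "\<And>t a. a \<in> A t \<Longrightarrow> g' t (\<rho> t a) = g t a"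
  shows "((A, B, f, g), (A', B', f', g')) \<in> assembly_rel F G U"
  unfolding assembly_rel_def using assms by blast

lemma assembly_relE:
  assumes "((A, B, f, g), (A', B', f', g')) \<in> assembly_rel F G U"
  obtains \<rho> where "(A, B, f, g) \<in> assemblies F G U" "(A', B', f', g') \<in> assemblies F G U"
    "bij_tuple \<rho> A A'" "trn F A \<rho> f = f'"
    "\<And>t a. a \<in> A t \<Longrightarrow> B' t (\<rho> t a) = B t a" "\<And>t a. a \<in> A t \<Longrightarrow> g' t (\<rho> t a) = g t a"
  using assms unfolding assembly_rel_def by blast

lemma bij_tuple_mem: "bij_tuple \<rho> A A' \<Longrightarrow> a \<in> A t \<Longrightarrow> \<rho> t a \<in> A' t"
  unfolding bij_tuple_def by (meson bij_betwE)

text \<open>Reflexivity, symmetry and transitivity come from identity, inverse and composite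
  renamings; the functor laws of the outer species \<open>F\<close> say that its structure follows
  them.\<close>

lemma equiv_assembly_rel:
  assumes F: "is_species F"
  shows "equiv (assemblies F G U) (assembly_rel F G U)"
proof (rule equivI)
  show "assembly_rel F G U \<subseteq> assemblies F G U \<times> assemblies F G U"
    by (auto simp: assembly_rel_def)
  show "refl_on (assemblies F G U) (assembly_rel F G U)"
  proof (rule refl_onI)
    fix x assume x: "x \<in> assemblies F G U"
    obtain A B f g where x': "x = (A, B, f, g)" by (metis prod_cases4)
    show "(x, x) \<in> assembly_rel F G U"
      unfolding x'
      by (rule assembly_relI[where \<rho> = "\<lambda>s u. u"])
        (use x in \<open>auto simp: x' bij_tuple_def bij_betw_def assemblies_iff intro: species_id[OF F]\<close>)
  qed
  show "sym (assembly_rel F G U)"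
  proof (rule symI)
    fix x y assume xy: "(x, y) \<in> assembly_rel F G U"
    obtain A B f g where x: "x = (A, B, f, g)" by (metis prod_cases4)
    obtain A' B' f' g' where y: "y = (A', B', f', g')" by (metis prod_cases4)
    obtain \<rho> where \<rho>: "(A, B, f, g) \<in> assemblies F G U" "(A', B', f', g') \<in> assemblies F G U"
      "bij_tuple \<rho> A A'" "trn F A \<rho> f = f'"
      "\<And>t a. a \<in> A t \<Longrightarrow> B' t (\<rho> t a) = B t a" "\<And>t a. a \<in> A t \<Longrightarrow> g' t (\<rho> t a) = g t a"
      using assembly_relE[OF xy[unfolded x y]] by metis
    obtain \<tau> where \<tau>: "bij_tuple \<tau> A' A" "\<And>t a. a \<in> A t \<Longrightarrow> \<tau> t (\<rho> t a) = a"
      "\<And>t a. a \<in> A' t \<Longrightarrow> \<rho> t (\<tau> t a) = a"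
      using bij_tuple_inverse[OF \<rho>(3)] by metis
    have A: "fin_tuple A" "f \<in> str F A" using \<rho>(1) by (auto simp: assemblies_iff)
    have "bij_tuple (\<lambda>s. \<tau> s \<circ> \<rho> s) A A"
      using \<rho>(3) \<tau>(1) unfolding bij_tuple_def by (meson bij_betw_trans)
    then have "trn F A (\<lambda>s. \<tau> s \<circ> \<rho> s) f = trn F A (\<lambda>s u. u) f"
      using \<tau>(2) by (intro species_cong[OF F A(1) _ A(2)]) auto
    then have "trn F A' \<tau> f' = f"
      using species_comp[OF F A(1) \<rho>(3) A(2) \<tau>(1)] species_id[OF F A] \<rho>(4) by simp
    then show "(y, x) \<in> assembly_rel F G U"
      unfolding x y
      by (rule assembly_relI[OF \<rho>(2,1) \<tau>(1)])
        (use \<rho>(5,6) \<tau>(1,3) bij_tuple_mem in metis)+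
  qed
  show "trans (assembly_rel F G U)"
  proof (rule transI)
    fix x y z assume xy: "(x, y) \<in> assembly_rel F G U" and yz: "(y, z) \<in> assembly_rel F G U"
    obtain A B f g where x: "x = (A, B, f, g)" by (metis prod_cases4)
    obtain A' B' f' g' where y: "y = (A', B', f', g')" by (metis prod_cases4)
    obtain A'' B'' f'' g'' where z: "z = (A'', B'', f'', g'')" by (metis prod_cases4)
    obtain \<rho> where \<rho>: "(A, B, f, g) \<in> assemblies F G U"
      "bij_tuple \<rho> A A'" "trn F A \<rho> f = f'"
      "\<And>t a. a \<in> A t \<Longrightarrow> B' t (\<rho> t a) = B t a" "\<And>t a. a \<in> A t \<Longrightarrow> g' t (\<rho> t a) = g t a"
      using assembly_relE[OF xy[unfolded x y]] by metis
    obtain \<tau> where \<tau>: "(A'', B'', f'', g'') \<in> assemblies F G U"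
      "bij_tuple \<tau> A' A''" "trn F A' \<tau> f' = f''"
      "\<And>t a. a \<in> A' t \<Longrightarrow> B'' t (\<tau> t a) = B' t a" "\<And>t a. a \<in> A' t \<Longrightarrow> g'' t (\<tau> t a) = g' t a"
      using assembly_relE[OF yz[unfolded y z]] by metis
    have A: "fin_tuple A" "f \<in> str F A" using \<rho>(1) by (auto simp: assemblies_iff)
    show "(x, z) \<in> assembly_rel F G U"
      unfolding x z
    proof (rule assembly_relI[OF \<rho>(1) \<tau>(1), where \<rho> = "\<lambda>s. \<tau> s \<circ> \<rho> s"])
      show "bij_tuple (\<lambda>s. \<tau> s \<circ> \<rho> s) A A''"
        using \<rho>(2) \<tau>(2) unfolding bij_tuple_def by (meson bij_betw_trans)
      show "trn F A (\<lambda>s. \<tau> s \<circ> \<rho> s) f = f''"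
        using species_comp[OF F A(1) \<rho>(2) A(2) \<tau>(2)] \<rho>(3) \<tau>(3) by simp
    qed (use \<rho>(4,5) \<tau>(4,5) bij_tuple_mem[OF \<rho>(2)] in auto)
  qed
qed

text \<open>An assembly contains functions on infinite domains, but it has finitely many points and
  prescribed values elsewhere. It is thus determined by finite sets over countable types, which
  \<open>code\<close> collects.\<close>

lemma countable_assemblies:
  fixes F :: "'t::finite species" and U :: "'s::finite \<Rightarrow> nat set"
  assumes "fin_tuple U"
  shows "countable (assemblies F G U)"
proof -
  define code where "code = (\<lambda>(A, B, f, g). (Sigma UNIV A, {(t, a, s, u). u \<in> B t a s}, f,
    {(t, a, n). a \<in> A t \<and> n = g t a}) ::
      ('t \<times> nat) set \<times> ('t \<times> nat \<times> 's \<times> nat) set \<times> nat \<times> ('t \<times> nat \<times> nat) set)"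
  have "inj_on code (assemblies F G U)"
  proof (rule inj_onI)
    fix x y assume x: "x \<in> assemblies F G U" and y: "y \<in> assemblies F G U" and xy: "code x = code y"
    obtain A B f g where x': "x = (A, B, f, g)" by (metis prod_cases4)
    obtain A' B' f' g' where y': "y = (A', B', f', g')" by (metis prod_cases4)
    have eqs: "Sigma UNIV A = Sigma UNIV A'" "f = f'"
      "{(t, a, s, u). u \<in> B t a s} = {(t, a, s, u). u \<in> B' t a s}"
      "{(t, a, n). a \<in> A t \<and> n = g t a} = {(t, a, n). a \<in> A' t \<and> n = g' t a}"
      using xy by (auto simp: code_def x' y')
    have A: "A = A'" using eqs(1) by (auto simp: fun_eq_iff set_eq_iff)
    have B: "B = B'" using eqs(3) by (auto simp: fun_eq_iff set_eq_iff)
    have "g t a = g' t a" for t a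
    proof (cases "a \<in> A t")
      case True
      then have "(t, a, g t a) \<in> {(t, a, n). a \<in> A t \<and> n = g t a}" by simp
      then show ?thesis unfolding eqs(4) by simp
    next
      case False
      then show ?thesis
        using assembly_outside(2)[OF x[unfolded x']] assembly_outside(2)[OF y[unfolded y']] A by simp
    qed
    then have "g = g'" by blast
    then show "x = y" using A B eqs(2) x' y' by simp
  qed
  moreover have "code ` assemblies F G U \<subseteq>
      Collect finite \<times> Collect finite \<times> UNIV \<times> Collect finite"
  proof
    fix z assume "z \<in> code ` assemblies F G U"
    then obtain A B f g where x: "(A, B, f, g) \<in> assemblies F G U" and z: "z = code (A, B, f, g)"
      by (metis imageE prod_cases4)
    have A: "finite (Sigma UNIV A)"
      using x by (auto simp: assemblies_iff fin_tuple_def)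
    have "{(t, a, s, u). u \<in> B t a s} \<subseteq> (\<lambda>((t, a), (s, u)). (t, a, s, u)) ` (Sigma UNIV A \<times> Sigma UNIV U)"
    proof clarify
      fix t a s u assume u: "u \<in> B t a s"
      have "a \<in> A t" using assembly_outside(1)[OF x] u by (metis empty_iff)
      moreover have "u \<in> U s" using u assembly_block_subset[OF x] by blast
      ultimately show "(t, a, s, u) \<in> (\<lambda>((t, a), (s, u)). (t, a, s, u)) ` (Sigma UNIV A \<times> Sigma UNIV U)"
        by (intro image_eqI[where x = "((t, a), (s, u))"]) auto
    qed
    moreover have "finite (Sigma UNIV U)" using assms by (auto simp: fin_tuple_def)
    ultimately have "finite {(t, a, s, u). u \<in> B t a s}"
      using A by (meson finite_SigmaI finite_imageI finite_subset)
    moreover have "{(t, a, n). a \<in> A t \<and> n = g t a} = (\<lambda>(t, a). (t, a, g t a)) ` Sigma UNIV A"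
      by force
    then have "finite {(t, a, n). a \<in> A t \<and> n = g t a}" using A by simp
    ultimately show "z \<in> Collect finite \<times> Collect finite \<times> UNIV \<times> Collect finite"
      using A by (simp add: z code_def)
  qed
  then have "countable (code ` assemblies F G U)"
    by (rule countable_subset) (intro countable_SIGMA countable_Collect_finite countableI_type)
  ultimately show ?thesis by (metis countable_image_inj_on)
qed


subsection \<open>Functoriality in the inner species\<close>

text \<open>One operation for two purposes: with \<open>\<psi>\<close> the transport of the inner
  species it is \<open>relabel\<close>, and with \<open>\<sigma>\<close> the identity it replaces
  the inner species by isomorphic ones.\<close>

definition map_assembly ::
  "('s \<Rightarrow> nat \<Rightarrow> nat) \<Rightarrow> ('t \<Rightarrow> ('s \<Rightarrow> nat set) \<Rightarrow> nat \<Rightarrow> nat) \<Rightarrow> ('t, 's) assembly \<Rightarrow> ('t, 's) assembly" where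
  "map_assembly \<sigma> \<psi> = (\<lambda>(A, B, f, g).
     (A, \<lambda>t a. image_tuple \<sigma> (B t a), f, \<lambda>t a. if a \<in> A t then \<psi> t (B t a) (g t a) else 0))"

lemma relabel_eq_map_assembly: "relabel G \<sigma> = map_assembly \<sigma> (\<lambda>t W. trn (G t) W \<sigma>)"
  by (simp add: relabel_def map_assembly_def)

lemma image_tuple_inj:
  assumes "bij_tuple \<sigma> U V" "\<And>s. A s \<subseteq> U s" "\<And>s. C s \<subseteq> U s" "image_tuple \<sigma> A = image_tuple \<sigma> C"
  shows "A = C"
proof
  fix s
  have "inj_on (\<sigma> s) (U s)" using assms(1) by (auto simp: bij_tuple_def bij_betw_def)
  moreover have "\<sigma> s ` A s = \<sigma> s ` C s" using assms(4) by (metis image_tuple_def)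
  ultimately show "A s = C s" using assms(2,3) inj_on_image_eq_iff by metis
qed

lemma map_assembly_mem:
  assumes \<sigma>: "bij_tuple \<sigma> U V"
    and \<psi>: "\<And>t W x. (\<And>s. W s \<subseteq> U s) \<Longrightarrow> x \<in> str (G t) W \<Longrightarrow> \<psi> t W x \<in> str (G' t) (image_tuple \<sigma> W)"
    and x: "x \<in> assemblies F G U"
  shows "map_assembly \<sigma> \<psi> x \<in> assemblies F G' V"
proof -
  obtain A B f g where x': "x = (A, B, f, g)" by (metis prod_cases4)
  note x = x[unfolded x']
  note x_iff = x[unfolded assemblies_iff]
  have sub: "B t a s \<subseteq> U s" for t a s using assembly_block_subset[OF x] .
  have inj: "inj_on (\<sigma> s) (U s)" and V: "V s = \<sigma> s ` U s" for s
    using \<sigma> by (auto simp: bij_tuple_def bij_betw_def)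
  have "image_tuple \<sigma> (B t a) s \<inter> image_tuple \<sigma> (B t' a') s = {}"
    if "a \<in> A t" "a' \<in> A t'" "(t, a) \<noteq> (t', a')" for s t a t' a'
  proof -
    have "B t a s \<inter> B t' a' s = {}" using assembly_disjoint[OF x that] .
    then show ?thesis
      using inj_on_image_Int[OF inj sub sub, of s t a t' a'] by (simp add: image_tuple_def)
  qed
  moreover have "v \<in> V s \<longleftrightarrow> (\<exists>t a. a \<in> A t \<and> v \<in> image_tuple \<sigma> (B t a) s)" for s v
  proof -
    have "u \<in> U s \<longleftrightarrow> (\<exists>t a. a \<in> A t \<and> u \<in> B t a s)" for u
      using assembly_Union[OF x] .
    then show ?thesis unfolding V image_tuple_def image_iff by metis
  qed
  moreover have "image_tuple \<sigma> (\<lambda>s. {}) = (\<lambda>s. {})" by (simp add: image_tuple_def)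
  ultimately show ?thesis
    unfolding x' map_assembly_def prod.case assemblies_iff
    using x_iff \<psi> sub by simp
qed

definition block_bij ::
  "('s \<Rightarrow> nat \<Rightarrow> nat) \<Rightarrow> ('s \<Rightarrow> nat set) \<Rightarrow> ('t \<Rightarrow> ('s \<Rightarrow> nat set) \<Rightarrow> nat \<Rightarrow> nat) \<Rightarrow>
    ('t \<Rightarrow> 's species) \<Rightarrow> ('t \<Rightarrow> 's species) \<Rightarrow> bool" where
  "block_bij \<sigma> U \<psi> G G' \<longleftrightarrow> (\<forall>t W. (\<forall>s. W s \<subseteq> U s) \<longrightarrow>
     bij_betw (\<psi> t W) (str (G t) W) (str (G' t) (image_tuple \<sigma> W)))"

lemma block_bijD:
  "block_bij \<sigma> U \<psi> G G' \<Longrightarrow> (\<And>s. W s \<subseteq> U s) \<Longrightarrow>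
    bij_betw (\<psi> t W) (str (G t) W) (str (G' t) (image_tuple \<sigma> W))"
  unfolding block_bij_def by blast

text \<open>The same renaming of points witnesses both sides. To go back, blocks are recovered
  because \<open>\<sigma>\<close> is injective on the labels, and then their structures because
  \<open>\<psi>\<close> is injective on each block.\<close>

lemma map_assembly_rel_iff:
  assumes \<sigma>: "bij_tuple \<sigma> U V"
    and \<psi>: "block_bij \<sigma> U \<psi> G G'"
    and x: "x \<in> assemblies F G U" and y: "y \<in> assemblies F G U"
  shows "(map_assembly \<sigma> \<psi> x, map_assembly \<sigma> \<psi> y) \<in> assembly_rel F G' V \<longleftrightarrow> (x, y) \<in> assembly_rel F G U"
proof -
  obtain A B f g where x': "x = (A, B, f, g)" by (metis prod_cases4)
  obtain A' B' f' g' where y': "y = (A', B', f', g')" by (metis prod_cases4)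
  have mem: "map_assembly \<sigma> \<psi> z \<in> assemblies F G' V" if "z \<in> assemblies F G U" for z
    by (intro map_assembly_mem[OF \<sigma> _ that]) (rule bij_betw_apply[OF block_bijD[OF \<psi>]])
  have sub: "B t a s \<subseteq> U s" "B' t a s \<subseteq> U s" for t a s
    using assembly_block_subset x y unfolding x' y' by metis+
  have "(image_tuple \<sigma> (B' t (\<rho> t a)) = image_tuple \<sigma> (B t a) \<and>
          \<psi> t (B' t (\<rho> t a)) (g' t (\<rho> t a)) = \<psi> t (B t a) (g t a)) \<longleftrightarrow>
        (B' t (\<rho> t a) = B t a \<and> g' t (\<rho> t a) = g t a)"
    if \<rho>: "bij_tuple \<rho> A A'" and a: "a \<in> A t" for \<rho> t a
  proof
    assume *: "image_tuple \<sigma> (B' t (\<rho> t a)) = image_tuple \<sigma> (B t a) \<and>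
      \<psi> t (B' t (\<rho> t a)) (g' t (\<rho> t a)) = \<psi> t (B t a) (g t a)"
    have B: "B' t (\<rho> t a) = B t a" 
      using image_tuple_inj[OF \<sigma>, of "B' t (\<rho> t a)" "B t a"] sub * by simp
    have "inj_on (\<psi> t (B t a)) (str (G t) (B t a))"
      using block_bijD[OF \<psi>, of "B t a" t] sub by (simp add: bij_betw_def)
    moreover have "g t a \<in> str (G t) (B t a)" "g' t (\<rho> t a) \<in> str (G t) (B t a)"
      using assembly_inner[OF x[unfolded x'] a] assembly_inner[OF y[unfolded y'] bij_tuple_mem[OF \<rho> a]] B
      by simp_all
    ultimately show "B' t (\<rho> t a) = B t a \<and> g' t (\<rho> t a) = g t a"
      using * B by (metis inj_onD)
  qed simp
  then show ?thesis
    using x y mem[OF x] mem[OF y] bij_tuple_mem[of _ A A']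
    unfolding x' y' map_assembly_def assembly_rel_def
    by (simp cong: conj_cong)
qed

text \<open>The preimage is again obtained by \<open>map_assembly\<close>, from the inverse
  relabelling \<open>\<tau>\<close> and the inverses \<open>\<psi>'\<close> of the bijections
  attached to the pulled-back blocks.\<close>

lemma map_assembly_surj:
  assumes \<sigma>: "bij_tuple \<sigma> U V"
    and \<psi>: "block_bij \<sigma> U \<psi> G G'"
    and y: "y \<in> assemblies F G' V"
  shows "\<exists>x\<in>assemblies F G U. map_assembly \<sigma> \<psi> x = y"
proof -
  obtain A B f g where y': "y = (A, B, f, g)" by (metis prod_cases4)
  obtain \<tau> where \<tau>: "bij_tuple \<tau> V U" "\<And>s u. u \<in> U s \<Longrightarrow> \<tau> s (\<sigma> s u) = u"
    "\<And>s v. v \<in> V s \<Longrightarrow> \<sigma> s (\<tau> s v) = v"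
    using bij_tuple_inverse[OF \<sigma>] by metis
  have \<sigma>\<tau>: "image_tuple \<sigma> (image_tuple \<tau> W) = W" if "\<And>s. W s \<subseteq> V s" for W
  proof
    fix s
    have "\<sigma> s ` \<tau> s ` W s = (\<lambda>w. w) ` W s"
      unfolding image_image using \<tau>(3) that by (intro image_cong) auto
    then show "image_tuple \<sigma> (image_tuple \<tau> W) s = W s" by (simp add: image_tuple_def)
  qed
  define \<psi>' where "\<psi>' t W = inv_into (str (G t) (image_tuple \<tau> W)) (\<psi> t (image_tuple \<tau> W))" for t W
  have b: "bij_betw (\<psi> t (image_tuple \<tau> W)) (str (G t) (image_tuple \<tau> W)) (str (G' t) W)"
    if "\<And>s. W s \<subseteq> V s" for t W
    using block_bijD[OF \<psi>, of "image_tuple \<tau> W" t] \<sigma>\<tau>[of W] image_tuple_subset[OF \<tau>(1)] that by simp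
  have "map_assembly \<tau> \<psi>' y \<in> assemblies F G U"
  proof (rule map_assembly_mem[OF \<tau>(1) _ y])
    show "\<psi>' t W x \<in> str (G t) (image_tuple \<tau> W)" if "\<And>s. W s \<subseteq> V s" "x \<in> str (G' t) W" for t W x
      unfolding \<psi>'_def using bij_betw_imp_surj_on[OF b[OF that(1)], of t] that(2) by (intro inv_into_into) auto
  qed
  moreover have "map_assembly \<sigma> \<psi> (map_assembly \<tau> \<psi>' y) = y"
  proof -
    have sub: "B t a s \<subseteq> V s" for t a s using assembly_block_subset y unfolding y' by metis
    have "\<psi> t (image_tuple \<tau> (B t a)) (\<psi>' t (B t a) (g t a)) = g t a" if "a \<in> A t" for t a
    proof -
      have "g t a \<in> str (G' t) (B t a)" using assembly_inner[OF y[unfolded y'] that] .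
      then show ?thesis
        unfolding \<psi>'_def using b[of "B t a" t, OF sub] by (simp add: bij_betw_inv_into_right)
    qed
    moreover have "g t a = 0" if "a \<notin> A t" for t a using assembly_outside(2)[OF y[unfolded y'] that] .
    ultimately show ?thesis
      using \<sigma>\<tau>[of "B _ _", OF sub] by (auto simp: y' map_assembly_def fun_eq_iff)
  qed
  ultimately show ?thesis by blast
qed

text \<open>Transport acts on a class by direct image. That the image is a full class, and not
  merely part of one, rests on surjectivity: whatever is equivalent to an image is itself an
  image.\<close>

lemma map_assembly_class:
  assumes \<sigma>: "bij_tuple \<sigma> U V"
    and \<psi>: "block_bij \<sigma> U \<psi> G G'"
    and x: "x \<in> assemblies F G U"
  shows "map_assembly \<sigma> \<psi> ` (assembly_rel F G U `` {x}) = assembly_rel F G' V `` {map_assembly \<sigma> \<psi> x}"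
proof (intro subset_antisym subsetI)
  fix z assume "z \<in> map_assembly \<sigma> \<psi> ` (assembly_rel F G U `` {x})"
  then obtain y where y: "(x, y) \<in> assembly_rel F G U" "z = map_assembly \<sigma> \<psi> y" by auto
  moreover have "y \<in> assemblies F G U" using y(1) by (auto simp: assembly_rel_def)
  ultimately show "z \<in> assembly_rel F G' V `` {map_assembly \<sigma> \<psi> x}"
    using map_assembly_rel_iff[OF \<sigma> \<psi> x] by simp
next
  fix z assume "z \<in> assembly_rel F G' V `` {map_assembly \<sigma> \<psi> x}"
  then have z: "(map_assembly \<sigma> \<psi> x, z) \<in> assembly_rel F G' V" by simp
  then have "z \<in> assemblies F G' V" by (auto simp: assembly_rel_def)
  then obtain y where y: "y \<in> assemblies F G U" "map_assembly \<sigma> \<psi> y = z"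
    using map_assembly_surj[OF \<sigma> \<psi>] by blast
  then have "(x, y) \<in> assembly_rel F G U"
    using map_assembly_rel_iff[OF \<sigma> \<psi> x y(1)] z by simp
  then show "z \<in> map_assembly \<sigma> \<psi> ` (assembly_rel F G U `` {x})" using y by auto
qed

lemma bij_betw_trn:
  assumes F: "is_species F" and U: "fin_tuple U" and \<sigma>: "bij_tuple \<sigma> U V"
  shows "bij_betw (trn F U \<sigma>) (str F U) (str F V)"
proof -
  obtain \<tau> where \<tau>: "bij_tuple \<tau> V U" "\<And>s u. u \<in> U s \<Longrightarrow> \<tau> s (\<sigma> s u) = u"
    "\<And>s v. v \<in> V s \<Longrightarrow> \<sigma> s (\<tau> s v) = v"
    using bij_tuple_inverse[OF \<sigma>] by metis
  have V: "fin_tuple V" using fin_tuple_bij[OF U \<sigma>] .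
  have c: "bij_tuple (\<lambda>s. \<tau> s \<circ> \<sigma> s) U U" "bij_tuple (\<lambda>s. \<sigma> s \<circ> \<tau> s) V V"
    using \<sigma> \<tau>(1) unfolding bij_tuple_def by (meson bij_betw_trans)+
  have 1: "trn F V \<tau> (trn F U \<sigma> x) = x" if "x \<in> str F U" for x
  proof -
    have "trn F U (\<lambda>s. \<tau> s \<circ> \<sigma> s) x = trn F U (\<lambda>s u. u) x"
      using \<tau>(2) by (intro species_cong[OF F U c(1) that]) auto
    then show ?thesis using species_comp[OF F U \<sigma> that \<tau>(1)] species_id[OF F U that] by simp
  qed
  have 2: "trn F U \<sigma> (trn F V \<tau> x) = x" if "x \<in> str F V" for x
  proof -
    have "trn F V (\<lambda>s. \<sigma> s \<circ> \<tau> s) x = trn F V (\<lambda>s u. u) x"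
      using \<tau>(3) by (intro species_cong[OF F V c(2) that]) auto
    then show ?thesis using species_comp[OF F V \<tau>(1) that \<sigma>] species_id[OF F V that] by simp
  qed
  show ?thesis
    by (rule bij_betw_byWitness[where f' = "trn F V \<tau>"])
      (use 1 2 species_trn[OF F U \<sigma>] species_trn[OF F V \<tau>(1)] in auto)
qed

lemma relabel_class:
  assumes G: "\<And>t. is_species (G t)" and U: "fin_tuple U" and \<sigma>: "bij_tuple \<sigma> U V"
    and x: "x \<in> assemblies F G U"
  shows "relabel G \<sigma> ` (assembly_rel F G U `` {x}) = assembly_rel F G V `` {relabel G \<sigma> x}"
    and "relabel G \<sigma> x \<in> assemblies F G V"
proof -
  have b: "block_bij \<sigma> U (\<lambda>t W. trn (G t) W \<sigma>) G G"
    unfolding block_bij_def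
    using bij_betw_trn[OF G] fin_tuple_subset[OF U] bij_tuple_subset[OF \<sigma>] by blast
  show "relabel G \<sigma> ` (assembly_rel F G U `` {x}) = assembly_rel F G V `` {relabel G \<sigma> x}"
    unfolding relabel_eq_map_assembly by (rule map_assembly_class[OF \<sigma> b x])
  show "relabel G \<sigma> x \<in> assemblies F G V"
    unfolding relabel_eq_map_assembly by (intro map_assembly_mem[OF \<sigma> _ x]) (rule bij_betw_apply[OF block_bijD[OF b]])
qed

text \<open>Finiteness is not claimed: blocks may be empty, so the labels do not bound the number of
  points.\<close>

lemma admissible_pcomp:
  fixes F :: "'t::finite species" and G :: "'t \<Rightarrow> 's::finite species"
  assumes G: "\<And>t. is_species (G t)"
  shows "admissible (pcomp F G)"
proof (rule admissibleI)
  fix U :: "'s \<Rightarrow> nat set" assume U: "fin_tuple U"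
  have "str (pcomp F G) U = (\<lambda>x. assembly_rel F G U `` {x}) ` assemblies F G U"
    by (auto simp: str_pcomp quotient_def)
  then show "countable (str (pcomp F G) U)" by (simp add: countable_assemblies[OF U])
next
  fix U V \<sigma> c assume *: "fin_tuple U" "bij_tuple \<sigma> U V" "c \<in> str (pcomp F G) U"
  then obtain x where "x \<in> assemblies F G U" "c = assembly_rel F G U `` {x}"
    by (auto simp: str_pcomp elim: quotientE)
  then show "trn (pcomp F G) U \<sigma> c \<in> str (pcomp F G) V"
    using relabel_class[of G, OF G *(1,2)] by (simp add: str_pcomp trn_pcomp quotientI)
qed

text \<open>Allows the Newton iterate, known only up to isomorphism, to be replaced by the literal
  truncation of \<open>S\<close> inside a composition.\<close>

lemma pcomp_cong:
  fixes F :: "'t::finite species" and G :: "'t \<Rightarrow> 's::finite species"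
  assumes F: "is_species F" and G: "\<And>t. is_species (G t)" and G': "\<And>t. is_species (G' t)"
    and iso: "\<And>t. iso_all (G t) (G' t)"
  shows "iso_all (pcomp F G) (pcomp F G')"
proof -
  have "\<exists>\<phi>. (\<forall>U. fin_tuple U \<longrightarrow> bij_betw (\<phi> U) (str (G t) U) (str (G' t) U)) \<and>
     (\<forall>U V \<sigma>. fin_tuple U \<longrightarrow> bij_tuple \<sigma> U V \<longrightarrow>
        (\<forall>x\<in>str (G t) U. \<phi> V (trn (G t) U \<sigma> x) = trn (G' t) U \<sigma> (\<phi> U x)))" for t
    using iso[of t] unfolding iso_on_def by blast
  then obtain \<phi> where \<phi>: "\<And>t U. fin_tuple U \<Longrightarrow> bij_betw (\<phi> t U) (str (G t) U) (str (G' t) U)"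
    and \<phi>_nat: "\<And>t U V \<sigma> x. fin_tuple U \<Longrightarrow> bij_tuple \<sigma> U V \<Longrightarrow> x \<in> str (G t) U \<Longrightarrow>
      \<phi> t V (trn (G t) U \<sigma> x) = trn (G' t) U \<sigma> (\<phi> t U x)"
    by metis
  define m where "m = map_assembly (\<lambda>s u. u) \<phi>"
  have id: "bij_tuple (\<lambda>s u. u) U U" for U :: "'s \<Rightarrow> nat set" by (simp add: bij_tuple_def bij_betw_def)
  have b: "block_bij (\<lambda>s u. u) U \<phi> G G'" if "fin_tuple U" for U
    unfolding block_bij_def using \<phi> fin_tuple_subset[OF that] by (simp add: image_tuple_def)
  show ?thesis
  proof (rule iso_onI[where \<phi> = "\<lambda>U c. m ` c"])
    fix U :: "'s \<Rightarrow> nat set" assume U: "fin_tuple U"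
    note cls = map_assembly_class[OF id b[OF U], folded m_def]
    note rel = map_assembly_rel_iff[OF id b[OF U], folded m_def]
    have mem: "m x \<in> assemblies F G' U" if "x \<in> assemblies F G U" for x
      unfolding m_def by (intro map_assembly_mem[OF id _ that]) (rule bij_betw_apply[OF block_bijD[OF b[OF U]]])
    show "bij_betw ((`) m) (str (pcomp F G) U) (str (pcomp F G') U)"
      unfolding bij_betw_def
    proof
      show "inj_on ((`) m) (str (pcomp F G) U)"
      proof (rule inj_onI)
        fix c d assume "c \<in> str (pcomp F G) U" "d \<in> str (pcomp F G) U" and cd: "m ` c = m ` d"
        then obtain x y where x: "x \<in> assemblies F G U" "c = assembly_rel F G U `` {x}"
          and y: "y \<in> assemblies F G U" "d = assembly_rel F G U `` {y}"
          by (auto simp: str_pcomp elim!: quotientE)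
        have "(m x, m y) \<in> assembly_rel F G' U"
          using cd cls[OF x(1)] cls[OF y(1)] mem[OF x(1)] mem[OF y(1)] x y
            eq_equiv_class_iff[OF equiv_assembly_rel[OF F]] by metis
        then show "c = d"
          using rel[OF x(1) y(1)] x y equiv_class_eq[OF equiv_assembly_rel[OF F]] by metis
      qed
      show "(`) m ` str (pcomp F G) U = str (pcomp F G') U"
      proof (intro subset_antisym subsetI)
        fix d assume "d \<in> (`) m ` str (pcomp F G) U"
        then obtain x where x: "x \<in> assemblies F G U" "d = m ` (assembly_rel F G U `` {x})"
          by (auto simp: str_pcomp elim!: quotientE)
        then show "d \<in> str (pcomp F G') U"
          using cls[OF x(1)] mem[OF x(1)] by (simp add: str_pcomp quotientI)
      next
        fix d assume "d \<in> str (pcomp F G') U"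
        then obtain y where y: "y \<in> assemblies F G' U" "d = assembly_rel F G' U `` {y}"
          by (auto simp: str_pcomp elim!: quotientE)
        obtain x where x: "x \<in> assemblies F G U" "m x = y"
          using map_assembly_surj[OF id b[OF U] y(1)] unfolding m_def by blast
        then show "d \<in> (`) m ` str (pcomp F G) U"
          using cls[OF x(1)] y(2) quotientI[OF x(1), of "assembly_rel F G U"]
          by (intro image_eqI[where x = "assembly_rel F G U `` {x}"]) (simp_all add: str_pcomp)
      qed
    qed
  next
    fix U V \<sigma> c assume *: "fin_tuple U" "bij_tuple \<sigma> U V" "c \<in> str (pcomp F G) U"
    then have c: "c \<subseteq> assemblies F G U"
      using in_quotient_imp_subset[OF equiv_assembly_rel[OF F]] by (simp add: str_pcomp)
    \<comment> \<open>Naturality on classes reduces to representatives, since both maps act by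
      direct image, and there to the naturality of \<open>\<phi>\<close> on each block.\<close>
    have "m (relabel G \<sigma> x) = relabel G' \<sigma> (m x)" if "x \<in> assemblies F G U" for x
    proof -
      obtain A B f g where x': "x = (A, B, f, g)" by (metis prod_cases4)
      have x: "(A, B, f, g) \<in> assemblies F G U" using that x' by simp
      have "\<phi> t (image_tuple \<sigma> (B t a)) (trn (G t) (B t a) \<sigma> (g t a)) = trn (G' t) (B t a) \<sigma> (\<phi> t (B t a) (g t a))"
        if "a \<in> A t" for t a
      proof -
        have sub: "\<And>s. B t a s \<subseteq> U s" using assembly_block_subset[OF x] .
        show ?thesis
          by (rule \<phi>_nat[OF fin_tuple_subset[OF *(1) sub] bij_tuple_subset[OF *(2) sub]])
            (rule assembly_inner[OF x that])
      qed
      then show ?thesis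
        by (auto simp: x' m_def map_assembly_def relabel_def image_tuple_def fun_eq_iff)
    qed
    then show "m ` trn (pcomp F G) U \<sigma> c = trn (pcomp F G') U \<sigma> (m ` c)"
      unfolding trn_pcomp image_image using c by (intro image_cong) auto
  qed (use G G' in \<open>auto intro: admissible_pcomp\<close>)
qed


section \<open>Points of an assembly and the derivative\<close>

text \<open>The shift built into \<open>spderiv\<close>: the hole is 0 and the other points of sort
  \<open>t\<close> move up by one. \<open>lift_point\<close> is the matching extension of a
  renaming, fixing the hole.\<close>

definition add_point :: "'t \<Rightarrow> ('t \<Rightarrow> nat set) \<Rightarrow> 't \<Rightarrow> nat set" where
  "add_point t A = A(t := insert 0 (Suc ` A t))"

definition lift_point :: "'t \<Rightarrow> ('t \<Rightarrow> nat \<Rightarrow> nat) \<Rightarrow> 't \<Rightarrow> nat \<Rightarrow> nat" where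
  "lift_point t \<rho> = \<rho>(t := case_nat 0 (\<lambda>u. Suc (\<rho> t u)))"

lemma str_spderiv: "str (spderiv t F) A = str F (add_point t A)"
  and trn_spderiv: "trn (spderiv t F) A \<rho> = trn F (add_point t A) (lift_point t \<rho>)"
  by (simp_all add: spderiv_def add_point_def lift_point_def)

lemma fin_tuple_add_point: "fin_tuple (add_point t A) \<longleftrightarrow> fin_tuple A"
  by (auto simp: fin_tuple_def add_point_def finite_image_iff split: if_splits)

lemma bij_tuple_lift_point:
  assumes "bij_tuple \<rho> A A'"
  shows "bij_tuple (lift_point t \<rho>) (add_point t A) (add_point t A')"
  unfolding bij_tuple_def
proof
  fix s
  have b: "bij_betw (\<rho> s) (A s) (A' s)" using assms by (simp add: bij_tuple_def)
  show "bij_betw (lift_point t \<rho> s) (add_point t A s) (add_point t A' s)"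
  proof (cases "s = t")
    case True
    have "inj_on (case_nat 0 (\<lambda>u. Suc (\<rho> t u))) (insert 0 (Suc ` A t))"
      using b True by (auto simp: inj_on_def bij_betw_def)
    moreover have "case_nat 0 (\<lambda>u. Suc (\<rho> t u)) ` insert 0 (Suc ` A t) = insert 0 (Suc ` \<rho> t ` A t)"
      by (simp add: image_image)
    then have "case_nat 0 (\<lambda>u. Suc (\<rho> t u)) ` insert 0 (Suc ` A t) = insert 0 (Suc ` A' t)"
      using b True by (simp add: bij_betw_def)
    ultimately show ?thesis using True by (simp add: bij_betw_def lift_point_def add_point_def)
  next
    case False
    then show ?thesis using b by (simp add: lift_point_def add_point_def)
  qed
qed

lemma is_species_spderiv:
  assumes F: "is_species F"
  shows "is_species (spderiv t F)"
proof (rule is_speciesI)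
  fix U V W :: "'a \<Rightarrow> nat set" and \<sigma> \<tau> x assume U: "fin_tuple U"
  note U' = U[unfolded fin_tuple_add_point[of t U, symmetric]]
  show "finite (str (spderiv t F) U)" using species_finite[OF F U'] by (simp add: str_spderiv)
  assume "x \<in> str (spderiv t F) U"
  then have x: "x \<in> str F (add_point t U)" by (simp add: str_spderiv)
  have id: "bij_tuple (\<lambda>s u. u) U U" by (simp add: bij_tuple_def bij_betw_def)
  have "trn F (add_point t U) (lift_point t (\<lambda>s u. u)) x = trn F (add_point t U) (\<lambda>s u. u) x"
    by (rule species_cong[OF F U' bij_tuple_lift_point[OF id] x])
      (auto simp: add_point_def lift_point_def split: if_splits nat.splits)
  then show "trn (spderiv t F) U (\<lambda>s u. u) x = x"
    using species_id[OF F U' x] by (simp add: trn_spderiv)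
  assume \<sigma>: "bij_tuple \<sigma> U V"
  note \<sigma>' = bij_tuple_lift_point[OF \<sigma>, of t]
  show "trn (spderiv t F) U \<sigma> x \<in> str (spderiv t F) V"
    using species_trn[OF F U' \<sigma>' x] by (simp add: trn_spderiv str_spderiv)
  show "trn (spderiv t F) U \<sigma> x = trn (spderiv t F) U \<tau> x" if "\<And>s u. u \<in> U s \<Longrightarrow> \<sigma> s u = \<tau> s u"
    unfolding trn_spderiv
    by (rule species_cong[OF F U' \<sigma>' x])
      (use that in \<open>auto simp: add_point_def lift_point_def split: if_splits\<close>)
  assume \<tau>: "bij_tuple \<tau> V W"
  note \<tau>' = bij_tuple_lift_point[OF \<tau>, of t]
  have "(\<lambda>s. lift_point t \<tau> s \<circ> lift_point t \<sigma> s) = lift_point t (\<lambda>s. \<tau> s \<circ> \<sigma> s)"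
    by (auto simp: lift_point_def fun_eq_iff split: nat.splits)
  then show "trn (spderiv t F) V \<tau> (trn (spderiv t F) U \<sigma> x) = trn (spderiv t F) U (\<lambda>s. \<tau> s \<circ> \<sigma> s) x"
    using species_comp[OF F U' \<sigma>' x \<tau>'] by (simp add: trn_spderiv)
qed

text \<open>Fills the hole of a derivative structure: point 0 of sort \<open>t\<close> receives the
  block \<open>W\<close> with structure \<open>y\<close>. On classes this is the map from the
  product of F'(G) and G_t to F(G) underlying the Taylor expansion.\<close>

definition insert_point ::
  "'t \<Rightarrow> ('s \<Rightarrow> nat set) \<Rightarrow> nat \<Rightarrow> ('t, 's) assembly \<Rightarrow> ('t, 's) assembly" where
  "insert_point t W y = (\<lambda>(A, B, f, g).
     (add_point t A, B(t := case_nat W (B t)), f, g(t := case_nat y (g t))))"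

lemma add_point_cases:
  assumes "a \<in> add_point t A t'"
  obtains (new) "t' = t" "a = 0" | (old) b where "b \<in> A t'" "a = (if t' = t then Suc b else b)"
  using assms by (auto simp: add_point_def split: if_splits)

lemma insert_point_mem:
  assumes x: "x \<in> assemblies (spderiv t F) G V" and V: "\<And>s. V s \<subseteq> U s"
    and y: "y \<in> str (G t) (\<lambda>s. U s - V s)"
  shows "insert_point t (\<lambda>s. U s - V s) y x \<in> assemblies F G U"
proof -
  obtain A B f g where x': "x = (A, B, f, g)" by (metis prod_cases4)
  note x = x[unfolded x']
  define W where "W = (\<lambda>s. U s - V s)"
  define B' where "B' = B(t := case_nat W (B t))"
  define g' where "g' = g(t := case_nat y (g t))"
  have B'0: "B' t 0 = W" and B'1: "B' t' (if t' = t then Suc b else b) = B t' b" for t' b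
    by (auto simp: B'_def)
  have g'0: "g' t 0 = y" and g'1: "g' t' (if t' = t then Suc b else b) = g t' b" for t' b
    by (auto simp: g'_def)
  have sub: "B t' b s \<subseteq> V s" for t' b s using assembly_block_subset[OF x] .
  have mem: "(if t' = t then Suc b else b) \<in> add_point t A t' \<longleftrightarrow> b \<in> A t'" for t' b
    by (auto simp: add_point_def)
  have "(add_point t A, B', f, g') \<in> assemblies F G U"
    unfolding assemblies_iff
  proof (intro conjI allI impI ballI)
    show "fin_tuple (add_point t A)" using assembly_fin[OF x] by (simp add: fin_tuple_add_point)
    show "f \<in> str F (add_point t A)" using assembly_outer[OF x] by (simp add: str_spderiv)
    show "g' t' a \<in> str (G t') (B' t' a)" if "a \<in> add_point t A t'" for t' a
      using that
    proof (cases rule: add_point_cases)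
      case new
      then show ?thesis using y by (simp add: g'0 B'0 W_def)
    next
      case (old b)
      then show ?thesis using assembly_inner[OF x old(1)] by (simp only: g'1 B'1)
    qed
    show "B' t' a = (\<lambda>s. {})" if "a \<notin> add_point t A t'" for t' a
      using that assembly_outside(1)[OF x] by (auto simp: B'_def add_point_def split: nat.splits if_splits)
    show "g' t' a = 0" if "a \<notin> add_point t A t'" for t' a
      using that assembly_outside(2)[OF x] by (auto simp: g'_def add_point_def split: nat.splits if_splits)
    show "B' t1 a1 s \<inter> B' t2 a2 s = {}"
      if a1: "a1 \<in> add_point t A t1" and a2: "a2 \<in> add_point t A t2" and ne: "(t1, a1) \<noteq> (t2, a2)"
      for s t1 a1 t2 a2
      using a1
    proof (cases rule: add_point_cases)
      case new
      note new' = this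
      show ?thesis
        using a2
      proof (cases rule: add_point_cases)
        case new
        then show ?thesis using new' ne by simp
      next
        case (old b)
        have "B' t1 a1 = W" using new' B'0 by simp
        moreover have "B' t2 a2 = B t2 b" using old B'1 by simp
        ultimately show ?thesis using sub[of t2 b s] by (auto simp: W_def)
      qed
    next
      case (old b1)
      have B1: "B' t1 a1 = B t1 b1" using old B'1 by simp
      show ?thesis
        using a2
      proof (cases rule: add_point_cases)
        case new
        then have "B' t2 a2 = W" using B'0 by simp
        then show ?thesis using B1 sub[of t1 b1 s] by (auto simp: W_def)
      next
        case (old b2)
        have "B' t2 a2 = B t2 b2" using old B'1 by simp
        moreover have "(t1, b1) \<noteq> (t2, b2)" using ne old \<open>a1 = _\<close> by auto
        ultimately show ?thesis
          using B1 assembly_disjoint[OF x \<open>b1 \<in> A t1\<close> \<open>b2 \<in> A t2\<close>] by simp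
      qed
    qed
    show "u \<in> U s \<longleftrightarrow> (\<exists>t' a. a \<in> add_point t A t' \<and> u \<in> B' t' a s)" for s u
    proof
      assume u: "u \<in> U s"
      show "\<exists>t' a. a \<in> add_point t A t' \<and> u \<in> B' t' a s"
      proof (cases "u \<in> V s")
        case True
        then obtain t' b where "b \<in> A t'" "u \<in> B t' b s" using assembly_Union[OF x] by metis
        then show ?thesis using mem B'1 by metis
      next
        case False
        then have "u \<in> B' t 0 s" using u B'0 by (simp add: W_def)
        moreover have "0 \<in> add_point t A t" by (simp add: add_point_def)
        ultimately show ?thesis by blast
      qed
    next
      assume "\<exists>t' a. a \<in> add_point t A t' \<and> u \<in> B' t' a s"
      then obtain t' a where a: "a \<in> add_point t A t'" and u: "u \<in> B' t' a s" by blast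
      from a show "u \<in> U s"
      proof (cases rule: add_point_cases)
        case new
        then show ?thesis using u B'0 by (simp add: W_def)
      next
        case (old b)
        then have "u \<in> B t' b s" using u B'1 by simp
        then show ?thesis using sub V by blast
      qed
    qed
  qed
  then show ?thesis by (simp add: x' insert_point_def B'_def g'_def W_def)
qed

text \<open>Transport in the derivative is transport along the renaming extended by fixing the hole,
  so that extension witnesses the equivalence of the filled assemblies. Filling is therefore well
  defined on classes.\<close>

lemma insert_point_rel:
  assumes xx: "(x, x') \<in> assembly_rel (spderiv t F) G V" and V: "\<And>s. V s \<subseteq> U s"
    and y: "y \<in> str (G t) (\<lambda>s. U s - V s)"
  shows "(insert_point t (\<lambda>s. U s - V s) y x, insert_point t (\<lambda>s. U s - V s) y x') \<in> assembly_rel F G U"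
proof -
  obtain A B f g where x: "x = (A, B, f, g)" by (metis prod_cases4)
  obtain A' B' f' g' where x': "x' = (A', B', f', g')" by (metis prod_cases4)
  obtain \<rho> where \<rho>: "x \<in> assemblies (spderiv t F) G V" "x' \<in> assemblies (spderiv t F) G V"
    "bij_tuple \<rho> A A'" "trn (spderiv t F) A \<rho> f = f'"
    "\<And>t a. a \<in> A t \<Longrightarrow> B' t (\<rho> t a) = B t a" "\<And>t a. a \<in> A t \<Longrightarrow> g' t (\<rho> t a) = g t a"
    using assembly_relE[OF xx[unfolded x x']] unfolding x x' by metis
  have mem: "insert_point t (\<lambda>s. U s - V s) y x \<in> assemblies F G U"
    "insert_point t (\<lambda>s. U s - V s) y x' \<in> assemblies F G U"
    using insert_point_mem[OF \<rho>(1) V y] insert_point_mem[OF \<rho>(2) V y] by simp_all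
  show ?thesis
    unfolding x x' insert_point_def prod.case
  proof (rule assembly_relI[where \<rho> = "lift_point t \<rho>"])
    show "bij_tuple (lift_point t \<rho>) (add_point t A) (add_point t A')"
      by (rule bij_tuple_lift_point[OF \<rho>(3)])
    show "trn F (add_point t A) (lift_point t \<rho>) f = f'" using \<rho>(4) by (simp add: trn_spderiv)
  qed (use mem \<rho>(5,6) in \<open>auto simp: x x' insert_point_def lift_point_def add_point_def split: if_splits\<close>)
qed

text \<open>Holes can be reopened if the renaming fixes them, which is the assumption
  \<open>\<rho>0\<close>. Otherwise a hole filled with an empty block could be exchanged with
  another point whose block is empty.\<close>

lemma insert_point_rel_cancel:
  assumes F: "is_species F"
    and x: "(A, B, f, g) \<in> assemblies (spderiv t F) G V"
    and x': "(A', B', f', g') \<in> assemblies (spderiv t F) G V"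
    and f: "f \<in> str F (add_point t A)"
    and \<rho>: "bij_tuple \<rho> (add_point t A) (add_point t A')" "trn F (add_point t A) \<rho> f = f'"
    and \<rho>_B: "\<And>t' a. a \<in> add_point t A t' \<Longrightarrow> (B'(t := case_nat W (B' t))) t' (\<rho> t' a) = (B(t := case_nat W (B t))) t' a"
    and \<rho>_g: "\<And>t' a. a \<in> add_point t A t' \<Longrightarrow> (g'(t := case_nat y (g' t))) t' (\<rho> t' a) = (g(t := case_nat y (g t))) t' a"
    and \<rho>0: "\<rho> t 0 = 0"
  shows "((A, B, f, g), (A', B', f', g')) \<in> assembly_rel (spderiv t F) G V"
proof -
  \<comment> \<open>Since 0 is fixed and the renaming is injective, successors go to successors, so
    the shift can be undone by subtracting 1.\<close>
  define \<rho>' where "\<rho>' = \<rho>(t := \<lambda>a. \<rho> t (Suc a) - 1)"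
  have b: "bij_betw (\<rho> t) (insert 0 (Suc ` A t)) (insert 0 (Suc ` A' t))"
    using \<rho>(1) by (auto simp: bij_tuple_def add_point_def split: if_splits)
  have Suc: "\<exists>b\<in>A' t. \<rho> t (Suc a) = Suc b" if "a \<in> A t" for a
  proof -
    have "\<rho> t (Suc a) \<noteq> \<rho> t 0" using b that by (auto simp: bij_betw_def inj_on_def)
    moreover have "\<rho> t (Suc a) \<in> insert 0 (Suc ` A' t)" using b that by (auto simp: bij_betw_def)
    ultimately show ?thesis using \<rho>0 by auto
  qed
  have Suc': "\<rho> t (Suc a) = Suc (\<rho>' t a)" if "a \<in> A t" for a
    using Suc[OF that] by (auto simp: \<rho>'_def)
  have "bij_betw (\<rho>' t) (A t) (A' t)"
    unfolding bij_betw_def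
  proof
    show "inj_on (\<rho>' t) (A t)"
    proof (rule inj_onI)
      fix a a' assume "a \<in> A t" "a' \<in> A t" "\<rho>' t a = \<rho>' t a'"
      then have "\<rho> t (Suc a) = \<rho> t (Suc a')" using Suc' by simp
      then show "a = a'" using b \<open>a \<in> A t\<close> \<open>a' \<in> A t\<close> by (auto simp: bij_betw_def inj_on_def)
    qed
    show "\<rho>' t ` A t = A' t"
    proof (intro subset_antisym subsetI)
      fix c assume "c \<in> \<rho>' t ` A t"
      then show "c \<in> A' t" using Suc Suc' by force
    next
      fix c assume "c \<in> A' t"
      then have "Suc c \<in> \<rho> t ` insert 0 (Suc ` A t)" using b by (simp add: bij_betw_def)
      then obtain a where "a \<in> A t" "Suc c = \<rho> t (Suc a)" using \<rho>0 by auto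
      then show "c \<in> \<rho>' t ` A t" using Suc' by auto
    qed
  qed
  then have \<rho>': "bij_tuple \<rho>' A A'"
    using \<rho>(1) by (auto simp: bij_tuple_def add_point_def \<rho>'_def split: if_splits)
  have fin: "fin_tuple (add_point t A)" using assembly_fin[OF x] by (simp add: fin_tuple_add_point)
  have "trn F (add_point t A) \<rho> f = trn F (add_point t A) (lift_point t \<rho>') f"
    by (rule species_cong[OF F fin \<rho>(1) f])
      (use \<rho>0 Suc' in \<open>auto simp: add_point_def lift_point_def \<rho>'_def split: if_splits\<close>)
  then have "trn (spderiv t F) A \<rho>' f = f'" using \<rho>(2) by (simp add: trn_spderiv)
  then show ?thesis
  proof (rule assembly_relI[OF x x' \<rho>'])
    fix t' a assume a: "a \<in> A t'"
    have eq: "\<rho> t' (if t' = t then Suc a else a) = (if t' = t then Suc (\<rho>' t' a) else \<rho>' t' a)"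
    proof (cases "t' = t")
      case True
      then show ?thesis using Suc' a by simp
    next
      case False
      then show ?thesis by (simp add: \<rho>'_def)
    qed
    have mem: "(if t' = t then Suc a else a) \<in> add_point t A t'" using a by (auto simp: add_point_def)
    show "B' t' (\<rho>' t' a) = B t' a" "g' t' (\<rho>' t' a) = g t' a"
      using \<rho>_B[OF mem] \<rho>_g[OF mem] unfolding eq by (simp_all split: if_splits)
  qed
qed

text \<open>Any point of sort \<open>t\<close> can serve as the hole: rename it to 0, shift the
  others of that sort, and transport the outer structure along this renaming.\<close>

lemma insert_point_surj:
  assumes F: "is_species F" and x: "(A, B, f, g) \<in> assemblies F G U" and a0: "a0 \<in> A t"
  obtains y where "y \<in> assemblies (spderiv t F) G (\<lambda>s. U s - B t a0 s)"
    "(insert_point t (B t a0) (g t a0) y, (A, B, f, g)) \<in> assembly_rel F G U"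
proof -
  define A0 where "A0 = A(t := A t - {a0})"
  \<comment> \<open>Once \<open>a0\<close> is no longer a point, its block and structure must take
    the default values prescribed outside \<open>A0\<close>.\<close>
  define B0 where "B0 = B(t := (B t)(a0 := \<lambda>s. {}))"
  define g0 where "g0 = g(t := (g t)(a0 := 0))"
  define \<rho> where "\<rho> = (\<lambda>t' a. if t' = t then (if a = a0 then 0 else Suc a) else a)"
  define V where "V = (\<lambda>s. U s - B t a0 s)"
  have sub: "B t' a s \<subseteq> U s" for t' a s using assembly_block_subset[OF x] .
  have \<rho>: "bij_tuple \<rho> A (add_point t A0)"
    unfolding bij_tuple_def
  proof
    fix s
    show "bij_betw (\<rho> s) (A s) (add_point t A0 s)"
    proof (cases "s = t")
      case True
      have "\<rho> t ` A t = insert 0 (Suc ` (A t - {a0}))"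
        using a0 by (auto simp: \<rho>_def image_iff)
      moreover have "inj_on (\<rho> t) (A t)" by (auto simp: inj_on_def \<rho>_def)
      ultimately show ?thesis using True by (simp add: bij_betw_def add_point_def A0_def)
    next
      case False
      then show ?thesis by (simp add: \<rho>_def add_point_def A0_def bij_betw_def)
    qed
  qed
  define f0 where "f0 = trn F A \<rho> f"
  have f0: "f0 \<in> str F (add_point t A0)"
    unfolding f0_def by (rule species_trn[OF F assembly_fin[OF x] \<rho> assembly_outer[OF x]])
  have pt: "a \<in> A0 t' \<longleftrightarrow> a \<in> A t' \<and> (t', a) \<noteq> (t, a0)" for a t' by (auto simp: A0_def)
  have B0: "B0 t' a = B t' a" and g0: "g0 t' a = g t' a" if "(t', a) \<noteq> (t, a0)" for t' a
    using that by (auto simp: B0_def g0_def)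
  have B00: "B0 t a0 = (\<lambda>s. {})" and g00: "g0 t a0 = 0" by (auto simp: B0_def g0_def)
  have y: "(A0, B0, f0, g0) \<in> assemblies (spderiv t F) G V"
    unfolding assemblies_iff
  proof (intro conjI allI impI ballI)
    show "fin_tuple A0" using assembly_fin[OF x] by (auto simp: fin_tuple_def A0_def)
    show "f0 \<in> str (spderiv t F) A0" using f0 by (simp add: str_spderiv)
    show "g0 t' a \<in> str (G t') (B0 t' a)" if "a \<in> A0 t'" for t' a
      using that assembly_inner[OF x] B0 g0 pt by simp
    show "B0 t' a = (\<lambda>s. {})" if "a \<notin> A0 t'" for t' a
    proof (cases "(t', a) = (t, a0)")
      case True then show ?thesis using B00 by simp
    next
      case False then show ?thesis using that assembly_outside(1)[OF x] B0 pt by simp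
    qed
    show "g0 t' a = 0" if "a \<notin> A0 t'" for t' a
    proof (cases "(t', a) = (t, a0)")
      case True then show ?thesis using g00 by simp
    next
      case False then show ?thesis using that assembly_outside(2)[OF x] g0 pt by simp
    qed
    show "B0 t1 a1 s \<inter> B0 t2 a2 s = {}" if "a1 \<in> A0 t1" "a2 \<in> A0 t2" "(t1, a1) \<noteq> (t2, a2)"
      for s t1 a1 t2 a2
      using assembly_disjoint[OF x _ _ that(3)] that pt B0 by simp
    show "u \<in> V s \<longleftrightarrow> (\<exists>t' a. a \<in> A0 t' \<and> u \<in> B0 t' a s)" for s u
    proof
      assume "u \<in> V s"
      then have u: "u \<in> U s" "u \<notin> B t a0 s" by (auto simp: V_def)
      then obtain t' a where a: "a \<in> A t'" "u \<in> B t' a s" using assembly_Union[OF x] by metis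
      then have "(t', a) \<noteq> (t, a0)" using u by auto
      then show "\<exists>t' a. a \<in> A0 t' \<and> u \<in> B0 t' a s" using a pt B0 by metis
    next
      assume "\<exists>t' a. a \<in> A0 t' \<and> u \<in> B0 t' a s"
      then obtain t' a where a: "a \<in> A t'" "(t', a) \<noteq> (t, a0)" "u \<in> B t' a s" using pt B0 by metis
      then have "B t' a s \<inter> B t a0 s = {}" using assembly_disjoint[OF x a(1) a0 a(2)] by blast
      then show "u \<in> V s" using a(3) sub[of t' a s] by (auto simp: V_def)
    qed
  qed
  have V: "(\<lambda>s. U s - V s) = B t a0" using sub by (auto simp: V_def fun_eq_iff)
  have "insert_point t (\<lambda>s. U s - V s) (g t a0) (A0, B0, f0, g0) \<in> assemblies F G U"
    by (rule insert_point_mem[OF y]) (use assembly_inner[OF x a0] in \<open>auto simp: V[symmetric]\<close>, auto simp: V_def)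
  then have mem: "(add_point t A0, B0(t := case_nat (B t a0) (B0 t)), f0, g0(t := case_nat (g t a0) (g0 t)))
      \<in> assemblies F G U"
    by (simp add: V insert_point_def)
  have "((A, B, f, g), insert_point t (B t a0) (g t a0) (A0, B0, f0, g0)) \<in> assembly_rel F G U"
    unfolding insert_point_def prod.case
    by (rule assembly_relI[OF x mem \<rho>])
      (auto simp: f0_def \<rho>_def B0_def g0_def)
  then have "(insert_point t (B t a0) (g t a0) (A0, B0, f0, g0), (A, B, f, g)) \<in> assembly_rel F G U"
    using equiv_assembly_rel[OF F] by (meson equivE symD)
  then show thesis using that y unfolding V_def by blast
qed

text \<open>Naturality of filling the hole, as an equality of assemblies and not only of classes,
  because relabelling leaves the points alone.\<close>

lemma relabel_insert_point:
  "relabel G \<sigma> (insert_point t W y x) = insert_point t (image_tuple \<sigma> W) (trn (G t) W \<sigma> y) (relabel G \<sigma> x)"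
  by (cases x) (auto simp: relabel_def insert_point_def add_point_def fun_eq_iff split: nat.splits)


section \<open>Taylor expansion of a composition\<close>

abbreviation subst_family :: "('n \<Rightarrow> 'z species) \<Rightarrow> 'z + 'n \<Rightarrow> 'z species" where
  "subst_family Y \<equiv> case_sum singleton Y"

lemma is_species_singleton: "is_species (singleton s)"
proof (rule is_speciesI)
  fix U V :: "'a \<Rightarrow> nat set" and \<sigma> x
  assume *: "bij_tuple \<sigma> U V" "x \<in> str (singleton s) U"
  then obtain u where "U = (\<lambda>t. if t = s then {u} else {})" and x: "x = 0"
    by (auto simp: singleton_def split: if_splits)
  then have "image_tuple \<sigma> U = (\<lambda>t. if t = s then {\<sigma> s u} else {})"
    by (auto simp: image_tuple_def fun_eq_iff)
  then have "V = (\<lambda>t. if t = s then {\<sigma> s u} else {})"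
    using image_tuple_bij[OF *(1)] by simp
  then show "trn (singleton s) U \<sigma> x \<in> str (singleton s) V"
    using x by (auto simp: singleton_def)
qed (auto simp: singleton_def)

lemma is_species_subst_family: "(\<And>j. is_species (Y j)) \<Longrightarrow> is_species (subst_family Y t)"
  by (cases t) (auto simp: is_species_singleton)

lemma subst_family_iso: "(\<And>j. iso_all (Y j) (Y' j)) \<Longrightarrow> iso_all (subst_family Y t) (subst_family Y' t)"
  by (cases t) (auto intro: iso_on_refl is_species_admissible is_species_singleton)

section \<open>Truncating the species substituted for the sorts \<open>Y\<close>\<close>

lemma truncated_assemblies_iff:
  "(A, B, f, g) \<in> assemblies F (subst_family (\<lambda>j. srestr p (S j))) U \<longleftrightarrow>
    (A, B, f, g) \<in> assemblies F (subst_family S) U \<and> (\<forall>j. \<forall>a\<in>A (Inr j). size_tuple (B (Inr j) a) \<le> p)"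
proof -
  have "(\<forall>t. \<forall>a\<in>A t. g t a \<in> str (subst_family (\<lambda>j. srestr p (S j)) t) (B t a)) \<longleftrightarrow>
    (\<forall>t. \<forall>a\<in>A t. g t a \<in> str (subst_family S t) (B t a)) \<and>
    (\<forall>j. \<forall>a\<in>A (Inr j). size_tuple (B (Inr j) a) \<le> p)"
    unfolding split_sum_all by (auto simp: srestr_eq_prestr str_prestr split: if_splits)
  then show ?thesis unfolding assemblies_iff by blast
qed

lemma truncated_assemblies_subset:
  "assemblies F (subst_family (\<lambda>j. srestr p (S j))) U \<subseteq> assemblies F (subst_family S) U"
  using truncated_assemblies_iff by fast

lemma small_assemblies_truncated:
  fixes F :: "('z::finite + 'n) species"
  assumes "fin_tuple U" "size_tuple U \<le> p" "x \<in> assemblies F (subst_family S) U"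
  shows "x \<in> assemblies F (subst_family (\<lambda>j. srestr p (S j))) U"
proof -
  obtain A B f g where x: "x = (A, B, f, g)" by (metis prod_cases4)
  have "size_tuple (B t a) \<le> size_tuple U" for t a
    by (rule size_tuple_mono[OF assms(1)]) (rule assembly_block_subset[OF assms(3)[unfolded x]])
  then have "size_tuple (B t a) \<le> p" for t a
    using assms(2) by (rule le_trans)
  then show ?thesis using assms(3) unfolding x truncated_assemblies_iff by blast
qed

text \<open>Renaming points preserves block sizes, so a class meets the size bound as a whole or not
  at all. The composition with truncated species thus consists literally of some of the classes of
  the full one.\<close>

lemma truncated_class:
  fixes F :: "('z::finite + 'n) species"
  assumes x: "x \<in> assemblies F (subst_family (\<lambda>j. srestr p (S j))) U"
  shows "assembly_rel F (subst_family (\<lambda>j. srestr p (S j))) U `` {x} = assembly_rel F (subst_family S) U `` {x}"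
proof -
  have "(x, y) \<in> assembly_rel F (subst_family (\<lambda>j. srestr p (S j))) U \<longleftrightarrow> (x, y) \<in> assembly_rel F (subst_family S) U"
    for y
  proof
    assume "(x, y) \<in> assembly_rel F (subst_family (\<lambda>j. srestr p (S j))) U"
    then show "(x, y) \<in> assembly_rel F (subst_family S) U"
      unfolding assembly_rel_def using truncated_assemblies_subset by fast
  next
    assume xy: "(x, y) \<in> assembly_rel F (subst_family S) U"
    obtain A B f g where x': "x = (A, B, f, g)" by (metis prod_cases4)
    obtain A' B' f' g' where y': "y = (A', B', f', g')" by (metis prod_cases4)
    obtain \<rho> where \<rho>: "(A', B', f', g') \<in> assemblies F (subst_family S) U"
      "bij_tuple \<rho> A A'" "trn F A \<rho> f = f'"
      "\<And>t a. a \<in> A t \<Longrightarrow> B' t (\<rho> t a) = B t a" "\<And>t a. a \<in> A t \<Longrightarrow> g' t (\<rho> t a) = g t a"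
      using assembly_relE[OF xy[unfolded x' y']] by metis
    have "size_tuple (B' (Inr j) a) \<le> p" if "a \<in> A' (Inr j)" for j a
    proof -
      have "a \<in> \<rho> (Inr j) ` A (Inr j)" using \<rho>(2) that by (simp add: bij_tuple_def bij_betw_def)
      then obtain b where "b \<in> A (Inr j)" "a = \<rho> (Inr j) b" by blast
      then show ?thesis using \<rho>(4) x unfolding x' truncated_assemblies_iff by simp
    qed
    then have "(A', B', f', g') \<in> assemblies F (subst_family (\<lambda>j. srestr p (S j))) U"
      using \<rho>(1) unfolding truncated_assemblies_iff by blast
    then show "(x, y) \<in> assembly_rel F (subst_family (\<lambda>j. srestr p (S j))) U"
      using x \<rho>(2-5) unfolding x' y' by (intro assembly_relI[where \<rho> = \<rho>])
  qed
  then show ?thesis by blast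
qed

lemma relabel_truncated: "relabel (subst_family (\<lambda>j. srestr p (S j))) = relabel (subst_family S)"
proof -
  have "trn (subst_family (\<lambda>j. srestr p (S j)) t) = trn (subst_family S t)" for t
    by (cases t) (auto simp: srestr_eq_prestr)
  then show ?thesis by (simp add: relabel_def fun_eq_iff)
qed

lemma str_pcomp_truncated_subset:
  fixes F :: "('z::finite + 'n) species"
  shows "str (pcomp F (subst_family (\<lambda>j. srestr p (S j)))) U \<subseteq> str (pcomp F (subst_family S)) U"
proof
  fix c assume "c \<in> str (pcomp F (subst_family (\<lambda>j. srestr p (S j)))) U"
  then obtain x where x: "x \<in> assemblies F (subst_family (\<lambda>j. srestr p (S j))) U"
    "c = assembly_rel F (subst_family (\<lambda>j. srestr p (S j))) U `` {x}"
    by (auto simp: str_pcomp elim: quotientE)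
  then have "c = assembly_rel F (subst_family S) U `` {x}" using truncated_class by blast
  moreover have "x \<in> assemblies F (subst_family S) U" using x truncated_assemblies_subset by blast
  ultimately show "c \<in> str (pcomp F (subst_family S)) U" by (simp add: str_pcomp quotientI)
qed

text \<open>
  On at most \<open>2p + 1\<close> labels, an assembly has at most one block with more than \<open>p\<close> labels.
  If there is one, its point becomes the hole of a structure of the derivative.
\<close>

theorem taylor_expansion:
  fixes F :: "('z::finite + 'n::finite) species" and S :: "'n \<Rightarrow> 'z species" and p :: nat
  assumes F: "is_species F" and S: "\<And>j. is_species (S j)"
  defines "T \<equiv> subst_family (\<lambda>j. srestr p (S j))"
  shows "iso_on (\<lambda>k. k \<le> 2 * p + 1) (pcomp F (subst_family S))
    (pplus (pcomp F T)
      (psum UNIV (\<lambda>j. pprod (pcomp (spderiv (Inr j) F) T) (prestr (\<lambda>k. p < k) (S j)))))"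
proof -
  let ?S = "subst_family S"
  define E where "E j = prestr (\<lambda>k. p < k) (S j)" for j
  \<comment> \<open>A class without large block corresponds to itself; a product structure
    corresponds to the class obtained by filling the hole of some representative. Independence of
    the representative is the uniqueness of \<open>C\<close>, proved below.\<close>
  define R :: "('z \<Rightarrow> nat set) \<Rightarrow> _ \<Rightarrow> ('z + 'n, 'z) assembly set \<Rightarrow> bool" where
    "R U z C = (case z of Inl c \<Rightarrow> c = C
      | Inr (j, V, c, y) \<Rightarrow> \<exists>x\<in>c. insert_point (Inr j) (\<lambda>s. U s - V s) y x \<in> C)" for U z C
  have spS: "is_species (?S t)" for t by (rule is_species_subst_family[OF S])
  have spT: "is_species (T t)" for t
    unfolding T_def by (rule is_species_subst_family) (simp add: srestr_eq_prestr is_species_prestr S)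
  have E: "admissible (E j)" for j
    unfolding E_def by (intro admissible_prestr is_species_admissible S)
  have F': "is_species (spderiv t F)" for t by (rule is_species_spderiv[OF F])
  note eqv = equiv_assembly_rel[OF F, of ?S]
  let ?L = "pplus (pcomp F T) (psum UNIV (\<lambda>j. pprod (pcomp (spderiv (Inr j) F) T) (E j)))"
  have InrD: "(\<forall>s. V s \<subseteq> U s) \<and> c \<in> str (pcomp (spderiv (Inr j) F) T) V \<and>
      y \<in> str (S j) (\<lambda>s. U s - V s) \<and> p < size_tuple (\<lambda>s. U s - V s)"
    if "Inr (j, V, c, y) \<in> str ?L U" for j V c y U
    using that by (auto simp: prespecies_op_simps E_def str_prestr split: if_splits)
  have clsD: "x \<in> assemblies (spderiv (Inr j) F) T V \<and> x \<in> assemblies (spderiv (Inr j) F) ?S V"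
    if "c \<in> str (pcomp (spderiv (Inr j) F) T) V" "x \<in> c" for c j V x
  proof -
    have "x \<in> assemblies (spderiv (Inr j) F) T V"
      using in_quotient_imp_subset[OF equiv_assembly_rel[OF F']] that unfolding str_pcomp by blast
    then show ?thesis using truncated_assemblies_subset unfolding T_def by blast
  qed
  have insert_mem: "insert_point (Inr j) (\<lambda>s. U s - V s) y x \<in> assemblies F ?S U"
    if "Inr (j, V, c, y) \<in> str ?L U" "x \<in> c" for j V c y U x
    using InrD[OF that(1)] clsD[OF _ that(2)] by (intro insert_point_mem) auto
  have rel_of_R: "\<exists>x\<in>c. \<exists>x'\<in>c'. (insert_point (Inr j) (\<lambda>s. U s - V s) y x,
      insert_point (Inr j') (\<lambda>s. U s - V' s) y' x') \<in> assembly_rel F ?S U"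
    if "R U (Inr (j, V, c, y)) C" "R U (Inr (j', V', c', y')) C" "C \<in> str (pcomp F ?S) U"
    for j V c y j' V' c' y' C U
    using that quotient_eq_iff[OF eqv] unfolding R_def str_pcomp sum.case prod.case by blast
  have "iso_on (\<lambda>k. k \<le> 2 * p + 1) ?L (pcomp F ?S)"
  proof (rule iso_on_relI[where R = R])
    show "admissible ?L"
      by (intro admissible_pplus admissible_psum admissible_pprod admissible_pcomp spT E)
    show "admissible (pcomp F ?S)" by (rule admissible_pcomp[OF spS])
  next
    fix U z assume U: "fin_tuple U" "size_tuple U \<le> 2 * p + 1" and z: "z \<in> str ?L U"
    show "\<exists>C\<in>str (pcomp F ?S) U. R U z C"
    proof (cases z)
      case (Inl c)
      then have "c \<in> str (pcomp F T) U" using z by (auto simp: prespecies_op_simps)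
      then have "c \<in> str (pcomp F ?S) U" using str_pcomp_truncated_subset unfolding T_def by blast
      then show ?thesis using Inl by (auto simp: R_def)
    next
      case (Inr w)
      obtain j V c y where w: "w = (j, V, c, y)" by (metis prod_cases4)
      have c: "c \<in> str (pcomp (spderiv (Inr j) F) T) V" using InrD z unfolding Inr w by blast
      then obtain x where x: "x \<in> c"
        using in_quotient_imp_non_empty[OF equiv_assembly_rel[OF F']] unfolding str_pcomp by blast
      let ?i = "insert_point (Inr j) (\<lambda>s. U s - V s) y x"
      have i: "?i \<in> assemblies F ?S U" using insert_mem[OF z[unfolded Inr w] x] .
      show ?thesis
        using x quotientI[OF i] equiv_class_self[OF eqv i]
        by (intro bexI[where x = "assembly_rel F ?S U `` {?i}"]) (auto simp: R_def Inr w str_pcomp)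
    qed
  next
    fix U C assume U: "fin_tuple U" "size_tuple U \<le> 2 * p + 1" and C: "C \<in> str (pcomp F ?S) U"
    then obtain x where x: "x \<in> assemblies F ?S U" "C = assembly_rel F ?S U `` {x}"
      by (auto simp: str_pcomp elim: quotientE)
    obtain A B f g where x': "x = (A, B, f, g)" by (metis prod_cases4)
    show "\<exists>z\<in>str ?L U. R U z C"
    proof (cases "\<forall>j. \<forall>a\<in>A (Inr j). size_tuple (B (Inr j) a) \<le> p")
      case True
      then have xT: "x \<in> assemblies F T U" using x unfolding x' T_def truncated_assemblies_iff by blast
      then have "C = assembly_rel F T U `` {x}" using truncated_class x(2) unfolding T_def by metis
      then have "C \<in> str (pcomp F T) U" using xT by (simp add: str_pcomp quotientI)
      then show ?thesis by (intro bexI[where x = "Inl C"]) (auto simp: R_def prespecies_op_simps)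
    next
      case False
      \<comment> \<open>A large block exists; its point becomes the hole, and \<open>V\<close> is
        the set of labels outside that block.\<close>
      then obtain j a where a: "a \<in> A (Inr j)" "p < size_tuple (B (Inr j) a)" by (auto simp: not_le)
      define V where "V = (\<lambda>s. U s - B (Inr j) a s)"
      have sub: "B (Inr j) a s \<subseteq> U s" for s using assembly_block_subset[OF x(1)[unfolded x']] .
      have W: "(\<lambda>s. U s - V s) = B (Inr j) a" using sub by (auto simp: V_def fun_eq_iff)
      have Vsub: "\<forall>s. V s \<subseteq> U s" by (auto simp: V_def)
      obtain y where y: "y \<in> assemblies (spderiv (Inr j) F) ?S V"
        "(insert_point (Inr j) (B (Inr j) a) (g (Inr j) a) y, (A, B, f, g)) \<in> assembly_rel F ?S U"
        using insert_point_surj[OF F x(1)[unfolded x'] a(1)] unfolding V_def by blast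
      \<comment> \<open>At most (2p + 1) - (p + 1) = p labels remain, so every other block is
        automatically small.\<close>
      have "size_tuple V \<le> p"
        using size_tuple_diff[OF U(1), of "B (Inr j) a"] sub a(2) U(2) unfolding V_def by simp
      moreover have "fin_tuple V" unfolding V_def by (rule fin_tuple_diff[OF U(1)])
      ultimately have yT: "y \<in> assemblies (spderiv (Inr j) F) T V"
        unfolding T_def using small_assemblies_truncated y(1) by blast
      let ?c = "assembly_rel (spderiv (Inr j) F) T V `` {y}"
      have "g (Inr j) a \<in> str (S j) (B (Inr j) a)"
        using assembly_inner[OF x(1)[unfolded x'] a(1)] by simp
      then have "Inr (j, V, ?c, g (Inr j) a) \<in> str ?L U"
        using a(2) yT Vsub by (auto simp: prespecies_op_simps E_def str_prestr W str_pcomp intro!: quotientI)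
      moreover have "(x, insert_point (Inr j) (B (Inr j) a) (g (Inr j) a) y) \<in> assembly_rel F ?S U"
        using y(2) eqv unfolding x' by (meson equivE symD)
      then have "R U (Inr (j, V, ?c, g (Inr j) a)) C"
        using equiv_class_self[OF equiv_assembly_rel[OF F'] yT] x(2) by (auto simp: R_def W)
      ultimately show ?thesis by blast
    qed
  next
    fix U z C C' assume U: "fin_tuple U" "size_tuple U \<le> 2 * p + 1" and z: "z \<in> str ?L U"
      and C: "C \<in> str (pcomp F ?S) U" and C': "C' \<in> str (pcomp F ?S) U"
      and R: "R U z C" and R': "R U z C'"
    show "C = C'"
    proof (cases z)
      case (Inl c)
      then show ?thesis using R R' by (simp add: R_def)
    next
      case (Inr w)
      obtain j V c y where w: "w = (j, V, c, y)" by (metis prod_cases4)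
      note D = InrD[OF z[unfolded Inr w]]
      obtain x x' where x: "x \<in> c" "insert_point (Inr j) (\<lambda>s. U s - V s) y x \<in> C"
        and x': "x' \<in> c" "insert_point (Inr j) (\<lambda>s. U s - V s) y x' \<in> C'"
        using R R' unfolding R_def Inr w sum.case prod.case by blast
      have "(x, x') \<in> assembly_rel (spderiv (Inr j) F) T V"
        using quotient_eq_iff[OF equiv_assembly_rel[OF F']] D x(1) x'(1) unfolding str_pcomp by blast
      then have "(x, x') \<in> assembly_rel (spderiv (Inr j) F) ?S V"
        using truncated_class clsD D x(1) unfolding T_def by blast
      then have "(insert_point (Inr j) (\<lambda>s. U s - V s) y x, insert_point (Inr j) (\<lambda>s. U s - V s) y x')
          \<in> assembly_rel F ?S U"
        using D by (intro insert_point_rel) auto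
      then show ?thesis using quotient_eq_iff[OF eqv] C C' x(2) x'(2) unfolding str_pcomp by blast
    qed
  next
    fix U z z' C assume U: "fin_tuple U" "size_tuple U \<le> 2 * p + 1" and z: "z \<in> str ?L U"
      and z': "z' \<in> str ?L U" and C: "C \<in> str (pcomp F ?S) U" and R: "R U z C" and R': "R U z' C"
    \<comment> \<open>The two summands do not overlap: a class over \<open>T\<close> has only small
      blocks of the sorts \<open>Y\<close>, whereas the filled hole carries more than p
      labels.\<close>
    have mixed: False
      if IC: "Inl C \<in> str ?L U" and D: "Inr (j, V, c, y) \<in> str ?L U" and RC: "R U (Inr (j, V, c, y)) C"
      for j V c y
    proof -
      obtain x where x: "x \<in> c" "insert_point (Inr j) (\<lambda>s. U s - V s) y x \<in> C"
        using RC unfolding R_def sum.case prod.case by blast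
      have "C \<in> str (pcomp F T) U" using IC by (auto simp: prespecies_op_simps)
      then have "insert_point (Inr j) (\<lambda>s. U s - V s) y x \<in> assemblies F T U"
        using in_quotient_imp_subset[OF equiv_assembly_rel[OF F]] x(2) unfolding str_pcomp by blast
      moreover obtain A B f g where x': "x = (A, B, f, g)" by (metis prod_cases4)
      ultimately have "size_tuple (\<lambda>s. U s - V s) \<le> p"
        unfolding x' insert_point_def prod.case T_def truncated_assemblies_iff
        by (auto simp: add_point_def dest!: spec[of _ j])
      then show False using InrD[OF D] by simp
    qed
    show "z = z'"
    proof (cases z)
      case (Inl c)
      then have c: "c = C" using R by (simp add: R_def)
      show ?thesis
      proof (cases z')
        case (Inl c')
        then show ?thesis using R' c \<open>z = Inl c\<close> by (simp add: R_def)
      next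
        case (Inr w')
        obtain j V d y where "w' = (j, V, d, y)" by (metis prod_cases4)
        then show ?thesis
          using mixed[of j V d y] z z' R' unfolding Inr \<open>z = Inl c\<close> c by blast
      qed
    next
      case (Inr w)
      show ?thesis
      proof (cases z')
        case (Inl c')
        then have "c' = C" using R' by (simp add: R_def)
        moreover obtain j V d y where "w = (j, V, d, y)" by (metis prod_cases4)
        ultimately show ?thesis
          using mixed[of j V d y] z z' R unfolding Inl Inr by blast
      next
        case Inr': (Inr w')
        obtain j V c y where w: "w = (j, V, c, y)" by (metis prod_cases4)
        obtain j' V' c' y' where w': "w' = (j', V', c', y')" by (metis prod_cases4)
        note D = InrD[OF z[unfolded Inr w]] and D' = InrD[OF z'[unfolded Inr' w']]
        obtain x x' where x: "x \<in> c" and x': "x' \<in> c'" and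
          rel: "(insert_point (Inr j) (\<lambda>s. U s - V s) y x, insert_point (Inr j') (\<lambda>s. U s - V' s) y' x')
            \<in> assembly_rel F ?S U"
          using rel_of_R[OF R[unfolded Inr w] R'[unfolded Inr' w'] C] by blast
        obtain A B f g where xx: "x = (A, B, f, g)" by (metis prod_cases4)
        obtain A' B' f' g' where xx': "x' = (A', B', f', g')" by (metis prod_cases4)
        have xT: "(A, B, f, g) \<in> assemblies (spderiv (Inr j) F) T V"
          "(A, B, f, g) \<in> assemblies (spderiv (Inr j) F) ?S V"
          using clsD D x unfolding xx by blast+
        have xT': "(A', B', f', g') \<in> assemblies (spderiv (Inr j') F) T V'"
          using clsD D' x' unfolding xx' by blast
        let ?B = "B(Inr j := case_nat (\<lambda>s. U s - V s) (B (Inr j)))"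
        let ?B' = "B'(Inr j' := case_nat (\<lambda>s. U s - V' s) (B' (Inr j')))"
        let ?g = "g(Inr j := case_nat y (g (Inr j)))"
        let ?g' = "g'(Inr j' := case_nat y' (g' (Inr j')))"
        obtain \<rho> where \<rho>: "bij_tuple \<rho> (add_point (Inr j) A) (add_point (Inr j') A')"
          "trn F (add_point (Inr j) A) \<rho> f = f'"
          "\<And>t a. a \<in> add_point (Inr j) A t \<Longrightarrow> ?B' t (\<rho> t a) = ?B t a"
          "\<And>t a. a \<in> add_point (Inr j) A t \<Longrightarrow> ?g' t (\<rho> t a) = ?g t a"
          using assembly_relE[OF rel[unfolded xx xx' insert_point_def prod.case]] by blast
        \<comment> \<open>The image of the hole of \<open>x\<close>. Its block has more than p
          labels, while the other points of \<open>x'\<close> of a sort \<open>Y\<close> have at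
          most p; so it is the hole of \<open>x'\<close>. Comparing sorts, blocks and structures
          gives \<open>j = j'\<close>, \<open>V = V'\<close> and \<open>y = y'\<close>.\<close>
        define a where "a = \<rho> (Inr j) 0"
        have zero: "0 \<in> add_point (Inr j) A (Inr j)" by (simp add: add_point_def)
        have a: "a \<in> add_point (Inr j') A' (Inr j)"
          unfolding a_def by (rule bij_tuple_mem[OF \<rho>(1) zero])
        have Ba: "?B' (Inr j) a = (\<lambda>s. U s - V s)" and ga: "?g' (Inr j) a = y"
          using \<rho>(3)[OF zero] \<rho>(4)[OF zero] by (simp_all add: a_def)
        have "\<not> (\<exists>b\<in>A' (Inr j). B' (Inr j) b = (\<lambda>s. U s - V s))"
          using xT' D unfolding T_def truncated_assemblies_iff by force
        then have j: "j = j'" and a0: "a = 0"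
          using a Ba by (auto simp: add_point_def split: if_splits)
        have W: "(\<lambda>s. U s - V s) = (\<lambda>s. U s - V' s)" and y: "y = y'"
          using Ba ga j a0 by auto
        have V: "V = V'"
        proof
          fix s
          have "U s - V s = U s - V' s" using W by meson
          then show "V s = V' s" using D D' by blast
        qed
        have f: "f \<in> str F (add_point (Inr j) A)"
          using assembly_outer[OF xT(1)] by (simp add: str_spderiv)
        have "((A, B, f, g), (A', B', f', g')) \<in> assembly_rel (spderiv (Inr j) F) T V"
        proof (rule insert_point_rel_cancel[OF F xT(1), where \<rho> = \<rho> and W = "\<lambda>s. U s - V s" and y = y])
          show "(A', B', f', g') \<in> assemblies (spderiv (Inr j) F) T V" using xT' V j by simp
          show "\<rho> (Inr j) 0 = 0" using a0 a_def by simp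
        qed (use \<rho> V j y f in simp_all)
        then have "(x, x') \<in> assembly_rel (spderiv (Inr j) F) T V" unfolding xx xx' .
        moreover have "c' \<in> str (pcomp (spderiv (Inr j) F) T) V" using D' j V by simp
        ultimately have "c = c'"
          using quotient_eq_iff[OF equiv_assembly_rel[OF F', of "Inr j" T V] _ _ x x'] D
          unfolding str_pcomp by blast
        then show ?thesis using Inr Inr' w w' j V y by simp
      qed
    qed
  next
    fix U V \<sigma> z C assume U: "fin_tuple U" "size_tuple U \<le> 2 * p + 1" and \<sigma>: "bij_tuple \<sigma> U V"
      and z: "z \<in> str ?L U" and C: "C \<in> str (pcomp F ?S) U" and R: "R U z C"
    show "R V (trn ?L U \<sigma> z) (trn (pcomp F ?S) U \<sigma> C)"
    proof (cases z)
      case (Inl c)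
      then show ?thesis
        using R by (simp add: R_def trn_pplus trn_pcomp T_def relabel_truncated)
    next
      case (Inr w)
      obtain j V0 c y where w: "w = (j, V0, c, y)" by (metis prod_cases4)
      note D = InrD[OF z[unfolded Inr w]]
      obtain x where x: "x \<in> c" "insert_point (Inr j) (\<lambda>s. U s - V0 s) y x \<in> C"
        using R unfolding R_def Inr w sum.case prod.case by blast
      \<comment> \<open>The complement of \<open>V0\<close> must be transported to the complement of
        its image, so that relabelling the filled assembly fills the relabelled one.\<close>
      have im: "image_tuple \<sigma> (\<lambda>s. U s - V0 s) = (\<lambda>s. V s - image_tuple \<sigma> V0 s)"
        using image_tuple_diff[OF \<sigma>, of V0 U] D image_tuple_bij[OF \<sigma>] by simp
      have "relabel ?S \<sigma> (insert_point (Inr j) (\<lambda>s. U s - V0 s) y x) =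
          insert_point (Inr j) (\<lambda>s. V s - image_tuple \<sigma> V0 s) (trn (S j) (\<lambda>s. U s - V0 s) \<sigma> y) (relabel T \<sigma> x)"
        by (simp add: relabel_insert_point im T_def relabel_truncated)
      moreover have "relabel ?S \<sigma> (insert_point (Inr j) (\<lambda>s. U s - V0 s) y x) \<in> relabel ?S \<sigma> ` C"
        using x(2) by blast
      ultimately have "insert_point (Inr j) (\<lambda>s. V s - image_tuple \<sigma> V0 s)
          (trn (S j) (\<lambda>s. U s - V0 s) \<sigma> y) (relabel T \<sigma> x) \<in> relabel ?S \<sigma> ` C"
        by simp
      then show ?thesis
        using x(1) by (auto simp: R_def Inr w prespecies_op_simps trn_pcomp E_def)
    qed
  qed
  then show ?thesis unfolding E_def by (rule iso_on_sym)
qed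


section \<open>Linear systems of species\<close>

lemma pprod_cong_right_all:
  "admissible F \<Longrightarrow> iso_all G G' \<Longrightarrow> iso_on P (pprod F G) (pprod F G')"
  by (rule pprod_cong_right) auto

lemma pplus_empty_right:
  assumes "admissible F" "admissible G" "\<And>U. fin_tuple U \<Longrightarrow> P (size_tuple U) \<Longrightarrow> str G U = {}"
  shows "iso_on P (pplus F G) F"
proof (rule iso_on_sym, rule iso_onI[where \<phi> = "\<lambda>U. Inl"])
  fix U :: "'a \<Rightarrow> nat set" assume "fin_tuple U" "P (size_tuple U)"
  then show "bij_betw Inl (str F U) (str (pplus F G) U)"
    using assms(3) by (auto simp: str_pplus bij_betw_def)
qed (auto simp: assms admissible_pplus trn_pplus)

lemma pplus_empty_left:
  assumes "admissible F" "admissible G" "\<And>U. fin_tuple U \<Longrightarrow> P (size_tuple U) \<Longrightarrow> str F U = {}"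
  shows "iso_on P (pplus F G) G"
proof (rule iso_on_sym, rule iso_onI[where \<phi> = "\<lambda>U. Inr"])
  fix U :: "'a \<Rightarrow> nat set" assume "fin_tuple U" "P (size_tuple U)"
  then show "bij_betw Inr (str G U) (str (pplus F G) U)"
    using assms(3) by (auto simp: str_pplus bij_betw_def)
qed (auto simp: assms admissible_pplus trn_pplus)

lemma iso_split_size:
  assumes F: "admissible F"
  shows "iso_all F (pplus (prestr (\<lambda>k. k \<le> p) F) (prestr (\<lambda>k. p < k) F))"
proof (rule iso_on_sizes)
  let ?A = "prestr (\<lambda>k. k \<le> p) F" and ?B = "prestr (\<lambda>k. p < k) F"
  show "admissible (pplus ?A ?B)" by (intro admissible_pplus admissible_prestr F)
  fix k
  show "iso_on (\<lambda>l. l = k) F (pplus ?A ?B)"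
  proof (cases "k \<le> p")
    case True
    have "iso_on (\<lambda>l. l = k) (pplus ?A ?B) ?A"
      using True by (intro pplus_empty_right admissible_prestr F) (auto simp: str_prestr)
    also have "iso_on (\<lambda>l. l = k) ?A F" using True by (intro iso_on_prestr F) auto
    finally show ?thesis by (rule iso_on_sym)
  next
    case False
    have "iso_on (\<lambda>l. l = k) (pplus ?A ?B) ?B"
      using False by (intro pplus_empty_left admissible_prestr F) (auto simp: str_prestr)
    also have "iso_on (\<lambda>l. l = k) ?B F" using False by (intro iso_on_prestr F) auto
    finally show ?thesis by (rule iso_on_sym)
  qed
qed (rule F)

lemma admissible_mat_pow:
  fixes M :: "'n::finite \<Rightarrow> 'n \<Rightarrow> 's::finite species"
  assumes "\<And>i j. admissible (M i j)"
  shows "admissible (mat_pow M k i j)"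
  by (induction k arbitrary: i j)
    (auto simp: admissible_mat_one mat_mult_def intro!: admissible_ssum admissible_stimes assms)

text \<open>The term k = 0 is split off and one factor \<open>M\<close> is pulled out of all the
  others. No convergence is involved, because countably infinite sums of structures are
  admissible.\<close>

lemma mat_geom_fixpoint:
  fixes M :: "'n::finite \<Rightarrow> 'n \<Rightarrow> 's::finite species"
  assumes M: "\<And>i j. admissible (M i j)" and D: "\<And>j. admissible (D j)"
  defines "G \<equiv> mat_vec (mat_geom M) D"
  shows "iso_all (G i) (pplus (D i) (psum UNIV (\<lambda>l. pprod (M i l) (G l))))"
proof -
  \<comment> \<open>Coordinate \<open>i\<close> of the vector obtained by applying the k-th power of
    \<open>M\<close> to \<open>D\<close>.\<close>
  define Q where "Q k i = psum UNIV (\<lambda>j. pprod (mat_pow M k i j) (D j))" for k i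
  note P = admissible_mat_pow[of M, OF M]
  have geom: "admissible (mat_geom M i j)" for i j
    unfolding mat_geom_def by (intro admissible_ssum P)
  have Q: "admissible (Q k i)" for k i
    unfolding Q_def by (intro admissible_psum admissible_pprod P D)
  have GQ: "iso_all (G i) (psum UNIV (\<lambda>k. Q k i))" for i
  proof -
    have "iso_all (G i) (psum UNIV (\<lambda>j. stimes (mat_geom M i j) (D j)))"
      unfolding G_def mat_vec_def by (intro ssum_iso admissible_stimes geom D)
    also have "iso_all \<dots> (psum UNIV (\<lambda>j. pprod (mat_geom M i j) (D j)))"
      by (intro psum_cong stimes_iso geom D)
    also have "iso_all \<dots> (psum UNIV (\<lambda>j. pprod (psum UNIV (\<lambda>k. mat_pow M k i j)) (D j)))"
      unfolding mat_geom_def by (intro psum_cong pprod_cong_left ssum_iso P D)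
    also have "iso_all \<dots> (psum UNIV (\<lambda>j. psum UNIV (\<lambda>k. pprod (mat_pow M k i j) (D j))))"
      by (intro psum_cong pprod_psum_left P D)
    also have "iso_all \<dots> (psum UNIV (\<lambda>k. Q k i))"
      unfolding Q_def by (intro psum_swap admissible_pprod P D)
    finally show ?thesis .
  qed
  have Q_Suc: "iso_all (Q (Suc k) i) (psum UNIV (\<lambda>l. pprod (M i l) (Q k l)))" for k i
  proof -
    have "iso_all (Q (Suc k) i)
        (psum UNIV (\<lambda>j. pprod (psum UNIV (\<lambda>l. stimes (M i l) (mat_pow M k l j))) (D j)))"
      unfolding Q_def mat_pow.simps mat_mult_def
      by (intro psum_cong pprod_cong_left ssum_iso admissible_stimes M P D)
    also have "iso_all \<dots> (psum UNIV (\<lambda>j. pprod (psum UNIV (\<lambda>l. pprod (M i l) (mat_pow M k l j))) (D j)))"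
      by (intro psum_cong pprod_cong_left stimes_iso M P D)
    also have "iso_all \<dots> (psum UNIV (\<lambda>j. psum UNIV (\<lambda>l. pprod (pprod (M i l) (mat_pow M k l j)) (D j))))"
      by (intro psum_cong pprod_psum_left admissible_pprod M P D)
    also have "iso_all \<dots> (psum UNIV (\<lambda>j. psum UNIV (\<lambda>l. pprod (M i l) (pprod (mat_pow M k l j) (D j)))))"
      by (intro psum_cong pprod_assoc M P D)
    also have "iso_all \<dots> (psum UNIV (\<lambda>l. psum UNIV (\<lambda>j. pprod (M i l) (pprod (mat_pow M k l j) (D j)))))"
      by (intro psum_swap admissible_pprod M P D)
    also have "iso_all \<dots> (psum UNIV (\<lambda>l. pprod (M i l) (Q k l)))"
      unfolding Q_def by (intro psum_cong iso_on_sym[OF pprod_psum_right] admissible_pprod M P D)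
    finally show ?thesis .
  qed
  have "iso_all (G i) (psum UNIV (\<lambda>k. Q k i))" by (rule GQ)
  also have "iso_all \<dots> (pplus (Q 0 i) (psum UNIV (\<lambda>k. Q (Suc k) i)))"
    by (intro psum_nat_unfold Q)
  also have "iso_all \<dots> (pplus (D i) (psum UNIV (\<lambda>k. psum UNIV (\<lambda>l. pprod (M i l) (Q k l)))))"
  proof (intro pplus_cong psum_cong Q_Suc)
    show "iso_all (Q 0 i) (D i)" unfolding Q_def mat_pow.simps by (rule psum_mat_one[OF D])
  qed
  also have "iso_all \<dots> (pplus (D i) (psum UNIV (\<lambda>l. psum UNIV (\<lambda>k. pprod (M i l) (Q k l)))))"
    by (intro pplus_cong iso_on_refl D psum_swap admissible_pprod M Q)
  also have "iso_all \<dots> (pplus (D i) (psum UNIV (\<lambda>l. pprod (M i l) (psum UNIV (\<lambda>k. Q k l)))))"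
    by (intro pplus_cong iso_on_refl D psum_cong iso_on_sym[OF pprod_psum_right] M Q)
  also have "iso_all \<dots> (pplus (D i) (psum UNIV (\<lambda>l. pprod (M i l) (G l))))"
    by (intro pplus_cong iso_on_refl D psum_cong pprod_cong_right_all M iso_on_sym[OF GQ])
  finally show ?thesis .
qed

text \<open>
  The structures of size \<open>k\<close> of \<open>M i l \<cdot> E l\<close> only involve those of \<open>E l\<close> of smaller size, or of
  size \<open>k\<close> if \<open>M i l\<close> has a structure on the empty set.
\<close>

lemma linear_system_unique:
  fixes M :: "'n::finite \<Rightarrow> 'n \<Rightarrow> ('s::finite, 'm) prespecies"
    and E :: "'n \<Rightarrow> ('s, 'a) prespecies" and G :: "'n \<Rightarrow> ('s, 'b) prespecies"
  assumes M: "\<And>i j. admissible (M i j)" and D: "\<And>i. admissible (D i)"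
    and E: "\<And>i. iso_on (\<lambda>k. k \<le> q) (E i) (pplus (D i) (psum UNIV (\<lambda>l. pprod (M i l) (E l))))"
    and G: "\<And>i. iso_on (\<lambda>k. k \<le> q) (G i) (pplus (D i) (psum UNIV (\<lambda>l. pprod (M i l) (G l))))"
    and r: "acyclic r" "\<And>i l. str (M i l) (\<lambda>s. {}) \<noteq> {} \<Longrightarrow> (i, l) \<in> r"
  shows "iso_on (\<lambda>k. k \<le> q) (E i) (G i)"
proof -
  have adm: "admissible (E i)" "admissible (G i)" for i
    using E G iso_on_admissible1 by blast+
  have "iso_on (\<lambda>l. l = k) (E i) (G i)" if "k \<le> q" for k i
    using that
  proof (induction k arbitrary: i rule: less_induct)
    case (less k)
    \<comment> \<open>The indices form a finite type, so the acyclic \<open>r\<close> has a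
      well-founded converse. Within a fixed size, a second induction runs along it, since coordinate
      \<open>i\<close> depends on its successors under \<open>r\<close>.\<close>
    have "wf (r\<inverse>)" using r(1) by (intro finite_acyclic_wf_converse finite)
    then show ?case
    proof (induction i rule: wf_induct_rule)
      case (less i)
      note inner = less and outer = \<open>\<And>y i. y < k \<Longrightarrow> y \<le> q \<Longrightarrow> iso_on (\<lambda>l. l = y) (E i) (G i)\<close>
      have "iso_on (\<lambda>m. m = k) (pprod (M i l) (E l)) (pprod (M i l) (G l))" for l
      proof (rule pprod_cong_right[OF M])
        let ?Q = "\<lambda>m. m < k \<or> m = k \<and> (i, l) \<in> r"
        show "iso_on ?Q (E l) (G l)"
        proof (rule iso_on_sizes[OF adm])
          fix m assume "?Q m"
          then show "iso_on (\<lambda>l. l = m) (E l) (G l)"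
            using outer[of m l] inner[of l] \<open>k \<le> q\<close> by auto
        qed
        fix U A assume U: "fin_tuple U" "size_tuple U = k" and A: "\<And>s. A s \<subseteq> U s" and ne: "str (M i l) A \<noteq> {}"
        show "?Q (size_tuple (\<lambda>s. U s - A s))"
        proof (cases "size_tuple A = 0")
          case True
          then have "A = (\<lambda>s. {})" using size_tuple_eq_0 fin_tuple_subset[OF U(1) A] by blast
          then show ?thesis using r(2) ne U(2) by simp
        next
          case False
          then show ?thesis using size_tuple_diff[OF U(1) A] U(2) by simp
        qed
      qed
      then have *: "iso_on (\<lambda>m. m = k) (pplus (D i) (psum UNIV (\<lambda>l. pprod (M i l) (E l))))
          (pplus (D i) (psum UNIV (\<lambda>l. pprod (M i l) (G l))))"
        by (intro pplus_cong psum_cong iso_on_refl D)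
      have E': "iso_on (\<lambda>m. m = k) (E i) (pplus (D i) (psum UNIV (\<lambda>l. pprod (M i l) (E l))))"
        using \<open>k \<le> q\<close> by (intro iso_on_mono[OF E]) auto
      have G': "iso_on (\<lambda>m. m = k) (G i) (pplus (D i) (psum UNIV (\<lambda>l. pprod (M i l) (G l))))"
        using \<open>k \<le> q\<close> by (intro iso_on_mono[OF G]) auto
      show ?case by (rule iso_on_trans[OF iso_on_trans[OF E' *] iso_on_sym[OF G']])
    qed
  qed
  then show ?thesis by (rule iso_on_sizes[OF adm])
qed


section \<open>The dependency relation at size zero is acyclic\<close>

text \<open>A renaming may move the hole, so the two fillings are compared by counting: it preserves
  the number of points of sort \<open>t\<close> with block \<open>U\<close> and structure
  \<open>y\<close>, and this number would be one larger for the first filling if \<open>y\<close>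
  and \<open>y'\<close> differed.\<close>

lemma insert_point_inj:
  assumes x: "x \<in> assemblies (spderiv t F) G (\<lambda>s. {})"
    and rel: "(insert_point t U y x, insert_point t U y' x) \<in> assembly_rel F G U"
  shows "y = y'"
proof (rule ccontr)
  assume ne: "y \<noteq> y'"
  obtain A B f g where x': "x = (A, B, f, g)" by (metis prod_cases4)
  let ?B = "B(t := case_nat U (B t))"
  let ?g = "g(t := case_nat y (g t))" and ?g' = "g(t := case_nat y' (g t))"
  obtain \<rho> where \<rho>: "bij_tuple \<rho> (add_point t A) (add_point t A)"
    "\<And>t' a. a \<in> add_point t A t' \<Longrightarrow> ?B t' (\<rho> t' a) = ?B t' a"
    "\<And>t' a. a \<in> add_point t A t' \<Longrightarrow> ?g' t' (\<rho> t' a) = ?g t' a"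
    by (rule assembly_relE[OF rel[unfolded x' insert_point_def prod.case]]) (rule that; assumption)
  let ?N = "\<lambda>h. {a \<in> add_point t A t. ?B t a = U \<and> h t a = y}"
  \<comment> \<open>The points of this kind already present in \<open>x\<close>, counted on both
    sides. They can exist when \<open>U\<close> is empty.\<close>
  let ?M = "Suc ` {b \<in> A t. B t b = U \<and> g t b = y}"
  have img: "\<rho> t ` ?N ?g = ?N ?g'"
  proof (intro subset_antisym subsetI)
    fix a assume "a \<in> \<rho> t ` ?N ?g"
    then obtain b where b: "b \<in> add_point t A t" "?B t b = U" "?g t b = y" "a = \<rho> t b" by blast
    then show "a \<in> ?N ?g'" using \<rho>(2,3)[OF b(1)] bij_tuple_mem[OF \<rho>(1) b(1)] by simp
  next
    fix a assume "a \<in> ?N ?g'"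
    then have a: "a \<in> add_point t A t" "?B t a = U" "?g' t a = y" by auto
    have "a \<in> \<rho> t ` add_point t A t" using \<rho>(1) a(1) by (simp add: bij_tuple_def bij_betw_def)
    then obtain b where b: "b \<in> add_point t A t" "a = \<rho> t b" by blast
    then show "a \<in> \<rho> t ` ?N ?g" using \<rho>(2,3)[OF b(1)] a by auto
  qed
  have inj: "inj_on (\<rho> t) (?N ?g)"
    using \<rho>(1) by (auto simp: bij_tuple_def bij_betw_def intro: inj_on_subset)
  have "card (?N ?g) = card (?N ?g')"
    using card_image[OF inj] unfolding img by (rule sym)
  moreover have "?N ?g = insert 0 ?M"
    by (auto simp: add_point_def)
  moreover have "?N ?g' = ?M"
    using ne by (auto simp: add_point_def)
  moreover have "finite ?M" using assembly_fin[OF x[unfolded x']] by (simp add: fin_tuple_def)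
  ultimately show False by (simp add: card_insert_if)
qed

text \<open>The assembly \<open>x\<close> uses no label, so filling its hole embeds the
  \<open>G t\<close>-structures on \<open>U\<close> into the composition. If the finite
  cardinalities agree, the embedding is onto; every assembly on \<open>U\<close> is then a filling
  up to renaming, and one of its blocks is all of \<open>U\<close>.\<close>

lemma insert_point_card:
  fixes F :: "'t::finite species" and G :: "'t \<Rightarrow> 's::finite species"
  assumes F: "is_species F" and x: "x \<in> assemblies (spderiv t F) G (\<lambda>s. {})"
    and fin: "finite (str (pcomp F G) U)"
  shows "card (str (G t) U) \<le> card (str (pcomp F G) U)"
    and "card (str (G t) U) = card (str (pcomp F G) U) \<Longrightarrow> (A, B, f, g) \<in> assemblies F G U \<Longrightarrow>
      \<exists>a\<in>A t. B t a = U"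
proof -
  note eqv = equiv_assembly_rel[OF F, of G U]
  define h where "h y = assembly_rel F G U `` {insert_point t U y x}" for y
  have mem: "insert_point t U y x \<in> assemblies F G U" if "y \<in> str (G t) U" for y
    using insert_point_mem[OF x, of U y] that by simp
  have inj: "inj_on h (str (G t) U)"
  proof (rule inj_onI)
    fix y y' assume "y \<in> str (G t) U" "y' \<in> str (G t) U" "h y = h y'"
    then have "(insert_point t U y x, insert_point t U y' x) \<in> assembly_rel F G U"
      using eq_equiv_class_iff[OF eqv] mem unfolding h_def by blast
    then show "y = y'" by (rule insert_point_inj[OF x])
  qed
  have sub: "h ` str (G t) U \<subseteq> str (pcomp F G) U"
    using mem by (auto simp: h_def str_pcomp intro: quotientI)
  show "card (str (G t) U) \<le> card (str (pcomp F G) U)"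
    by (rule card_inj_on_le[OF inj sub fin])
  assume card: "card (str (G t) U) = card (str (pcomp F G) U)" and z: "(A, B, f, g) \<in> assemblies F G U"
  have "h ` str (G t) U = str (pcomp F G) U"
    using card card_image[OF inj] by (intro card_subset_eq[OF fin sub]) simp
  then have "assembly_rel F G U `` {(A, B, f, g)} \<in> h ` str (G t) U"
    using z by (simp add: str_pcomp quotientI)
  then obtain y where y: "y \<in> str (G t) U" "assembly_rel F G U `` {(A, B, f, g)} = h y" by blast
  then have rel: "(insert_point t U y x, (A, B, f, g)) \<in> assembly_rel F G U"
    using eq_equiv_class_iff[OF eqv mem[OF y(1)] z] unfolding h_def by simp
  obtain A' B' f' g' where x': "x = (A', B', f', g')" by (metis prod_cases4)
  obtain \<rho> where \<rho>: "bij_tuple \<rho> (add_point t A') A"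
    "\<And>t' a. a \<in> add_point t A' t' \<Longrightarrow> B t' (\<rho> t' a) = (B'(t := case_nat U (B' t))) t' a"
    by (rule assembly_relE[OF rel[unfolded x' insert_point_def prod.case]]) (rule that; assumption)
  have zero: "0 \<in> add_point t A' t" by (simp add: add_point_def)
  show "\<exists>a\<in>A t. B t a = U"
    using bij_tuple_mem[OF \<rho>(1) zero] \<rho>(2)[OF zero] by auto
qed

text \<open>Points, blocks and outer structure are kept, so whatever is learnt about the blocks of
  the new assembly holds for the old one. This carries an assembly over an iterate to one over
  \<open>S\<close> and back.\<close>

lemma assembly_change_inner:
  assumes x: "(A, B, f, g) \<in> assemblies F G U"
    and G': "\<And>t a. a \<in> A t \<Longrightarrow> str (G' t) (B t a) \<noteq> {}"
  shows "\<exists>g'. (A, B, f, g') \<in> assemblies F G' U"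
proof -
  define g' where "g' t a = (if a \<in> A t then SOME y. y \<in> str (G' t) (B t a) else 0)" for t a
  have "g' t a \<in> str (G' t) (B t a)" if "a \<in> A t" for t a
    using G'[OF that] that unfolding g'_def by (simp add: some_in_eq)
  moreover have "g' t a = 0" if "a \<notin> A t" for t a using that by (simp add: g'_def)
  ultimately have "(A, B, f, g') \<in> assemblies F G' U"
    using x unfolding assemblies_iff by simp
  then show ?thesis by (intro exI[of _ g'])
qed

text \<open>The nonzero entries at size 0 of the Jacobian matrix. It is taken at \<open>S\<close>
  and not at an iterate, so that one relation covers all the truncations of
  \<open>S\<close>.\<close>

definition dependency :: "('n \<Rightarrow> ('z + 'n) species) \<Rightarrow> ('n \<Rightarrow> 'z species) \<Rightarrow> ('n \<times> 'n) set" where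
  "dependency H S = {(i, j). assemblies (spderiv (Inr j) (H i)) (subst_family S) (\<lambda>s. {}) \<noteq> {}}"

lemma str_iter_Z_Suc:
  assumes "str (iter_Z H (Suc n) i) U \<noteq> {}"
  obtains A B f g where "(A, B, f, g) \<in> assemblies (H i) (subst_family (iter_Z H n)) U"
proof -
  have "assemblies (H i) (subst_family (iter_Z H n)) U \<noteq> {}"
    using assms by (auto simp: subst_ZY_def scomp_def encode_def quotient_def)
  then show thesis using that by (metis ex_in_conv prod_cases4)
qed

text \<open>Every fixed point dominates the iterates in support: an assembly over an iterate becomes
  one over \<open>S\<close> by choosing new structures on the same blocks. No natural embedding of
  the iterates into \<open>S\<close> is required.\<close>

lemma iter_Z_nonempty_imp:
  fixes S :: "'n::finite \<Rightarrow> 'z::finite species"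
  assumes S: "\<And>i. iso_all (S i) (pcomp (H i) (subst_family S))"
    and "fin_tuple U" "str (iter_Z H n i) U \<noteq> {}"
  shows "str (S i) U \<noteq> {}"
  using assms(2,3)
proof (induction n arbitrary: i U)
  case 0
  then show ?case by (simp add: szero_def)
next
  case (Suc n)
  obtain A B f g where x: "(A, B, f, g) \<in> assemblies (H i) (subst_family (iter_Z H n)) U"
    using str_iter_Z_Suc[OF Suc.prems(2)] by blast
  have "str (subst_family S t) (B t a) \<noteq> {}" if a: "a \<in> A t" for t a
  proof (cases t)
    case (Inl z)
    then show ?thesis using assembly_inner[OF x a] by auto
  next
    case (Inr j)
    have "fin_tuple (B t a)"
      by (rule fin_tuple_subset[OF Suc.prems(1)]) (rule assembly_block_subset[OF x])
    then show ?thesis using Suc.IH assembly_inner[OF x a] Inr by fastforce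
  qed
  then obtain g' where "(A, B, f, g') \<in> assemblies (H i) (subst_family S) U"
    using assembly_change_inner[OF x] by blast
  then have "str (pcomp (H i) (subst_family S)) U \<noteq> {}"
    by (auto simp: str_pcomp quotient_def)
  then show ?case using iso_on_nonempty[OF S Suc.prems(1)] by blast
qed

text \<open>
  Along a dependency \<open>(i, j)\<close>, filling the hole of a structure of size zero of
  \<open>\<partial>H\<^sub>i/\<partial>Y\<^sub>j\<close> embeds \<open>S j\<close> into \<open>S i\<close>. On a cycle these embeddings are bijections of finite sets,
  so that no structure can be the first one to appear in the iteration.
\<close>

lemma acyclic_dependency:
  fixes H :: "'n::finite \<Rightarrow> ('z::finite + 'n) species"
  assumes H: "\<And>i. is_species (H i)" and S: "\<And>i. is_species (S i)"
    and iso: "\<And>i. iso_all (S i) (pcomp (H i) (subst_family S))"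
    and wf: "well_founded H"
  shows "acyclic (dependency H S)"
proof (rule ccontr)
  let ?D = "dependency H S"
  assume "\<not> acyclic ?D"
  then obtain i where i: "(i, i) \<in> ?D\<^sup>+" by (auto simp: acyclic_def)
  \<comment> \<open>The strongly connected component of \<open>i\<close>. As \<open>i\<close> lies
    on a cycle, every member of \<open>C\<close> has a successor inside \<open>C\<close>.\<close>
  define C where "C = {k. (i, k) \<in> ?D\<^sup>* \<and> (k, i) \<in> ?D\<^sup>*}"
  have C_succ: "\<exists>j\<in>C. (k, j) \<in> ?D" if "k \<in> C" for k
  proof -
    have "(k, i) \<in> ?D\<^sup>+" using that i unfolding C_def by (auto intro: rtrancl_trancl_trancl)
    then obtain j where j: "(k, j) \<in> ?D" "(j, i) \<in> ?D\<^sup>*" by (meson tranclD)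
    then have "j \<in> C" using that unfolding C_def by (auto intro: rtrancl_into_rtrancl)
    then show ?thesis using j by blast
  qed
  obtain L where L: "converges_to (iter_Z H) L" "\<not> L i \<cong> (szero :: 'z species)"
    using wf unfolding well_founded_def by blast
  \<comment> \<open>No coordinate of the limit is empty. By contact at the size of \<open>U\<close>,
    some iterate has a structure on this label set, so there is a first index at which a coordinate
    in \<open>C\<close> has one.\<close>
  obtain U where U: "fin_tuple U" "str (L i) U \<noteq> {}"
  proof (rule ccontr)
    assume "\<not> thesis"
    then have "\<And>U. fin_tuple U \<Longrightarrow> str (L i) U = {}" using that by blast
    then have "L i \<cong> (szero :: 'z species)" unfolding iso_def by (auto simp: szero_def bij_betw_def)
    then show False using L(2) by blast
  qed
  obtain N where "contact (size_tuple U) (iter_Z H N i) (L i)"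
    using L(1) unfolding converges_to_def by blast
  then obtain \<phi> where "bij_betw \<phi> (str (srestr (size_tuple U) (iter_Z H N i)) U)
      (str (srestr (size_tuple U) (L i)) U)"
    using U(1) unfolding contact_def iso_def by blast
  then have "str (iter_Z H N i) U \<noteq> {}" using U(2) by (auto simp: srestr_def bij_betw_def)
  then have "\<exists>n. \<exists>k\<in>C. str (iter_Z H n k) U \<noteq> {}" unfolding C_def by blast
  then obtain n where n: "\<exists>k\<in>C. str (iter_Z H n k) U \<noteq> {}"
    and least: "\<And>m. m < n \<Longrightarrow> \<not> (\<exists>k\<in>C. str (iter_Z H m k) U \<noteq> {})"
    using exists_least_iff[of "\<lambda>n. \<exists>k\<in>C. str (iter_Z H n k) U \<noteq> {}"] by blast
  have fin: "finite (str (pcomp (H k) (subst_family S)) U)" for k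
    using iso_on_finite[OF iso U(1)] species_finite[OF S U(1)] by blast
  have card_S: "card (str (S k) U) = card (str (pcomp (H k) (subst_family S)) U)" for k
    using iso_on_card[OF iso U(1)] by blast
  have le1: "card (str (S j) U) \<le> card (str (S k) U)" if kj: "(k, j) \<in> ?D" for k j
  proof -
    obtain x where "x \<in> assemblies (spderiv (Inr j) (H k)) (subst_family S) (\<lambda>s. {})"
      using kj by (auto simp: dependency_def)
    from insert_point_card(1)[OF H this fin] show ?thesis by (simp add: card_S[of k])
  qed
  have le: "card (str (S j) U) \<le> card (str (S k) U)" if "(k, j) \<in> ?D\<^sup>*" for k j
    using that by (induction rule: rtrancl_induct) (auto dest: le1 intro: le_trans)
  \<comment> \<open>Cardinalities weakly decrease along dependencies, hence are constant on the
    component.\<close>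
  have eq: "card (str (S k) U) = card (str (S i) U)" if "k \<in> C" for k
    using that le[of k i] le[of i k] by (auto simp: C_def)
  obtain k where k: "k \<in> C" "str (iter_Z H n k) U \<noteq> {}" using n by blast
  then obtain n' where n': "n = Suc n'" by (cases n) (auto simp: szero_def)
  obtain A B f g where x: "(A, B, f, g) \<in> assemblies (H k) (subst_family (iter_Z H n')) U"
    using str_iter_Z_Suc k(2) unfolding n' by metis
  have "str (subst_family S t) (B t a) \<noteq> {}" if a: "a \<in> A t" for t a
  proof (cases t)
    case (Inl z)
    then show ?thesis using assembly_inner[OF x a] by auto
  next
    case (Inr j)
    have fin: "fin_tuple (B t a)"
      by (rule fin_tuple_subset[OF U(1)]) (rule assembly_block_subset[OF x])
    have "str (iter_Z H n' j) (B t a) \<noteq> {}" using assembly_inner[OF x a] Inr by auto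
    then show ?thesis using iter_Z_nonempty_imp[of S H, OF iso fin] Inr by simp
  qed
  then obtain g' where x': "(A, B, f, g') \<in> assemblies (H k) (subst_family S) U"
    using assembly_change_inner[OF x] by blast
  obtain j where j: "j \<in> C" "(k, j) \<in> ?D" using C_succ[OF k(1)] by blast
  obtain w where w: "w \<in> assemblies (spderiv (Inr j) (H k)) (subst_family S) (\<lambda>s. {})"
    using j(2) by (auto simp: dependency_def)
  \<comment> \<open>Equal cardinalities turn the embedding along (k, j) into a bijection, so
    \<open>x'\<close> must have a block of sort \<open>Inr j\<close> equal to
    \<open>U\<close>.\<close>
  have "card (str (subst_family S (Inr j)) U) = card (str (pcomp (H k) (subst_family S)) U)"
    using eq[OF j(1)] eq[OF k(1)] card_S[of k] by simp
  then obtain a where "a \<in> A (Inr j)" "B (Inr j) a = U"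
    using insert_point_card(2)[OF H w fin _ x'] by blast
  \<comment> \<open>The assembly \<open>x\<close> has the same blocks, so this block carries a
    structure of the previous iterate, on the same \<open>U\<close> and at a coordinate of
    \<open>C\<close>.\<close>
  then have "str (iter_Z H n' j) U \<noteq> {}" using assembly_inner[OF x] by fastforce
  then show False using least[of n'] j(1) n' by blast
qed


section \<open>Newton iteration\<close>

lemma subst_ZY_iso_pcomp:
  fixes F :: "('z::finite + 'n::finite) species"
  assumes "\<And>j. is_species (Y j)"
  shows "iso_all (subst_ZY F Y) (pcomp F (subst_family Y))"
  unfolding subst_ZY_def scomp_eq_encode
  by (intro iso_on_sym[OF iso_encode] admissible_pcomp is_species_subst_family assms)

text \<open>Finiteness of a composition is not automatic when blocks may be empty. Here it is
  inherited from the composition with \<open>S\<close>, which contains all the truncated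
  classes.\<close>

lemma is_species_pcomp_truncated:
  fixes F :: "('z::finite + 'n::finite) species" and S :: "'n \<Rightarrow> 'z species"
  assumes S: "\<And>j. is_species (S j)" and F: "is_species (pcomp F (subst_family S))"
  shows "is_species (pcomp F (subst_family (\<lambda>j. srestr p (S j))))"
proof (rule is_species_embedding[OF _ F, where \<phi> = "\<lambda>U x. x"])
  show "admissible (pcomp F (subst_family (\<lambda>j. srestr p (S j))))"
    by (intro admissible_pcomp is_species_subst_family) (simp add: srestr_eq_prestr is_species_prestr S)
  show "x \<in> str (pcomp F (subst_family S)) U"
    if "x \<in> str (pcomp F (subst_family (\<lambda>j. srestr p (S j)))) U" for U x
    using that str_pcomp_truncated_subset by (rule rev_subsetD)
qed (simp_all add: trn_pcomp relabel_truncated)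

text \<open>
  With \<open>E\<close> the part of \<open>S\<close> of size greater than \<open>p\<close>, the Taylor expansion of \<open>S = H(Z, S)\<close> at \<open>Y\<close>
  reads \<open>E = D + J \<cdot> E\<close> up to size \<open>2p + 1\<close>, where \<open>D = H(Z, Y) - Y\<close>, and this linear system is
  also solved by the Newton correction.
\<close>

theorem newton_step:
  fixes H :: "'n::finite \<Rightarrow> ('z::finite + 'n) species" and S Y :: "'n \<Rightarrow> 'z species"
  assumes H: "\<And>i. is_species (H i)" and wf: "well_founded H"
    and S: "\<And>i. is_species (S i)" and fix_S: "\<And>i. S i \<cong> subst_ZY (H i) S"
    and Y: "\<And>i. iso_all (Y i) (srestr p (S i))"
  shows "iso_on (\<lambda>k. k \<le> 2 * p + 1) (newton H Y i) (S i)"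
proof -
  define T where "T = subst_family (\<lambda>j. srestr p (S j))"
  define E where "E i = prestr (\<lambda>k. p < k) (S i)" for i
  define X where "X i = subst_ZY (H i) Y" for i
  define J where "J = jacobian H Y"
  define D where "D i = sminus (X i) (Y i)" for i
  define G where "G = mat_vec (mat_geom J) D"
  have S_adm: "admissible (S i)" for i by (rule is_species_admissible[OF S])
  have E: "admissible (E i)" for i unfolding E_def by (rule admissible_prestr[OF S_adm])
  have trunc: "is_species (srestr p (S i))" for i
    unfolding srestr_eq_prestr by (rule is_species_prestr[OF S])
  have Y_sp: "is_species (Y i)" for i by (rule iso_all_is_species[OF Y trunc])
  have Y_adm: "admissible (Y i)" for i by (rule is_species_admissible[OF Y_sp])
  have S_iso: "iso_all (S i) (pcomp (H i) (subst_family S))" for i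
    by (rule iso_on_trans[OF iso_imp_iso_all[OF fix_S S_adm] subst_ZY_iso_pcomp[OF S]])
  have subst_iso: "iso_all (subst_ZY F Y) (pcomp F T)" if "is_species F" for F
  proof -
    have "iso_all (pcomp F (subst_family Y)) (pcomp F T)"
      unfolding T_def
      by (intro pcomp_cong that is_species_subst_family subst_family_iso Y_sp trunc Y)
    then show ?thesis by (rule iso_on_trans[OF subst_ZY_iso_pcomp[OF Y_sp]])
  qed
  have X_iso: "iso_all (X i) (pcomp (H i) T)" for i unfolding X_def by (rule subst_iso[OF H])
  have J_iso: "iso_all (J i j) (pcomp (spderiv (Inr j) (H i)) T)" for i j
    unfolding J_def jacobian_def by (intro subst_iso is_species_spderiv H)
  have J: "admissible (J i j)" for i j by (rule iso_on_admissible1[OF J_iso])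
  have "is_species (pcomp (H i) (subst_family S))" for i
    by (rule iso_all_is_species[OF iso_on_sym[OF S_iso] S])
  then have X_sp: "is_species (X i)" for i
    using is_species_pcomp_truncated[of S "H i" p, OF S] iso_all_is_species[OF X_iso] unfolding T_def by blast
  have X: "admissible (X i)" for i by (rule is_species_admissible[OF X_sp])
  have JE: "admissible (psum UNIV (\<lambda>j. pprod (J i j) (E j)))" for i
    by (intro admissible_psum admissible_pprod J E)
  \<comment> \<open>\<open>E\<close> starts at size p + 1, so the linear term vanishes up to size p;
    the expansion then says that H(Z, Y) agrees with \<open>S\<close> there.\<close>
  have JE_empty: "str (psum UNIV (\<lambda>j. pprod (J i j) (E j))) U = {}"
    if U: "fin_tuple U" "size_tuple U \<le> p" for i U
  proof -
    have small: "size_tuple (\<lambda>s. U s - A s) \<le> p" for A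
      using size_tuple_mono[OF U(1), of "\<lambda>s. U s - A s"] U(2) by fastforce
    have "str (E j) (\<lambda>s. U s - A s) = {}" for j A
      using small[of A] by (simp add: E_def str_prestr not_less)
    then show ?thesis by (simp add: prespecies_op_simps)
  qed
  have expansion: "iso_on (\<lambda>k. k \<le> 2 * p + 1) (S i) (pplus (X i) (psum UNIV (\<lambda>j. pprod (J i j) (E j))))" for i
  proof -
    have "iso_on (\<lambda>k. k \<le> 2 * p + 1) (S i) (pcomp (H i) (subst_family S))"
      by (rule iso_on_all[OF S_iso])
    also have "iso_on (\<lambda>k. k \<le> 2 * p + 1) \<dots> (pplus (pcomp (H i) T)
        (psum UNIV (\<lambda>j. pprod (pcomp (spderiv (Inr j) (H i)) T) (E j))))"
      unfolding T_def E_def by (rule taylor_expansion[OF H S])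
    also have "iso_on (\<lambda>k. k \<le> 2 * p + 1) \<dots> (pplus (X i) (psum UNIV (\<lambda>j. pprod (J i j) (E j))))"
      by (intro pplus_cong psum_cong pprod_cong_left iso_on_sym[OF J_iso] iso_on_all[OF iso_on_sym[OF X_iso]] E)
    finally show ?thesis .
  qed
  have X_small: "iso_on (\<lambda>k. k \<le> p) (X i) (S i)" for i
  proof -
    have "iso_on (\<lambda>k. k \<le> p) (S i) (pplus (X i) (psum UNIV (\<lambda>j. pprod (J i j) (E j))))"
      by (rule iso_on_mono[OF expansion]) simp
    also have "iso_on (\<lambda>k. k \<le> p) \<dots> (X i)"
      by (rule pplus_empty_right[OF X JE JE_empty])
    finally show ?thesis by (rule iso_on_sym)
  qed
  have D_spec: "is_species (D i) \<and> X i \<cong> splus (Y i) (D i)" for i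
  proof -
    \<comment> \<open>The difference is a choice operator, so a witness is needed: as
      \<open>X\<close> agrees with \<open>Y\<close> up to size p, its part of size greater than p is
      a complement of \<open>Y\<close>.\<close>
    let ?D = "prestr (\<lambda>k. p < k) (X i)"
    have D': "admissible ?D" by (rule admissible_prestr[OF X])
    have "iso_all (prestr (\<lambda>k. k \<le> p) (X i)) (Y i)"
      using iso_on_trans[OF iso_on_imp_prestr[OF X_small] iso_on_sym[OF Y[unfolded srestr_eq_prestr]]] .
    then have "iso_all (pplus (prestr (\<lambda>k. k \<le> p) (X i)) ?D) (pplus (Y i) ?D)"
      by (intro pplus_cong iso_on_refl D')
    from iso_on_trans[OF iso_on_trans[OF iso_split_size[OF X] this] iso_on_sym[OF splus_iso[OF Y_adm D']]]
    have "iso_all (X i) (splus (Y i) ?D)" .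
    then have "is_species ?D \<and> X i \<cong> splus (Y i) ?D"
      by (simp add: is_species_prestr X_sp iso_all_iff_iso)
    then show ?thesis unfolding D_def sminus_def by (rule someI)
  qed
  have D: "admissible (D i)" for i using D_spec is_species_admissible by blast
  have X_YD: "iso_all (X i) (pplus (Y i) (D i))" for i
    using iso_on_trans[OF iso_imp_iso_all[OF conjunct2[OF D_spec] X] splus_iso[OF Y_adm D]] .
  have Y_card: "card (str (Y i) U) = card (str (S i) U)" if "fin_tuple U" "size_tuple U \<le> p" for i U
    using iso_on_card[OF Y that(1), of i] that(2) by (simp add: srestr_eq_prestr str_prestr)
  have Y_empty: "str (Y i) U = {}" if "fin_tuple U" "p < size_tuple U" for i U
    using iso_on_nonempty[OF Y that(1), of i] that(2) by (simp add: srestr_eq_prestr str_prestr)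
  \<comment> \<open>The chosen difference need not be the witness just exhibited. Its absence in
    small sizes follows from its defining property, by cancelling cardinalities of finite
    sets.\<close>
  have D_empty: "str (D i) U = {}" if U: "fin_tuple U" "size_tuple U \<le> p" for i U
  proof -
    have fin: "finite (str (Y i) U)" "finite (str (D i) U)"
      using species_finite U(1) Y_sp D_spec by blast+
    have "card (str (X i) U) = card (str (Y i) U) + card (str (D i) U)"
      using iso_on_card[OF X_YD U(1), of i] fin by (simp add: str_pplus card_Plus)
    moreover have "card (str (X i) U) = card (str (Y i) U)"
      using iso_on_card[OF X_small U] Y_card[OF U] by simp
    ultimately show ?thesis using fin by simp
  qed
  \<comment> \<open>Up to size p both sides are empty. Above p, \<open>Y\<close> is empty, so
    \<open>X\<close> can be replaced by \<open>D\<close> in the expansion of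
    \<open>S\<close>.\<close>
  have E_eq: "iso_on (\<lambda>k. k \<le> 2 * p + 1) (E i) (pplus (D i) (psum UNIV (\<lambda>j. pprod (J i j) (E j))))" for i
  proof (rule iso_on_sizes[OF E admissible_pplus[OF D JE]])
    fix k assume k: "k \<le> 2 * p + 1"
    show "iso_on (\<lambda>l. l = k) (E i) (pplus (D i) (psum UNIV (\<lambda>j. pprod (J i j) (E j))))"
    proof (cases "k \<le> p")
      case True
      then show ?thesis
        by (intro iso_on_empty E admissible_pplus D JE)
          (simp_all add: str_pplus D_empty JE_empty, simp add: E_def str_prestr)
    next
      case False
      have "iso_on (\<lambda>l. l = k) (E i) (S i)"
        unfolding E_def using False by (intro iso_on_prestr S_adm) simp
      also have "iso_on (\<lambda>l. l = k) \<dots> (pplus (X i) (psum UNIV (\<lambda>j. pprod (J i j) (E j))))"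
        by (rule iso_on_mono[OF expansion]) (use k in simp)
      also have "iso_on (\<lambda>l. l = k) \<dots> (pplus (D i) (psum UNIV (\<lambda>j. pprod (J i j) (E j))))"
      proof (intro pplus_cong iso_on_refl JE)
        have "iso_on (\<lambda>l. l = k) (pplus (Y i) (D i)) (D i)"
          using False by (intro pplus_empty_left Y_adm D Y_empty) auto
        then show "iso_on (\<lambda>l. l = k) (X i) (D i)"
          by (rule iso_on_trans[OF iso_on_all[OF X_YD]])
      qed
      finally show ?thesis .
    qed
  qed
  have G_eq: "iso_on (\<lambda>k. k \<le> 2 * p + 1) (G i) (pplus (D i) (psum UNIV (\<lambda>j. pprod (J i j) (G j))))" for i
    unfolding G_def by (rule iso_on_all[OF mat_geom_fixpoint[OF J D]])
  have acyclic: "acyclic (dependency H S)" by (rule acyclic_dependency[OF H S S_iso wf])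
  \<comment> \<open>An assembly over the truncations is an assembly over \<open>S\<close>, so the
    size-0 entries of \<open>J\<close> are among the dependencies.\<close>
  have dep: "(i, j) \<in> dependency H S" if "str (J i j) (\<lambda>s. {}) \<noteq> {}" for i j
  proof -
    have "str (pcomp (spderiv (Inr j) (H i)) T) (\<lambda>s. {}) \<noteq> {}"
      using iso_on_nonempty[OF J_iso, of "\<lambda>s. {}" i j] that by (simp add: fin_tuple_def)
    then have "assemblies (spderiv (Inr j) (H i)) T (\<lambda>s. {}) \<noteq> {}"
      by (auto simp: str_pcomp quotient_def)
    then show ?thesis
      using truncated_assemblies_subset unfolding T_def dependency_def by blast
  qed
  \<comment> \<open>Both vectors solve the same linear system, whose acyclic part at size 0 makes
    the solution unique. In particular the infinite sum behind \<open>G\<close> is finite in these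
    sizes.\<close>
  have EG: "iso_on (\<lambda>k. k \<le> 2 * p + 1) (E i) (G i)"
    by (rule linear_system_unique[OF J D E_eq G_eq acyclic dep])
  have "newton H Y i = splus (Y i) (G i)"
    by (simp add: newton_def G_def J_def D_def[abs_def] X_def)
  also have "iso_on (\<lambda>k. k \<le> 2 * p + 1) (splus (Y i) (G i)) (pplus (Y i) (G i))"
    by (rule splus_iso[OF Y_adm iso_on_admissible2[OF EG]])
  also have "iso_on (\<lambda>k. k \<le> 2 * p + 1) \<dots> (pplus (srestr p (S i)) (E i))"
    by (rule pplus_cong[OF iso_on_all[OF Y] iso_on_sym[OF EG]])
  also have "iso_on (\<lambda>k. k \<le> 2 * p + 1) \<dots> (S i)"
    unfolding E_def srestr_eq_prestr by (rule iso_on_all[OF iso_on_sym[OF iso_split_size[OF S_adm]]])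
  finally show ?thesis .
qed

theorem mainTheorem8:
  fixes H :: "'n::finite \<Rightarrow> ('z::finite + 'n) species"
    and S :: "'n \<Rightarrow> 'z species"
    and m :: nat
  assumes "\<And>i. is_species (H i)"
    and "well_founded H"
    and "\<And>i. is_species (S i)"
    and "\<And>i. S i \<cong> subst_ZY (H i) S"
    and "\<And>i. at_zero (S i) \<cong> iter_0 H m i"
  shows "\<forall>n i. contact (2 ^ n - 1) (newton_iter H (\<lambda>j. at_zero (S j)) n i) (S i)"
proof -
  have S_adm: "admissible (S i)" for i by (rule is_species_admissible[OF assms(3)])
  \<comment> \<open>Stronger than contact: the iterate is isomorphic to the whole truncation, hence
    has no structure above the bound. The induction needs this, since the Newton step requires
    \<open>Y\<close> to vanish in sizes above p.\<close>
  have *: "iso_all (newton_iter H (\<lambda>j. at_zero (S j)) n i) (srestr (2 ^ n - 1) (S i))" for n i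
  proof (induction n arbitrary: i)
    case 0
    \<comment> \<open>For n = 0 the bound is 0, so the initial value is literally the
      truncation.\<close>
    show ?case by (simp add: srestr_eq_prestr iso_on_refl admissible_prestr S_adm)
  next
    case (Suc n)
    have "(1 :: nat) \<le> 2 ^ n" by simp
    \<comment> \<open>With p = 2^n - 1, the range 2p + 1 of the Newton step is exactly the size at
      which the next iterate is truncated. The inequality above is needed because subtraction is on
      natural numbers.\<close>
    then have "2 * (2 ^ n - 1) + 1 = 2 ^ (n + 1) - (1 :: nat)" unfolding power_add power_one_right by arith
    then have "iso_on (\<lambda>k. k \<le> 2 ^ (n + 1) - 1) (newton H (newton_iter H (\<lambda>j. at_zero (S j)) n) i) (S i)"
      using newton_step[OF assms(1-4) Suc.IH, of i] by simp
    from iso_on_imp_prestr[OF this] show ?case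
      unfolding newton_iter.simps srestr_eq_prestr by (simp only: Suc_eq_plus1)
  qed
  show ?thesis
  proof (intro allI)
    fix n i
    let ?Y = "newton_iter H (\<lambda>j. at_zero (S j)) n i"
    have "iso_on (\<lambda>k. k \<le> 2 ^ n - 1) ?Y (srestr (2 ^ n - 1) (S i))" by (rule iso_on_all[OF *])
    also have "iso_on (\<lambda>k. k \<le> 2 ^ n - 1) \<dots> (S i)"
      unfolding srestr_eq_prestr by (rule iso_on_prestr[OF S_adm])
    finally show "contact (2 ^ n - 1) ?Y (S i)"
      using contact_iff_iso_on iso_on_admissible1 S_adm by blast
  qed
qed

end
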